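(* Let $0<r\leq 1$, $\alpha>\frac{4}{r}$ and $1\leq p<\infty$. Let $\mathcal L_{sub}=D_1^2+D_2^2$ be the sub-Laplacian on $\mathrm{SO}(3)$. Then the operator $(I-\mathcal L_{sub})^{-\frac{\alpha}{2}}$ is $r$-nuclear on $L^p(\mathrm{SO}(3))$. The same conclusion holds for the same powers of the sub-Laplacian on $L^p(\mathrm{SU}(2))$ or on $L^p(\mathbb S^3)$.
   Context: The groups carry normalised Haar measure. The unitary dual of $\mathrm{SO}(3)$ is $\{[t^\ell]:\ell\in\mathbb N_0\}$, and that of $\mathrm{SU}(2)$ is $\{[t^\ell]:\ell\in\frac12\mathbb N_0\}$, with $t^\ell$ unitary of dimension $2\ell+1$, with rows and columns indexed by $m,n\in\{-\ell,-\ell+1,\dots,\ell\}$. The matrix-valued symbol of an operator $A$ is $\sigma_A(x,\ell)=t^\ell(x)^*(At^\ell)(x)$, where $A$ is applied entrywise. $D_1,D_2,D_3$ are the invariant vector fields on the group corresponding to derivatives with respect to the Euler angles; with an appropriate choice of basis in the representation spaces, the sub-Laplacian $\mathcal L_{sub}=D_1^2+D_2^2$ has the $x$-independent diagonal symbol $\sigma_{\mathcal L_{sub}}(\ell)_{mn}=(m^2-\ell(\ell+1))\delta_{mn}$. The power $(I-\mathcal L_{sub})^{-\alpha/2}$ is the left-invariant operator with symbol $(1+\ell(\ell+1)-m^2)^{-\alpha/2}\delta_{mn}$, i.e. $f\mapsto\sum_\ell(2\ell+1)\operatorname{Tr}(t^\ell(x)\sigma(\ell)\widehat f(\ell))$ with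 $\widehat f(\ell)=\int f(x)t^\ell(x)^*dx$ and $\sigma(\ell)$ this diagonal matrix. The sphere $\mathbb S^3$ is identified with $\mathrm{SU}(2)$ (quaternionic product corresponding to matrix multiplication), with the operator transported accordingly. For $0<r\le1$ and a Banach space $E$, a linear operator $T:E\to E$ is $r$-nuclear if there are sequences $(x_n')$ in $E'$ and $(y_n)$ in $E$ with $Tx=\sum_{n=1}^\infty\langle x,x_n'\rangle y_n$ for all $x\in E$ and $\sum_{n=1}^\infty\|x_n'\|_{E'}^r\|y_n\|_E^r<\infty$. *)

theory Defs
  imports
    "HOL-Analysis.Analysis"
    "HOL-Probability.Probability"
    "HOL-Library.Function_Algebras"
    "HOL-Computational_Algebra.Polynomial"
begin

section \<open>Nuclear operators\<close>

text \<open>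
  A complex Banach space \<open>E\<close> is presented by a complex vector space \<open>V\<close> of representatives (with
  scalar multiplication \<open>scl\<close>) and a seminorm \<open>N\<close> on it, so that \<open>E\<close> is \<open>V\<close> modulo \<open>{x. N x = 0}\<close>.
  Vectors are identified when \<open>N (x - y) = 0\<close>. Bounded functionals on \<open>(V, N)\<close> vanish on the null
  vectors, so they are exactly the elements of the dual of \<open>E\<close>, with the same norm.
\<close>

definition bounded_functionals ::
  "(complex \<Rightarrow> 'v \<Rightarrow> 'v) \<Rightarrow> 'v::ab_group_add set \<Rightarrow> ('v \<Rightarrow> real) \<Rightarrow> ('v \<Rightarrow> complex) set" where
  "bounded_functionals scl V N =
     {\<phi>. (\<forall>x\<in>V. \<forall>y\<in>V. \<phi> (x + y) = \<phi> x + \<phi> y) \<and>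
         (\<forall>c. \<forall>x\<in>V. \<phi> (scl c x) = c * \<phi> x) \<and>
         (\<exists>C. \<forall>x\<in>V. cmod (\<phi> x) \<le> C * N x)}"

definition dual_norm :: "'v set \<Rightarrow> ('v \<Rightarrow> real) \<Rightarrow> ('v \<Rightarrow> complex) \<Rightarrow> real" where
  "dual_norm V N \<phi> = (SUP x\<in>{x\<in>V. N x \<le> 1}. cmod (\<phi> x))"

definition linear_operator ::
  "(complex \<Rightarrow> 'v \<Rightarrow> 'v) \<Rightarrow> 'v::ab_group_add set \<Rightarrow> ('v \<Rightarrow> real) \<Rightarrow> ('v \<Rightarrow> 'v) \<Rightarrow> bool" where
  "linear_operator scl V N T \<longleftrightarrow>
     (\<forall>x\<in>V. T x \<in> V) \<and>
     (\<forall>x\<in>V. \<forall>y\<in>V. N (x - y) = 0 \<longrightarrow> N (T x - T y) = 0) \<and>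
     (\<forall>x\<in>V. \<forall>y\<in>V. N (T (x + y) - (T x + T y)) = 0) \<and>
     (\<forall>c. \<forall>x\<in>V. N (T (scl c x) - scl c (T x)) = 0)"

definition r_nuclear ::
  "real \<Rightarrow> (complex \<Rightarrow> 'v \<Rightarrow> 'v) \<Rightarrow> 'v::ab_group_add set \<Rightarrow> ('v \<Rightarrow> real) \<Rightarrow> ('v \<Rightarrow> 'v) \<Rightarrow> bool" where
  "r_nuclear r scl V N T \<longleftrightarrow>
     linear_operator scl V N T \<and>
     (\<exists>(\<phi> :: nat \<Rightarrow> 'v \<Rightarrow> complex) (y :: nat \<Rightarrow> 'v).
        (\<forall>n. \<phi> n \<in> bounded_functionals scl V N) \<and>
        (\<forall>n. y n \<in> V) \<and>
        (\<forall>x\<in>V. (\<lambda>k. N (T x - (\<Sum>n<k. scl (\<phi> n x) (y n)))) \<longlonglongrightarrow> 0) \<and>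
        summable (\<lambda>n. dual_norm V N (\<phi> n) powr r * N (y n) powr r))"

definition Lp_space :: "real \<Rightarrow> 'a measure \<Rightarrow> ('a \<Rightarrow> complex) set" where
  "Lp_space p \<mu> = {f \<in> borel_measurable \<mu>. integrable \<mu> (\<lambda>x. cmod (f x) powr p)}"

definition Lp_norm :: "real \<Rightarrow> 'a measure \<Rightarrow> ('a \<Rightarrow> complex) \<Rightarrow> real" where
  "Lp_norm p \<mu> f = (\<integral>x. cmod (f x) powr p \<partial>\<mu>) powr (1 / p)"

definition r_nuclear_on_Lp ::
  "real \<Rightarrow> real \<Rightarrow> 'a measure \<Rightarrow> (('a \<Rightarrow> complex) \<Rightarrow> 'a \<Rightarrow> complex) \<Rightarrow> bool" where
  "r_nuclear_on_Lp r p \<mu> T \<longleftrightarrow>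
     r_nuclear r (\<lambda>c f x. c * f x) (Lp_space p \<mu>) (Lp_norm p \<mu>) T"


section \<open>The groups\<close>

definition adjoint_mat :: "complex^'n^'m \<Rightarrow> complex^'m^'n" where
  "adjoint_mat A = (\<chi> i j. cnj (A $ j $ i))"

definition SU2 :: "(complex^2^2) set" where
  "SU2 = {u. u ** adjoint_mat u = mat 1 \<and> det u = 1}"

definition SO3 :: "(real^3^3) set" where
  "SO3 = {R. orthogonal_matrix R \<and> det R = 1}"

definition S3 :: "(real^4) set" where
  "S3 = sphere 0 1"

text \<open>The quaternion \<open>a + b i + c j + d k\<close> is the vector \<open>(a, b, c, d)\<close>.\<close>

definition quat_mult :: "real^4 \<Rightarrow> real^4 \<Rightarrow> real^4" where
  "quat_mult x y = vector
     [x$1 * y$1 - x$2 * y$2 - x$3 * y$3 - x$4 * y$4,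
      x$1 * y$2 + x$2 * y$1 + x$3 * y$4 - x$4 * y$3,
      x$1 * y$3 - x$2 * y$4 + x$3 * y$1 + x$4 * y$2,
      x$1 * y$4 + x$2 * y$3 - x$3 * y$2 + x$4 * y$1]"

text \<open>Turns \<open>quat_mult\<close> into the matrix product and maps \<open>S3\<close> bijectively onto \<open>SU2\<close>.\<close>

definition quat_to_SU2 :: "real^4 \<Rightarrow> complex^2^2" where
  "quat_to_SU2 x = vector
     [vector [Complex (x$1) (x$4), Complex (x$2) (x$3)],
      vector [Complex (- (x$2)) (x$3), Complex (x$1) (- (x$4))]]"

text \<open>On a compact group a left-invariant Borel probability measure is automatically
  right-invariant and is unique, so this predicate determines \<open>\<mu>\<close>.\<close>

definition normalized_haar :: "'a::topological_space set \<Rightarrow> ('a \<Rightarrow> 'a \<Rightarrow> 'a) \<Rightarrow> 'a measure \<Rightarrow> bool" where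
  "normalized_haar G mul \<mu> \<longleftrightarrow>
     sets \<mu> = sets (restrict_space borel G) \<and> prob_space \<mu> \<and>
     (\<forall>g\<in>G. distr \<mu> \<mu> (mul g) = \<mu>)"


section \<open>Irreducible representations\<close>

text \<open>
  The half-integer \<open>\<ell>\<close> is encoded by \<open>k = 2\<ell>\<close>, and row or column indices \<open>m \<in> {-\<ell>, \<dots>, \<ell>}\<close> by
  \<open>i = \<ell> + m \<in> {0, \<dots>, k}\<close>, so that \<open>\<ell> - m = k - i\<close>.

  \<open>SU2\<close> acts on homogeneous polynomials of degree \<open>2\<ell>\<close> in \<open>z = (z\<^sub>1, z\<^sub>2)\<close> by
  \<open>(T\<^sub>\<ell>(u) f)(z) = f(z u)\<close>, and \<open>t\<^sup>\<ell>(u)\<close> is the matrix of \<open>T\<^sub>\<ell>(u)\<close> in the orthonormal basis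
  \<open>q\<^sub>m = z\<^sub>1^(\<ell>-m) z\<^sub>2^(\<ell>+m) / sqrt ((\<ell>-m)! (\<ell>+m)!)\<close>. Its \<open>(m, n)\<close> entry comes from the coefficient of
  \<open>z\<^sub>1^(\<ell>-m) z\<^sub>2^(\<ell>+m)\<close> in \<open>(z\<^sub>1 u\<^sub>1\<^sub>1 + z\<^sub>2 u\<^sub>2\<^sub>1)^(\<ell>-n) (z\<^sub>1 u\<^sub>1\<^sub>2 + z\<^sub>2 u\<^sub>2\<^sub>2)^(\<ell>+n)\<close>,
  read off below after putting \<open>z\<^sub>2 = 1\<close>.
\<close>

definition rep_SU2 :: "nat \<Rightarrow> complex^2^2 \<Rightarrow> nat \<Rightarrow> nat \<Rightarrow> complex" where
  "rep_SU2 k u i j =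
     of_real (sqrt (fact (k - i) * fact i / (fact (k - j) * fact j))) *
     coeff ([: u$2$1, u$1$1 :] ^ (k - j) * [: u$2$2, u$1$2 :] ^ j) (k - i)"

definition pauli :: "3 \<Rightarrow> complex^2^2" where
  "pauli a =
     (if a = 1 then vector [vector [0, 1], vector [1, 0]]
      else if a = 2 then vector [vector [0, - \<i>], vector [\<i>, 0]]
      else vector [vector [1, 0], vector [0, - 1]])"

text \<open>The double cover, i.e. the adjoint action: \<open>u \<sigma>\<^sub>b u\<^sup>* = (\<Sum>a. R\<^sub>a\<^sub>b \<sigma>\<^sub>a)\<close>.\<close>

definition SU2_to_SO3 :: "complex^2^2 \<Rightarrow> real^3^3" where
  "SU2_to_SO3 u = (\<chi> a b. Re (trace (pauli a ** u ** pauli b ** adjoint_mat u)) / 2)"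

text \<open>For integer \<open>\<ell>\<close>, i.e. even \<open>k\<close>, \<open>rep_SU2 k\<close> agrees on the two preimages \<open>u\<close> and \<open>-u\<close> of a
  rotation, so the choice is immaterial.\<close>

definition rep_SO3 :: "nat \<Rightarrow> real^3^3 \<Rightarrow> nat \<Rightarrow> nat \<Rightarrow> complex" where
  "rep_SO3 k R = rep_SU2 k (SOME u. u \<in> SU2 \<and> SU2_to_SO3 u = R)"


section \<open>Symbols and quantization\<close>

text \<open>\<open>t k x\<close> is the matrix \<open>t\<^sup>\<ell>(x)\<close> with \<open>k = 2\<ell>\<close>.\<close>

definition op_symbol ::
  "(nat \<Rightarrow> 'a \<Rightarrow> nat \<Rightarrow> nat \<Rightarrow> complex) \<Rightarrow> (('a \<Rightarrow> complex) \<Rightarrow> 'a \<Rightarrow> complex) \<Rightarrow>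
   'a \<Rightarrow> nat \<Rightarrow> nat \<Rightarrow> nat \<Rightarrow> complex" where
  "op_symbol t A x k i j = (\<Sum>h\<le>k. cnj (t k x h i) * A (\<lambda>y. t k y h j) x)"

definition fourier_coeff ::
  "(nat \<Rightarrow> 'a \<Rightarrow> nat \<Rightarrow> nat \<Rightarrow> complex) \<Rightarrow> 'a measure \<Rightarrow> ('a \<Rightarrow> complex) \<Rightarrow>
   nat \<Rightarrow> nat \<Rightarrow> nat \<Rightarrow> complex" where
  "fourier_coeff t \<mu> f k i j = (\<integral>x. f x * cnj (t k x j i) \<partial>\<mu>)"

text \<open>\<open>\<Sum>\<^sub>\<ell> (2\<ell>+1) Tr (t\<^sup>\<ell>(x) \<sigma>(x,\<ell>) f\<^sup>^(\<ell>))\<close>, where \<open>K\<close> is the set of \<open>k = 2\<ell>\<close> that index the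
  unitary dual.\<close>

definition quantization ::
  "nat set \<Rightarrow> (nat \<Rightarrow> 'a \<Rightarrow> nat \<Rightarrow> nat \<Rightarrow> complex) \<Rightarrow> 'a measure \<Rightarrow>
   ('a \<Rightarrow> nat \<Rightarrow> nat \<Rightarrow> nat \<Rightarrow> complex) \<Rightarrow> ('a \<Rightarrow> complex) \<Rightarrow> 'a \<Rightarrow> complex" where
  "quantization K t \<mu> \<sigma> f x =
     (\<Sum>\<^sub>\<infinity>k\<in>K. of_nat (k + 1) *
        (\<Sum>i\<le>k. \<Sum>j\<le>k. \<Sum>h\<le>k. t k x i j * \<sigma> x k j h * fourier_coeff t \<mu> f k h i))"

text \<open>For an operator \<open>A\<close> with diagonal symbol, \<open>(I - A)^(-\<alpha>/2)\<close> is the operator whose symbol is the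
  corresponding power of the diagonal matrix \<open>I - \<sigma>\<^sub>A(x,\<ell>)\<close>.\<close>

definition neg_power_symbol ::
  "(nat \<Rightarrow> 'a \<Rightarrow> nat \<Rightarrow> nat \<Rightarrow> complex) \<Rightarrow> (('a \<Rightarrow> complex) \<Rightarrow> 'a \<Rightarrow> complex) \<Rightarrow> real \<Rightarrow>
   'a \<Rightarrow> nat \<Rightarrow> nat \<Rightarrow> nat \<Rightarrow> complex" where
  "neg_power_symbol t A \<alpha> x k i j =
     (if i = j then (1 - op_symbol t A x k i i) powr of_real (- \<alpha> / 2) else 0)"


section \<open>Sub-Laplacians\<close>

text \<open>The left-invariant vector field generated by the one-parameter subgroup \<open>\<gamma>\<close>.\<close>

definition invariant_field ::
  "('a \<Rightarrow> 'a \<Rightarrow> 'a) \<Rightarrow> (real \<Rightarrow> 'a) \<Rightarrow> ('a \<Rightarrow> complex) \<Rightarrow> 'a \<Rightarrow> complex" where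
  "invariant_field mul \<gamma> f x = vector_derivative (\<lambda>s. f (mul x (\<gamma> s))) (at 0)"

definition sub_laplacian ::
  "('a \<Rightarrow> 'a \<Rightarrow> 'a) \<Rightarrow> (real \<Rightarrow> 'a) \<Rightarrow> (real \<Rightarrow> 'a) \<Rightarrow> ('a \<Rightarrow> complex) \<Rightarrow> 'a \<Rightarrow> complex" where
  "sub_laplacian mul \<gamma>1 \<gamma>2 f x =
     invariant_field mul \<gamma>1 (invariant_field mul \<gamma>1 f) x +
     invariant_field mul \<gamma>2 (invariant_field mul \<gamma>2 f) x"

text \<open>
  The one-parameter subgroups of the first two Euler rotations. The third one is
  \<open>diag (exp (i s/2), exp (-i s/2))\<close> in \<open>SU2\<close>, respectively the rotation about the third axis in \<open>SO3\<close>;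
  it is diagonalized by the representations above. Consequently both sub-Laplacians below have the
  symbol \<open>\<sigma>(\<ell>)\<^sub>m\<^sub>n = (m^2 - \<ell> (\<ell>+1)) \<delta>\<^sub>m\<^sub>n\<close>.
\<close>

definition omega1 :: "real \<Rightarrow> complex^2^2" where
  "omega1 s = vector [vector [of_real (cos (s/2)), \<i> * of_real (sin (s/2))],
                      vector [\<i> * of_real (sin (s/2)), of_real (cos (s/2))]]"

definition omega2 :: "real \<Rightarrow> complex^2^2" where
  "omega2 s = vector [vector [of_real (cos (s/2)), - of_real (sin (s/2))],
                      vector [of_real (sin (s/2)), of_real (cos (s/2))]]"

definition rot1 :: "real \<Rightarrow> real^3^3" where
  "rot1 s = vector [vector [1, 0, 0],
                    vector [0, cos s, - sin s],
                    vector [0, sin s, cos s]]"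

definition rot2 :: "real \<Rightarrow> real^3^3" where
  "rot2 s = vector [vector [cos s, 0, sin s],
                    vector [0, 1, 0],
                    vector [- sin s, 0, cos s]]"

definition sub_laplacian_SU2 :: "(complex^2^2 \<Rightarrow> complex) \<Rightarrow> complex^2^2 \<Rightarrow> complex" where
  "sub_laplacian_SU2 = sub_laplacian (**) omega1 omega2"

definition sub_laplacian_SO3 :: "(real^3^3 \<Rightarrow> complex) \<Rightarrow> real^3^3 \<Rightarrow> complex" where
  "sub_laplacian_SO3 = sub_laplacian (**) rot1 rot2"

text \<open>In the following, \<open>\<mu>\<close> is the normalized Haar measure of the respective group, and the operators
  are \<open>(I - L\<^sub>s\<^sub>u\<^sub>b)^(-\<alpha>/2)\<close>.\<close>

definition sub_power_SU2 ::
  "(complex^2^2) measure \<Rightarrow> real \<Rightarrow> (complex^2^2 \<Rightarrow> complex) \<Rightarrow> complex^2^2 \<Rightarrow> complex" where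
  "sub_power_SU2 \<mu> \<alpha> =
     quantization UNIV rep_SU2 \<mu> (neg_power_symbol rep_SU2 sub_laplacian_SU2 \<alpha>)"

definition sub_power_SO3 ::
  "(real^3^3) measure \<Rightarrow> real \<Rightarrow> (real^3^3 \<Rightarrow> complex) \<Rightarrow> real^3^3 \<Rightarrow> complex" where
  "sub_power_SO3 \<mu> \<alpha> =
     quantization {k. even k} rep_SO3 \<mu> (neg_power_symbol rep_SO3 sub_laplacian_SO3 \<alpha>)"

definition sub_power_S3 ::
  "(real^4) measure \<Rightarrow> real \<Rightarrow> (real^4 \<Rightarrow> complex) \<Rightarrow> real^4 \<Rightarrow> complex" where
  "sub_power_S3 \<mu> \<alpha> f x =
     sub_power_SU2 (distr \<mu> (restrict_space borel SU2) quat_to_SU2) \<alpha>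
       (f \<circ> inv_into S3 quat_to_SU2) (quat_to_SU2 x)"

end

theory Submission
  imports Defs
begin

text \<open>
  On \<open>L\<^sup>p\<close> the operator is the sum of the rank-one pieces
  \<open>f \<mapsto> (k + 1) \<Lambda>\<^sub>k\<^sub>j^(-\<alpha>/2) (\<integral> f cnj t\<^sub>i\<^sub>j) t\<^sub>i\<^sub>j\<close>, where \<open>\<Lambda>\<^sub>k\<^sub>j = 1 + \<ell>(\<ell>+1) - m\<^sup>2\<close>. Interpolating between
  \<open>L\<^sup>1\<close> and \<open>L\<^sup>\<infinity>\<close>, the product of the \<open>L\<^sup>p\<close> norm and the dual norm of such a piece is at most its
  coefficient times \<open>A\<^sub>i\<^sub>j B\<^sub>i\<^sub>j\<close>, with \<open>A\<close> and \<open>B\<close> the \<open>L\<^sup>\<infinity>\<close> and \<open>L\<^sup>1\<close> norms of \<open>t\<^sub>i\<^sub>j\<close>. The point is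
  that \<open>\<Sum>\<^sub>i A\<^sub>i\<^sub>j B\<^sub>i\<^sub>j \<le> C * sqrt (\<Lambda>\<^sub>k\<^sub>j / (k + 1))\<close>, which is as good as orthogonality in \<open>L\<^sup>2\<close> up to a factor
  that the decay of \<open>\<Lambda>\<^sub>k\<^sub>j^(-\<alpha>/2)\<close> away from \<open>\<bar>m\<bar> = \<ell>\<close> absorbs. Columns of a unitary matrix being unit
  vectors, a one-dimensional Sobolev estimate along a torus in the direction of the second generator
  gives \<open>\<Sum>\<^sub>i A\<^sub>i\<^sub>j\<^sup>2 \<le> C * sqrt \<Lambda>\<^sub>k\<^sub>j\<close>. Conjugating the diagonal generator by \<open>u\<close> shows that the \<open>j\<close>-th column of
  \<open>t(u)\<close> has second moment at most \<open>\<Lambda>\<^sub>k\<^sub>j\<close> around the row determined by \<open>1 - 2 \<bar>u\<^sub>1\<^sub>2\<bar>\<^sup>2\<close>; as this quantity is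
  uniformly distributed on \<open>[-1, 1]\<close>, a weighted Cauchy-Schwarz inequality gives
  \<open>\<Sum>\<^sub>i B\<^sub>i\<^sub>j\<^sup>2 \<le> C * sqrt \<Lambda>\<^sub>k\<^sub>j / (k + 1)\<close>.
\<close>

section \<open>Nuclear operators on \<open>L\<^sup>p\<close>\<close>

text \<open>The hypothesis on \<alpha> is used up in the last summation. The mean over the rows i of
  the cost of a column is of order \<Lambda>^(-\<alpha>/2) sqrt (\<Lambda> / (k + 1)), and the sum
  over the columns is dominated by |m| near l, where \<Lambda> is of order k + 1. Level k then
  contributes at most a multiple of (k + 1)^(1 - \<alpha> r / 2), which is summable precisely if
  \<alpha> > 4/r. Bounding both norms of t_ij by 1 would require \<alpha> > 4/r + 2, and bounding
  only the L^1 norm by (k + 1)^(-1/2) would still require \<alpha> > 4/r + 1. This is why the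
  estimates have to see \<Lambda> and are made for whole columns. The operator is defined pointwise
  by an unordered sum over levels, so two kinds of convergence are kept apart: the levels converge
  absolutely at every point, which makes the image of f measurable, while the separate entries are
  shown to converge absolutely almost everywhere, which is enough to identify the two sums in
  L^p.\<close>

lemma convex_on_powr_nonneg:
  assumes "1 \<le> p"
  shows "convex_on {0..} (\<lambda>x::real. x powr p)"
proof (rule convex_onI)
  fix t x y :: real
  assume t: "0 < t" "t < 1" and xy: "x \<in> {0..}" "y \<in> {0..}"
  have le: "s powr p \<le> s" if "0 < s" "s < 1" for s :: real
    using powr_mono'[of 1 p s] that assms by simp
  show "((1 - t) *\<^sub>R x + t *\<^sub>R y) powr p \<le> (1 - t) * x powr p + t * y powr p"
  proof (cases "x = 0 \<or> y = 0")
    case True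
    then show ?thesis
    proof
      assume "x = 0"
      then show ?thesis using t xy le[of t] by (simp add: powr_mult mult_right_mono)
    next
      assume "y = 0"
      then show ?thesis using t xy le[of "1 - t"] by (simp add: powr_mult mult_right_mono)
    qed
  next
    case False
    then show ?thesis
      using convex_onD[OF powr_convex[OF assms], of t x y] t xy by auto
  qed
qed auto

text \<open>Minkowski's inequality with prescribed majorants \<open>a i\<close> in place of the
  norms. It is Jensen's inequality for s^p, applied to the numbers |g_i| / a_i with weights a_i / S.
  Positive majorants avoid a case distinction on vanishing norms.\<close>

lemma Lp_sum_bound:
  fixes g :: "'i \<Rightarrow> 'a \<Rightarrow> complex"
  assumes p: "1 \<le> p" and fin: "finite F"
    and a: "\<And>i. i \<in> F \<Longrightarrow> 0 < a i"
    and meas: "\<And>i. i \<in> F \<Longrightarrow> g i \<in> borel_measurable M"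
    and int: "\<And>i. i \<in> F \<Longrightarrow> integrable M (\<lambda>x. cmod (g i x) powr p)"
    and le: "\<And>i. i \<in> F \<Longrightarrow> (\<integral>x. cmod (g i x) powr p \<partial>M) \<le> a i powr p"
  shows "integrable M (\<lambda>x. cmod (\<Sum>i\<in>F. g i x) powr p)"
    and "(\<integral>x. cmod (\<Sum>i\<in>F. g i x) powr p \<partial>M) \<le> (\<Sum>i\<in>F. a i) powr p"
proof -
  define S where "S = (\<Sum>i\<in>F. a i)"
  define c where "c i = S powr p * (a i / S) / a i powr p" for i
  have pw: "cmod (\<Sum>i\<in>F. g i x) powr p \<le> (\<Sum>i\<in>F. c i * cmod (g i x) powr p)" for x
  proof (cases "F = {}")
    case False
    have S: "0 < S" unfolding S_def using fin False a by (intro sum_pos) auto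
    have "(\<Sum>i\<in>F. a i / S) = 1"
      using S unfolding S_def by (simp flip: sum_divide_distrib)
    then have conv: "(\<Sum>i\<in>F. (a i / S) *\<^sub>R (cmod (g i x) / a i)) powr p
        \<le> (\<Sum>i\<in>F. (a i / S) * (cmod (g i x) / a i) powr p)"
      using fin False a S less_imp_le
      by (intro convex_on_sum[OF _ _ convex_on_powr_nonneg[OF p]]) (auto intro!: divide_nonneg_pos)
    have "(\<Sum>i\<in>F. (a i / S) *\<^sub>R (cmod (g i x) / a i)) = (\<Sum>i\<in>F. cmod (g i x)) / S"
      unfolding sum_divide_distrib using a S by (intro sum.cong) (fastforce simp: field_simps)+
    then have "(\<Sum>i\<in>F. cmod (g i x)) powr p = S powr p * (\<Sum>i\<in>F. (a i / S) *\<^sub>R (cmod (g i x) / a i)) powr p"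
      using S by (simp add: powr_divide sum_nonneg)
    also have "\<dots> \<le> S powr p * (\<Sum>i\<in>F. (a i / S) * (cmod (g i x) / a i) powr p)"
      using conv by (intro mult_left_mono) auto
    also have "\<dots> = (\<Sum>i\<in>F. c i * cmod (g i x) powr p)"
      unfolding sum_distrib_left c_def
    proof (intro sum.cong refl)
      fix i assume "i \<in> F"
      then show "S powr p * (a i / S * (cmod (g i x) / a i) powr p) =
         S powr p * (a i / S) / a i powr p * cmod (g i x) powr p"
        using a[of i] by (simp add: powr_divide)
    qed
    finally have "(\<Sum>i\<in>F. cmod (g i x)) powr p \<le> (\<Sum>i\<in>F. c i * cmod (g i x) powr p)" .
    moreover have "cmod (\<Sum>i\<in>F. g i x) powr p \<le> (\<Sum>i\<in>F. cmod (g i x)) powr p"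
      using p by (intro powr_mono2 norm_sum) auto
    ultimately show ?thesis by linarith
  qed simp
  have int_sum: "integrable M (\<lambda>x. \<Sum>i\<in>F. c i * cmod (g i x) powr p)"
    using int by auto
  show int': "integrable M (\<lambda>x. cmod (\<Sum>i\<in>F. g i x) powr p)"
    by (rule Bochner_Integration.integrable_bound[OF int_sum])
       (use meas pw in \<open>auto intro!: AE_I2 order_trans[OF pw] borel_measurable_sum\<close>)
  show "(\<integral>x. cmod (\<Sum>i\<in>F. g i x) powr p \<partial>M) \<le> (\<Sum>i\<in>F. a i) powr p"
  proof (cases "F = {}")
    case False
    have S: "0 < S" unfolding S_def using fin False a by (intro sum_pos) auto
    have c0: "0 \<le> c i" if "i \<in> F" for i using a[OF that] S by (simp add: c_def)
    have "(\<integral>x. cmod (\<Sum>i\<in>F. g i x) powr p \<partial>M) \<le> (\<integral>x. (\<Sum>i\<in>F. c i * cmod (g i x) powr p) \<partial>M)"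
      by (intro integral_mono int' int_sum pw)
    also have "\<dots> = (\<Sum>i\<in>F. c i * (\<integral>x. cmod (g i x) powr p \<partial>M))"
      using int by (subst Bochner_Integration.integral_sum) auto
    also have "\<dots> \<le> (\<Sum>i\<in>F. c i * a i powr p)"
      using le c0 by (intro sum_mono mult_left_mono) auto
    also have "\<dots> = (\<Sum>i\<in>F. S powr p * (a i / S))"
      using a by (intro sum.cong) (fastforce simp: c_def)+
    also have "\<dots> = S powr p"
      using S unfolding sum_distrib_left[symmetric] sum_divide_distrib[symmetric] S_def by simp
    finally show ?thesis by (simp add: S_def)
  qed simp
qed

text \<open>Fatou's lemma applied to the finite sections of the series that start at N. The case N =
  0 puts the sum into L^p, and the bound tending to 0 with N gives convergence in norm.\<close>

lemma Lp_series_tail_bound: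
  fixes g :: "nat \<Rightarrow> 'a \<Rightarrow> complex"
  assumes p: "1 \<le> p"
    and b: "\<And>n. 0 < b n" "summable b"
    and meas [measurable]: "\<And>n. g n \<in> borel_measurable M" "G \<in> borel_measurable M"
    and int: "\<And>n. integrable M (\<lambda>x. cmod (g n x) powr p)"
    and le: "\<And>n. (\<integral>x. cmod (g n x) powr p \<partial>M) \<le> b n powr p"
    and lim: "AE x in M. (\<lambda>m. \<Sum>n<m. g n x) \<longlonglongrightarrow> G x"
  shows "integrable M (\<lambda>x. cmod (G x - (\<Sum>n<N. g n x)) powr p)"
    and "(\<integral>x. cmod (G x - (\<Sum>n<N. g n x)) powr p \<partial>M) \<le> (\<Sum>n. b (n + N)) powr p"
proof -
  define u where "u m x = ennreal (cmod (\<Sum>n\<in>{N..<N+m}. g n x) powr p)" for m x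
  have "(\<integral>\<^sup>+x. ennreal (cmod (G x - (\<Sum>n<N. g n x)) powr p) \<partial>M) = (\<integral>\<^sup>+x. liminf (\<lambda>m. u m x) \<partial>M)"
  proof (rule nn_integral_cong_AE, use lim in eventually_elim)
    fix x assume lim: "(\<lambda>m. \<Sum>n<m. g n x) \<longlonglongrightarrow> G x"
    have "(\<Sum>n<m + N. g n x) - (\<Sum>n<N. g n x) = (\<Sum>n\<in>{N..<N+m}. g n x)" for m
      unfolding lessThan_atLeast0 using sum.atLeastLessThan_concat[of 0 N "N + m" "\<lambda>n. g n x"]
      by (simp add: add.commute algebra_simps)
    moreover have "(\<lambda>m. (\<Sum>n<m + N. g n x) - (\<Sum>n<N. g n x)) \<longlonglongrightarrow> G x - (\<Sum>n<N. g n x)"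
      using lim by (intro tendsto_intros LIMSEQ_ignore_initial_segment)
    ultimately have "(\<lambda>m. \<Sum>n\<in>{N..<N+m}. g n x) \<longlonglongrightarrow> G x - (\<Sum>n<N. g n x)" by simp
    then have "(\<lambda>m. u m x) \<longlonglongrightarrow> ennreal (cmod (G x - (\<Sum>n<N. g n x)) powr p)"
      unfolding u_def using p by (intro tendsto_ennrealI tendsto_powr2 tendsto_norm) auto
    then show "ennreal (cmod (G x - (\<Sum>n<N. g n x)) powr p) = liminf (\<lambda>m. u m x)"
      by (simp add: lim_imp_Liminf)
  qed
  also have "\<dots> \<le> liminf (\<lambda>m. \<integral>\<^sup>+x. u m x \<partial>M)"
    by (intro nn_integral_liminf) (auto simp: u_def)
  also have "\<dots> \<le> liminf (\<lambda>m::nat. ennreal ((\<Sum>n. b (n + N)) powr p))"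
  proof (rule Liminf_mono, rule always_eventually, rule allI)
    fix m
    have "(\<integral>\<^sup>+x. u m x \<partial>M) = ennreal (\<integral>x. cmod (\<Sum>n\<in>{N..<N+m}. g n x) powr p \<partial>M)"
      unfolding u_def
      by (intro nn_integral_eq_integral Lp_sum_bound(1)[OF p, where a=b]) (use b int le in auto)
    also have "\<dots> \<le> ennreal ((\<Sum>n\<in>{N..<N+m}. b n) powr p)"
      by (intro ennreal_leI Lp_sum_bound(2)[OF p]) (use b int le in auto)
    also have "(\<Sum>n\<in>{N..<N+m}. b n) = (\<Sum>n<m. b (n + N))"
      using sum.shift_bounds_nat_ivl[of b 0 N m] by (simp add: add.commute lessThan_atLeast0)
    also have "ennreal ((\<Sum>n<m. b (n + N)) powr p) \<le> ennreal ((\<Sum>n. b (n + N)) powr p)"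
      using p b less_imp_le[OF b(1)]
      by (intro ennreal_leI powr_mono2 sum_le_suminf summable_ignore_initial_segment sum_nonneg) auto
    finally show "(\<integral>\<^sup>+x. u m x \<partial>M) \<le> ennreal ((\<Sum>n. b (n + N)) powr p)" .
  qed
  also have "\<dots> = ennreal ((\<Sum>n. b (n + N)) powr p)" by (simp add: Liminf_const)
  finally have nn: "(\<integral>\<^sup>+x. ennreal (cmod (G x - (\<Sum>n<N. g n x)) powr p) \<partial>M) \<le> ennreal ((\<Sum>n. b (n + N)) powr p)" .
  show int': "integrable M (\<lambda>x. cmod (G x - (\<Sum>n<N. g n x)) powr p)"
    using nn by (intro integrableI_bounded) (auto intro: le_less_trans)
  show "(\<integral>x. cmod (G x - (\<Sum>n<N. g n x)) powr p \<partial>M) \<le> (\<Sum>n. b (n + N)) powr p"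
    using nn nn_integral_eq_integral[OF int'] by (simp add: ennreal_le_iff)
qed

section \<open>The seminormed space L^p of a probability measure\<close>

lemma Lp_space_integrable:
  assumes "prob_space M" "1 \<le> p" "f \<in> Lp_space p M"
  shows "integrable M f"
proof -
  interpret prob_space M by fact
  have "cmod (f x) \<le> 1 + cmod (f x) powr p" for x
  proof (cases "cmod (f x) \<le> 1")
    case False
    then show ?thesis using powr_mono[of 1 p "cmod (f x)"] assms(2) by simp
  qed (simp add: add_increasing2)
  then show ?thesis
    using assms(3)
    by (intro Bochner_Integration.integrable_bound[of M "\<lambda>x. 1 + cmod (f x) powr p" f])
       (auto simp: Lp_space_def)
qed

lemma Lp_norm_nonneg: "0 \<le> Lp_norm p M f"
  by (simp add: Lp_norm_def)

lemma Lp_norm_powr: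
  assumes "1 \<le> p"
  shows "Lp_norm p M f powr p = (\<integral>x. cmod (f x) powr p \<partial>M)"
  using assms by (simp add: Lp_norm_def powr_powr)

lemma Lp_norm_eq_0_iff:
  assumes "1 \<le> p" "f \<in> Lp_space p M"
  shows "Lp_norm p M f = 0 \<longleftrightarrow> (AE x in M. f x = 0)"
  using assms integral_nonneg_eq_0_iff_AE[of M "\<lambda>x. cmod (f x) powr p"]
  by (simp add: Lp_norm_def Lp_space_def powr_eq_0_iff)

lemma Lp_space_add:
  assumes "1 \<le> p" "f \<in> Lp_space p M" "g \<in> Lp_space p M"
  shows "f + g \<in> Lp_space p M"
proof -
  \<comment> \<open>The finite-sum bound is used over the index type \<open>bool\<close>. Its
    majorants must be positive, hence the norms plus 1.\<close>
  define h where "h b = (if b then f else g)" for b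
  have h: "h b \<in> Lp_space p M" for b using assms by (simp add: h_def)
  have "integrable M (\<lambda>x. cmod (\<Sum>b\<in>UNIV. h b x) powr p)"
    using h Lp_norm_nonneg[of p M] assms(1)
    by (intro Lp_sum_bound(1)[where a = "\<lambda>b. Lp_norm p M (h b) + 1"])
       (auto simp: Lp_space_def Lp_norm_powr[symmetric] add_nonneg_pos intro!: powr_mono2)
  then show ?thesis
    using assms by (auto simp: Lp_space_def UNIV_bool h_def plus_fun_def add.commute)
qed

lemma Lp_space_scale:
  assumes "f \<in> Lp_space p M"
  shows "(\<lambda>x. c * f x) \<in> Lp_space p M"
  using assms by (auto simp: Lp_space_def norm_mult powr_mult)

lemma Lp_space_diff:
  assumes "1 \<le> p" "f \<in> Lp_space p M" "g \<in> Lp_space p M"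
  shows "f - g \<in> Lp_space p M"
  using Lp_space_add[OF assms(1,2) Lp_space_scale[OF assms(3), of "-1"]]
  by (simp add: plus_fun_def fun_diff_def)

section \<open>Interpolation between L^1 and the supremum norm\<close>

text \<open>An upper bound for x that is linear in x^p, with equality at x = c. It can be integrated
  against a weight before c is chosen.\<close>

lemma Young_tangent:
  fixes x c p :: real
  assumes "1 \<le> p" "0 \<le> x" "0 < c"
  shows "x \<le> (x powr p * c powr (1 - p) + (p - 1) * c) / p"
proof -
  have "x powr p * c powr (1 - p) > 0 \<Longrightarrow> x = (x powr p * c powr (1 - p)) powr (1/p) * c powr (1 - 1/p)"
    using assms by (auto simp: powr_mult powr_powr field_simps simp flip: powr_add)
  moreover have "(x powr p * c powr (1 - p)) powr (1/p) * c powr (1 - 1/p)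
      \<le> 1/p * (x powr p * c powr (1 - p)) + (1 - 1/p) * c" if "x powr p * c powr (1 - p) > 0"
    using assms that by (intro Youngs_inequality_0) auto
  moreover have "1/p * (x powr p * c powr (1 - p)) + (1 - 1/p) * c = (x powr p * c powr (1 - p) + (p - 1) * c) / p"
    using assms by (simp add: field_simps)
  moreover have "x = 0" if "\<not> x powr p * c powr (1 - p) > 0"
    using that assms by (auto simp: zero_less_mult_iff)
  ultimately show ?thesis
    using assms by (cases "x powr p * c powr (1 - p) > 0") auto
qed


lemma borel_measurable_cnj [measurable]:
  "f \<in> borel_measurable M \<Longrightarrow> (\<lambda>x. cnj (f x)) \<in> borel_measurable M"
  by (rule measurable_compose[OF _ borel_measurable_continuous_onI[of cnj]]) (auto intro: continuous_intros)

text \<open>Holder's inequality for the measure |e| dM, followed by |e| \<le> A in the factor that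
  contains f. Working with \<open>Young_tangent\<close> instead of a conjugate exponent treats p = 1
  and p > 1 alike.\<close>

lemma Holder_sup_L1:
  assumes "prob_space M" and p: "1 \<le> p" and f: "f \<in> Lp_space p M"
    and e [measurable]: "e \<in> borel_measurable M" and A: "\<And>x. x \<in> space M \<Longrightarrow> cmod (e x) \<le> A"
  shows "cmod (\<integral>x. f x * cnj (e x) \<partial>M)
    \<le> A powr (1/p) * (\<integral>x. cmod (e x) \<partial>M) powr (1 - 1/p) * Lp_norm p M f"
    (is "?I \<le> A powr (1/p) * ?B powr (1 - 1/p) * ?F")
proof -
  interpret prob_space M by fact
  have [measurable]: "f \<in> borel_measurable M" and fp: "integrable M (\<lambda>x. cmod (f x) powr p)"
    using f by (auto simp: Lp_space_def)
  have inte: "integrable M (\<lambda>x. cmod (e x))"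
    by (rule integrable_const_bound[where B=A]) (use A in auto)
  have B0: "0 \<le> ?B" by (intro integral_nonneg_AE) auto
  consider "?B = 0" | "?F = 0" | "0 < ?B" "0 < ?F" using B0 Lp_norm_nonneg[of p M f] by (metis less_eq_real_def)
  then show ?thesis
  proof cases
    case 1
    then have "AE x in M. e x = 0" using integral_nonneg_eq_0_iff_AE[OF inte] by auto
    then have "(\<integral>x. f x * cnj (e x) \<partial>M) = 0" by (intro integral_eq_zero_AE) auto
    then show ?thesis by (simp add: Lp_norm_nonneg)
  next
    case 2
    then have "AE x in M. f x = 0" using Lp_norm_eq_0_iff[OF p f] by simp
    then have "(\<integral>x. f x * cnj (e x) \<partial>M) = 0" by (intro integral_eq_zero_AE) auto
    then show ?thesis by (simp add: Lp_norm_nonneg)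
  next
    case 3
    have "?B \<le> (\<integral>x. A \<partial>M)" by (intro integral_mono inte) (use A in auto)
    then have A0: "0 < A" using 3 by (simp add: prob_space)
    \<comment> \<open>The value that balances the two terms: c^(1-p) A F^p = c B.\<close>
    define c where "c = ?F * (A / ?B) powr (1/p)"
    have c: "0 < c" using 3 A0 by (simp add: c_def)
    have int1: "integrable M (\<lambda>x. cmod (f x) powr p * cmod (e x))"
      by (rule Bochner_Integration.integrable_bound[of M "\<lambda>x. A * cmod (f x) powr p"])
         (use fp A in \<open>auto simp: mult.commute intro!: mult_right_mono AE_I2 order_trans[OF _ abs_ge_self]\<close>)
    have int2: "integrable M (\<lambda>x. (c powr (1 - p) * (cmod (f x) powr p * cmod (e x)) + (p - 1) * c * cmod (e x)) / p)"
      using int1 inte by auto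
    have pw: "cmod (f x * cnj (e x)) \<le> (c powr (1 - p) * (cmod (f x) powr p * cmod (e x)) + (p - 1) * c * cmod (e x)) / p" for x
      using mult_right_mono[OF Young_tangent[OF p _ c, of "cmod (f x)"], of "cmod (e x)"] p
      by (simp add: norm_mult field_simps)
    have "?I \<le> (\<integral>x. cmod (f x * cnj (e x)) \<partial>M)" by (rule integral_norm_bound)
    also have "\<dots> \<le> (\<integral>x. (c powr (1 - p) * (cmod (f x) powr p * cmod (e x)) + (p - 1) * c * cmod (e x)) / p \<partial>M)"
    proof (intro integral_mono int2 pw Bochner_Integration.integrable_bound[OF int2] AE_I2)
      show "(\<lambda>x. cmod (f x * cnj (e x))) \<in> borel_measurable M" by (simp add: norm_mult)
    qed (use order_trans[OF pw abs_ge_self] in simp)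
    also have "\<dots> = (c powr (1 - p) * (\<integral>x. cmod (f x) powr p * cmod (e x) \<partial>M) + (p - 1) * c * ?B) / p"
      using int1 inte by simp
    also have "\<dots> \<le> (c powr (1 - p) * (A * ?F powr p) + (p - 1) * c * ?B) / p"
    proof -
      have "(\<integral>x. cmod (f x) powr p * cmod (e x) \<partial>M) \<le> (\<integral>x. A * cmod (f x) powr p \<partial>M)"
        by (intro integral_mono int1) (use fp A in \<open>auto simp: mult.commute intro!: mult_right_mono\<close>)
      then show ?thesis
        using p by (intro divide_right_mono add_right_mono mult_left_mono) (auto simp: Lp_norm_powr)
    qed
    also have "\<dots> = A powr (1/p) * ?B powr (1 - 1/p) * ?F"
    proof -
      have c_eq: "c = ?F * A powr (1/p) / ?B powr (1/p)"
        using 3 A0 by (simp add: c_def powr_divide)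
      have B1: "?B powr (1 - 1/p) = ?B / ?B powr (1/p)" using 3 by (simp add: powr_diff)
      have "c powr p = ?F powr p * A / ?B"
        using 3 A0 p by (simp add: c_eq powr_divide powr_mult powr_powr)
      then have "c powr (1 - p) * (A * ?F powr p) = c * ?B"
        using 3 A0 c by (simp add: powr_diff)
      then have "(c powr (1 - p) * (A * ?F powr p) + (p - 1) * c * ?B) / p = c * ?B"
        using p by (simp add: field_simps)
      then show ?thesis by (simp add: c_eq B1)
    qed
    finally show ?thesis .
  qed
qed

text \<open>From |e|^p \<le> A^(p-1) |e|. Multiplied with the bound of \<open>Holder_sup_L1\<close>,
  the exponents of A and of the L^1 norm both add up to 1, so that p disappears from the
  product.\<close>

lemma Lp_norm_sup_L1:
  assumes "prob_space M" and p: "1 \<le> p"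
    and e [measurable]: "e \<in> borel_measurable M" and A: "\<And>x. x \<in> space M \<Longrightarrow> cmod (e x) \<le> A"
  shows "e \<in> Lp_space p M"
    and "Lp_norm p M e \<le> A powr (1 - 1/p) * (\<integral>x. cmod (e x) \<partial>M) powr (1/p)"
proof -
  interpret prob_space M by fact
  have inte: "integrable M (\<lambda>x. cmod (e x))"
    by (rule integrable_const_bound[where B=A]) (use A in auto)
  have A0: "0 \<le> A" using A norm_ge_zero not_empty by (meson ex_in_conv order_trans)
  have pw: "cmod (e x) powr p \<le> A powr (p - 1) * cmod (e x)" if "x \<in> space M" for x
  proof (cases "e x = 0")
    case False
    have "cmod (e x) powr p = cmod (e x) powr (p - 1) * cmod (e x)"
      using False by (simp add: powr_diff)
    also have "\<dots> \<le> A powr (p - 1) * cmod (e x)"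
      using A[OF that] p by (intro mult_right_mono powr_mono2) auto
    finally show ?thesis .
  qed (use A0 in auto)
  have intp: "integrable M (\<lambda>x. cmod (e x) powr p)"
    by (rule Bochner_Integration.integrable_bound[of M "\<lambda>x. A powr (p - 1) * cmod (e x)"])
       (use inte pw in \<open>auto intro!: AE_I2\<close>)
  then show "e \<in> Lp_space p M" by (simp add: Lp_space_def)
  have "(\<integral>x. cmod (e x) powr p \<partial>M) \<le> (\<integral>x. A powr (p - 1) * cmod (e x) \<partial>M)"
    by (intro integral_mono intp pw) (use inte in auto)
  then have "Lp_norm p M e \<le> (A powr (p - 1) * (\<integral>x. cmod (e x) \<partial>M)) powr (1/p)"
    unfolding Lp_norm_def using p by (intro powr_mono2) (auto intro!: integral_nonneg_AE)
  also have "\<dots> = A powr ((p - 1) * (1/p)) * (\<integral>x. cmod (e x) \<partial>M) powr (1/p)"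
    using A0 by (simp add: powr_mult powr_powr integral_nonneg_AE)
  also have "(p - 1) * (1/p) = 1 - 1/p" using p by (simp add: field_simps)
  finally show "Lp_norm p M e \<le> A powr (1 - 1/p) * (\<integral>x. cmod (e x) \<partial>M) powr (1/p)" .
qed

section \<open>A nuclearity criterion for series of rank-one operators\<close>

lemma summable_of_summable_powr:
  assumes "summable (\<lambda>n. K n powr r)" "0 < r" "r \<le> 1" "\<And>n. 0 \<le> K n"
  shows "summable (K :: nat \<Rightarrow> real)"
proof (rule summable_comparison_test_ev[OF _ assms(1)])
  have "eventually (\<lambda>n. K n powr r < 1) sequentially"
    using summable_LIMSEQ_zero[OF assms(1)] by (rule order_tendstoD) simp
  then show "eventually (\<lambda>n. norm (K n) \<le> K n powr r) sequentially"
  proof eventually_elim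
    case (elim n)
    then have "K n \<le> 1" using ge_one_powr_ge_zero[of "K n" r] assms by force
    then show ?case using assms powr_mono'[of r 1 "K n"] by simp
  qed
qed

text \<open>The sup norm and the L^1 norm of \<open>e n\<close> control both the functional and the
  vector of the n-th piece, and the product of the two bounds is \<open>c n * A n * B n\<close> for
  every p. Pointwise convergence to \<open>T f\<close> is asked for almost everywhere only, because
  \<open>T f\<close> matters only modulo null functions.\<close>

lemma r_nuclear_Lp_series:
  fixes c A :: "nat \<Rightarrow> real"
  assumes M: "prob_space M" and r: "0 < r" "r \<le> 1" and p: "1 \<le> p"
    and c: "\<And>n. 0 \<le> c n"
    and e [measurable]: "\<And>n. e n \<in> borel_measurable M"
    and A: "\<And>n x. x \<in> space M \<Longrightarrow> cmod (e n x) \<le> A n"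
    and summ: "summable (\<lambda>n. (c n * A n * (\<integral>x. cmod (e n x) \<partial>M)) powr r)"
    and T_meas: "\<And>f. f \<in> Lp_space p M \<Longrightarrow> T f \<in> borel_measurable M"
    and T_lim: "\<And>f. f \<in> Lp_space p M \<Longrightarrow>
      AE x in M. (\<lambda>m. \<Sum>n<m. of_real (c n) * (\<integral>y. f y * cnj (e n y) \<partial>M) * e n x) \<longlonglongrightarrow> T f x"
  shows "r_nuclear_on_Lp r p M T"
proof -
  interpret prob_space M by fact
  define B where "B n = (\<integral>x. cmod (e n x) \<partial>M)" for n
  define \<phi> where "\<phi> n f = of_real (c n) * (\<integral>y. f y * cnj (e n y) \<partial>M)" for n f
  define K where "K n = c n * A n * B n" for n
  have A0: "0 \<le> A n" for n using A norm_ge_zero not_empty by (meson ex_in_conv order_trans)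
  have B0: "0 \<le> B n" for n unfolding B_def by (intro integral_nonneg_AE) auto
  have K0: "0 \<le> K n" for n using A0 B0 c by (simp add: K_def)
  have K_split: "(c n * (A n powr (1/p) * B n powr (1 - 1/p))) * (A n powr (1 - 1/p) * B n powr (1/p)) = K n" for n
  proof -
    have split: "x powr (1/p) * x powr (1 - 1/p) = x" if "0 \<le> x" for x :: real
      using that by (simp flip: powr_add)
    have "(c n * (A n powr (1/p) * B n powr (1 - 1/p))) * (A n powr (1 - 1/p) * B n powr (1/p)) =
        c n * (A n powr (1/p) * A n powr (1 - 1/p)) * (B n powr (1/p) * B n powr (1 - 1/p))"
      by (simp only: mult_ac)
    then show ?thesis by (simp only: split[OF A0] split[OF B0] K_def)
  qed
  have int_fe: "integrable M (\<lambda>y. f y * cnj (e n y))" if "f \<in> Lp_space p M" for f n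
  proof (rule Bochner_Integration.integrable_bound[of M "\<lambda>y. A n * cmod (f y)"])
    show "integrable M (\<lambda>y. A n * cmod (f y))" using Lp_space_integrable[OF M p that] by simp
    have [measurable]: "f \<in> borel_measurable M" using that by (simp add: Lp_space_def)
    show "(\<lambda>y. f y * cnj (e n y)) \<in> borel_measurable M" by measurable
    show "AE y in M. norm (f y * cnj (e n y)) \<le> norm (A n * cmod (f y))"
      using A0[of n] mult_right_mono[OF A norm_ge_zero] by (intro AE_I2) (simp add: norm_mult mult.commute)
  qed
  have \<phi>_bound: "cmod (\<phi> n f) \<le> c n * (A n powr (1/p) * B n powr (1 - 1/p)) * Lp_norm p M f"
    if "f \<in> Lp_space p M" for n f
    using Holder_sup_L1[OF M p that e A, of n] c[of n]
    by (auto simp: \<phi>_def norm_mult B_def mult.assoc intro!: mult_left_mono)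
  have e_Lp: "e n \<in> Lp_space p M" and e_norm: "Lp_norm p M (e n) \<le> A n powr (1 - 1/p) * B n powr (1/p)" for n
    using Lp_norm_sup_L1[OF M p e A, of n] by (auto simp: B_def)
  have dual: "0 \<le> dual_norm (Lp_space p M) (Lp_norm p M) (\<phi> n)"
      "dual_norm (Lp_space p M) (Lp_norm p M) (\<phi> n) \<le> c n * (A n powr (1/p) * B n powr (1 - 1/p))" for n
  proof -
    let ?S = "{x \<in> Lp_space p M. Lp_norm p M x \<le> 1}"
    have ne: "(\<lambda>x. 0) \<in> ?S" by (simp add: Lp_space_def Lp_norm_def)
    have le: "cmod (\<phi> n x) \<le> c n * (A n powr (1/p) * B n powr (1 - 1/p))" if "x \<in> ?S" for x
      using \<phi>_bound[of x n] that c[of n]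
        mult_left_mono[of "Lp_norm p M x" 1 "c n * (A n powr (1/p) * B n powr (1 - 1/p))"] by auto
    show "dual_norm (Lp_space p M) (Lp_norm p M) (\<phi> n) \<le> c n * (A n powr (1/p) * B n powr (1 - 1/p))"
      unfolding dual_norm_def using ne le by (intro cSUP_least) auto
    have "0 \<le> cmod (\<phi> n (\<lambda>x. 0))" by simp
    also have "\<dots> \<le> dual_norm (Lp_space p M) (Lp_norm p M) (\<phi> n)"
      unfolding dual_norm_def using ne le by (intro cSUP_upper bdd_aboveI2) auto
    finally show "0 \<le> dual_norm (Lp_space p M) (Lp_norm p M) (\<phi> n)" .
  qed
  have sumK: "summable K"
    using summ r K0 by (intro summable_of_summable_powr[of K r]) (simp_all add: K_def B_def)
  have sum_apply: "(\<Sum>n<m. h n) x = (\<Sum>n<m. h n x)" for h :: "nat \<Rightarrow> 'a \<Rightarrow> complex" and m x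
    by (induction m) (simp_all add: plus_fun_def zero_fun_def)
  have tail: "integrable M (\<lambda>x. cmod (T f x - (\<Sum>n<N. \<phi> n f * e n x)) powr p)"
    "(\<integral>x. cmod (T f x - (\<Sum>n<N. \<phi> n f * e n x)) powr p \<partial>M) \<le>
       (\<Sum>n. K (n + N) * Lp_norm p M f + (1/2) ^ (n + N)) powr p" if f: "f \<in> Lp_space p M" for f N
  proof -
    \<comment> \<open>The geometric term keeps the majorants positive when \<open>K n\<close> or the
      norm of f vanishes, without spoiling summability.\<close>
    let ?b = "\<lambda>n. K n * Lp_norm p M f + (1/2) ^ n"
    have g_Lp: "(\<lambda>x. \<phi> n f * e n x) \<in> Lp_space p M" for n by (rule Lp_space_scale[OF e_Lp])
    have "(\<integral>x. cmod (\<phi> n f * e n x) powr p \<partial>M) \<le> ?b n powr p" for n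
    proof -
      have "(\<integral>x. cmod (\<phi> n f * e n x) powr p \<partial>M) = (cmod (\<phi> n f) * Lp_norm p M (e n)) powr p"
        by (simp add: norm_mult powr_mult Lp_norm_powr[OF p] Lp_norm_nonneg)
      also have "\<dots> \<le> ?b n powr p"
      proof (intro powr_mono2)
        have "cmod (\<phi> n f) * Lp_norm p M (e n) \<le>
          (c n * (A n powr (1/p) * B n powr (1 - 1/p)) * Lp_norm p M f) * (A n powr (1 - 1/p) * B n powr (1/p))"
          using \<phi>_bound[OF f] e_norm c by (intro mult_mono) (auto simp: Lp_norm_nonneg)
        also have "\<dots> = K n * Lp_norm p M f" using K_split[of n] by (simp add: algebra_simps)
        finally show "cmod (\<phi> n f) * Lp_norm p M (e n) \<le> ?b n" by (smt (verit) zero_le_power zero_le_divide_1_iff)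
      qed (use p in \<open>auto simp: Lp_norm_nonneg\<close>)
      finally show ?thesis .
    qed
    moreover have "0 < ?b n" for n using K0[of n] Lp_norm_nonneg[of p M f] by (intro add_nonneg_pos) auto
    moreover have "summable ?b" using sumK by (intro summable_add summable_mult2 summable_geometric) auto
    ultimately show "integrable M (\<lambda>x. cmod (T f x - (\<Sum>n<N. \<phi> n f * e n x)) powr p)"
      "(\<integral>x. cmod (T f x - (\<Sum>n<N. \<phi> n f * e n x)) powr p \<partial>M) \<le> (\<Sum>n. ?b (n + N)) powr p"
      using Lp_series_tail_bound[where g="\<lambda>n x. \<phi> n f * e n x" and b="?b" and G="T f" and M=M and p=p and N=N]
        g_Lp p T_meas[OF f] T_lim[OF f]
      by (auto simp: Lp_space_def \<phi>_def)
  qed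
  have T_Lp: "T f \<in> Lp_space p M" if "f \<in> Lp_space p M" for f
    using tail(1)[OF that, of 0] T_meas[OF that] by (simp add: Lp_space_def)
  have norm_0: "Lp_norm p M h = 0" if "AE x in M. h x = 0" for h
    unfolding Lp_norm_def using that by (subst integral_eq_zero_AE) auto
  have \<phi>_add: "\<phi> n (f + g) = \<phi> n f + \<phi> n g" if "f \<in> Lp_space p M" "g \<in> Lp_space p M" for n f g
    using int_fe[OF that(1)] int_fe[OF that(2)] by (simp add: \<phi>_def algebra_simps plus_fun_def)
  have \<phi>_scale: "\<phi> n (\<lambda>x. k * f x) = k * \<phi> n f" for n f k
    unfolding \<phi>_def mult.assoc integral_mult_right_zero by (rule mult.left_commute)
  have lim: "AE x in M. (\<lambda>m. \<Sum>n<m. \<phi> n f * e n x) \<longlonglongrightarrow> T f x" if "f \<in> Lp_space p M" for f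
    using T_lim[OF that] by (simp add: \<phi>_def)
  \<comment> \<open>The functionals \<open>\<phi> n\<close> respect null functions, sums and
    multiples. The operator inherits this through the almost everywhere limit.\<close>
  have "linear_operator (\<lambda>c f x. c * f x) (Lp_space p M) (Lp_norm p M) T"
    unfolding linear_operator_def
  proof (intro conjI ballI allI impI)
    fix f g assume f: "f \<in> Lp_space p M" and g: "g \<in> Lp_space p M" and 0: "Lp_norm p M (f - g) = 0"
    have AE: "AE x in M. f x = g x" using 0 Lp_norm_eq_0_iff[OF p Lp_space_diff[OF p f g]] by simp
    have eq: "\<phi> n f = \<phi> n g" for n
    proof -
      have "(\<integral>y. f y * cnj (e n y) \<partial>M) = (\<integral>y. g y * cnj (e n y) \<partial>M)"
        using f g AE by (intro integral_cong_AE) (auto simp: Lp_space_def)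
      then show ?thesis by (simp add: \<phi>_def)
    qed
    have "AE x in M. T f x = T g x"
      using lim[OF f] lim[OF g] unfolding eq by eventually_elim (rule LIMSEQ_unique)
    then show "Lp_norm p M (T f - T g) = 0" by (intro norm_0) auto
  next
    fix f g assume f: "f \<in> Lp_space p M" and g: "g \<in> Lp_space p M"
    have "AE x in M. T (f + g) x = T f x + T g x"
      using lim[OF f] lim[OF g] lim[OF Lp_space_add[OF p f g]]
    proof eventually_elim
      case (elim x)
      then show ?case
        using tendsto_add[OF elim(1,2)]
        by (intro LIMSEQ_unique[OF elim(3)]) (simp add: \<phi>_add[OF f g] distrib_right sum.distrib)
    qed
    then show "Lp_norm p M (T (f + g) - (T f + T g)) = 0" by (intro norm_0) auto
  next
    fix k f assume f: "f \<in> Lp_space p M"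
    have "AE x in M. T (\<lambda>x. k * f x) x = k * T f x"
      using lim[OF f] lim[OF Lp_space_scale[OF f, of k]]
    proof eventually_elim
      case (elim x)
      then show ?case
        using tendsto_mult_left[OF elim(1), of k]
        by (intro LIMSEQ_unique[OF elim(2)]) (simp add: \<phi>_scale sum_distrib_left mult.assoc)
    qed
    then show "Lp_norm p M (T (\<lambda>x. k * f x) - (\<lambda>x. k * T f x)) = 0" by (intro norm_0) auto
  qed (rule T_Lp)
  moreover have "\<phi> n \<in> bounded_functionals (\<lambda>c f x. c * f x) (Lp_space p M) (Lp_norm p M)" for n
    unfolding bounded_functionals_def using \<phi>_add \<phi>_scale \<phi>_bound by blast
  moreover have "(\<lambda>k. Lp_norm p M (T f - (\<Sum>n<k. (\<lambda>x. \<phi> n f * e n x)))) \<longlonglongrightarrow> 0"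
    if f: "f \<in> Lp_space p M" for f
  proof (rule tendsto_sandwich[OF _ _ tendsto_const])
    let ?b = "\<lambda>n. K n * Lp_norm p M f + (1/2) ^ n"
    have b: "summable ?b" using sumK by (intro summable_add summable_mult2 summable_geometric) auto
    have b0: "0 \<le> ?b n" for n using K0[of n] Lp_norm_nonneg[of p M f] by auto
    have "Lp_norm p M (T f - (\<Sum>n<k. (\<lambda>x. \<phi> n f * e n x))) \<le> (\<Sum>n. ?b (n + k))" for k
    proof -
      have "Lp_norm p M (T f - (\<Sum>n<k. (\<lambda>x. \<phi> n f * e n x))) \<le> ((\<Sum>n. ?b (n + k)) powr p) powr (1/p)"
        using tail(2)[OF f, of k] p
        by (subst (1) Lp_norm_def, intro powr_mono2) (auto simp: sum_apply intro!: integral_nonneg_AE)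
      also have "\<dots> = (\<Sum>n. ?b (n + k))"
        using p suminf_nonneg[OF summable_ignore_initial_segment[OF b], of k] b0 by (simp add: powr_powr)
      finally show ?thesis .
    qed
    then show "\<forall>\<^sub>F k in sequentially. Lp_norm p M (T f - (\<Sum>n<k. (\<lambda>x. \<phi> n f * e n x))) \<le> (\<Sum>n. ?b (n + k))"
      by simp
    show "(\<lambda>k. \<Sum>n. ?b (n + k)) \<longlonglongrightarrow> 0" by (rule suminf_exist_split2[OF b])
  qed (auto simp: Lp_norm_nonneg)
  moreover have "summable (\<lambda>n. dual_norm (Lp_space p M) (Lp_norm p M) (\<phi> n) powr r * Lp_norm p M (e n) powr r)"
  proof (rule summable_comparison_test[OF _ summ], intro exI[of _ 0] allI impI)
    fix n :: nat
    let ?d = "dual_norm (Lp_space p M) (Lp_norm p M) (\<phi> n)"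
    have "?d * Lp_norm p M (e n) \<le>
        (c n * (A n powr (1/p) * B n powr (1 - 1/p))) * (A n powr (1 - 1/p) * B n powr (1/p))"
      using dual[of n] e_norm[of n] c[of n] by (intro mult_mono) (auto simp: Lp_norm_nonneg)
    then have "?d * Lp_norm p M (e n) \<le> K n" by (simp only: K_split)
    then have "(?d * Lp_norm p M (e n)) powr r \<le> K n powr r"
      using r dual(1)[of n] by (intro powr_mono2) (auto simp: Lp_norm_nonneg)
    then show "norm (?d powr r * Lp_norm p M (e n) powr r) \<le> (c n * A n * (\<integral>x. cmod (e n x) \<partial>M)) powr r"
      using dual(1)[of n] by (simp add: powr_mult Lp_norm_nonneg K_def B_def)
  qed
  ultimately show ?thesis
    unfolding r_nuclear_on_Lp_def r_nuclear_def using e_Lp by (intro conjI exI[of _ \<phi>] exI[of _ e]) auto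
qed

section \<open>Matrix coefficients of \<open>SU(2)\<close>\<close>

lemma SU2_iff:
  "u \<in> SU2 \<longleftrightarrow> u$2$2 = cnj (u$1$1) \<and> u$2$1 = - cnj (u$1$2) \<and> (cmod (u$1$1))\<^sup>2 + (cmod (u$1$2))\<^sup>2 = 1"
proof -
  have unitary: "u ** adjoint_mat u = mat 1 \<longleftrightarrow>
      u$1$1 * cnj (u$1$1) + u$1$2 * cnj (u$1$2) = 1 \<and> u$1$1 * cnj (u$2$1) + u$1$2 * cnj (u$2$2) = 0 \<and>
      u$2$1 * cnj (u$1$1) + u$2$2 * cnj (u$1$2) = 0 \<and> u$2$1 * cnj (u$2$1) + u$2$2 * cnj (u$2$2) = 1"
    by (simp add: vec_eq_iff forall_2 sum_2 matrix_matrix_mult_def adjoint_mat_def mat_def)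
  have norm: "(cmod (u$1$1))\<^sup>2 + (cmod (u$1$2))\<^sup>2 = 1 \<longleftrightarrow> u$1$1 * cnj (u$1$1) + u$1$2 * cnj (u$1$2) = 1"
    by (simp flip: complex_norm_square of_real_add of_real_power)
  show ?thesis
  proof
    assume "u \<in> SU2"
    then have eqs: "u$1$1 * cnj (u$1$1) + u$1$2 * cnj (u$1$2) = 1" "u$2$1 * cnj (u$1$1) + u$2$2 * cnj (u$1$2) = 0"
      "u$1$1 * u$2$2 - u$1$2 * u$2$1 = 1"
      unfolding SU2_def by (simp_all add: unitary det_2)
    have "u$2$2 = cnj (u$1$1)" using eqs by algebra
    moreover have "u$2$1 = - cnj (u$1$2)" using eqs by algebra
    ultimately show "u$2$2 = cnj (u$1$1) \<and> u$2$1 = - cnj (u$1$2) \<and> (cmod (u$1$1))\<^sup>2 + (cmod (u$1$2))\<^sup>2 = 1"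
      using eqs norm by simp
  next
    assume "u$2$2 = cnj (u$1$1) \<and> u$2$1 = - cnj (u$1$2) \<and> (cmod (u$1$1))\<^sup>2 + (cmod (u$1$2))\<^sup>2 = 1"
    then show "u \<in> SU2"
      unfolding norm SU2_def by (simp add: unitary det_2) (simp add: algebra_simps)
  qed
qed

section \<open>Unitarity of the representations\<close>

text \<open>\<open>col1 u\<close> and \<open>col2 u\<close> are the linear forms by which u replaces
  z_1 and z_2, dehomogenised at z_2 = 1.\<close>

definition col1 :: "complex^2^2 \<Rightarrow> complex poly" where "col1 u = [:u$2$1, u$1$1:]"
definition col2 :: "complex^2^2 \<Rightarrow> complex poly" where "col2 u = [:u$2$2, u$1$2:]"

definition rep_weight :: "nat \<Rightarrow> nat \<Rightarrow> nat \<Rightarrow> real" where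
  "rep_weight k i j = sqrt (fact (k - i) * fact i / (fact (k - j) * fact j))"

lemma rep_SU2_eq:
  "rep_SU2 k u i j = of_real (rep_weight k i j) * coeff (col1 u ^ (k - j) * col2 u ^ j) (k - i)"
  by (simp add: rep_SU2_def rep_weight_def col1_def col2_def)

text \<open>The Fischer inner product, for which the monomials z_1^c z_2^(k-c) are orthogonal with
  squared norm c! (k-c)!. The degree k is a parameter because it is lost when z_2 is set to
  1.\<close>

definition fischer :: "nat \<Rightarrow> complex poly \<Rightarrow> complex poly \<Rightarrow> complex" where
  "fischer k f g = (\<Sum>c\<le>k. fact c * fact (k - c) * cnj (coeff f c) * coeff g c)"

text \<open>The adjoint of multiplication by b z_1 + a z_2 is cnj b d/dz_1 + cnj a d/dz_2. On a form
  of degree k + 1 with z_2 = 1, Euler's identity turns d/dz_2 into (k + 1) - z d/dz.\<close>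

lemma fischer_mult_linear:
  assumes "degree f \<le> k"
  shows "fischer (Suc k) ([:a, b:] * f) g =
    fischer k f (smult (cnj a) (smult (of_nat (Suc k)) g - [:0, 1:] * pderiv g) + smult (cnj b) (pderiv g))"
proof -
  have cf: "coeff ([:a, b:] * f) c = a * coeff f c + (if c = 0 then 0 else b * coeff f (c - 1))" for c
    by (cases c) (simp_all add: coeff_pCons)
  have 0: "coeff f (Suc k) = 0" using assms by (simp add: coeff_eq_0)
  have "fischer (Suc k) ([:a, b:] * f) g =
      (\<Sum>c\<le>Suc k. fact c * fact (Suc k - c) * cnj (a * coeff f c) * coeff g c) +
      (\<Sum>c\<le>Suc k. fact c * fact (Suc k - c) * cnj (if c = 0 then 0 else b * coeff f (c - 1)) * coeff g c)"
    unfolding fischer_def cf by (simp add: algebra_simps flip: sum.distrib)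
  also have "(\<Sum>c\<le>Suc k. fact c * fact (Suc k - c) * cnj (a * coeff f c) * coeff g c) =
      (\<Sum>c\<le>k. fact c * fact (k - c) * cnj (coeff f c) * (cnj a * (of_nat (Suc k - c) * coeff g c)))"
    using 0 by (simp add: Suc_diff_le algebra_simps)
  also have "(\<Sum>c\<le>Suc k. fact c * fact (Suc k - c) * cnj (if c = 0 then 0 else b * coeff f (c - 1)) * coeff g c) =
      (\<Sum>c\<le>k. fact c * fact (k - c) * cnj (coeff f c) * (cnj b * (of_nat (Suc c) * coeff g (Suc c))))"
    by (subst sum.atMost_Suc_shift) (simp add: algebra_simps)
  also have "(\<Sum>c\<le>k. fact c * fact (k - c) * cnj (coeff f c) * (cnj a * (of_nat (Suc k - c) * coeff g c))) +
      (\<Sum>c\<le>k. fact c * fact (k - c) * cnj (coeff f c) * (cnj b * (of_nat (Suc c) * coeff g (Suc c)))) =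
    fischer k f (smult (cnj a) (smult (of_nat (Suc k)) g - [:0, 1:] * pderiv g) + smult (cnj b) (pderiv g))"
    unfolding fischer_def sum.distrib[symmetric]
  proof (intro sum.cong refl)
    fix c assume c: "c \<in> {..k}"
    have "coeff ([:0, 1:] * pderiv g) c = of_nat c * coeff g c"
      by (cases c) (simp_all add: coeff_pCons coeff_pderiv)
    then have "coeff (smult (cnj a) (smult (of_nat (Suc k)) g - [:0, 1:] * pderiv g) + smult (cnj b) (pderiv g)) c =
       cnj a * (of_nat (Suc k - c) * coeff g c) + cnj b * (of_nat (Suc c) * coeff g (Suc c))"
      using c by (simp only: coeff_add coeff_smult coeff_diff coeff_pderiv) (simp add: of_nat_diff algebra_simps)
    then show "fact c * fact (k - c) * cnj (coeff f c) * (cnj a * (of_nat (Suc k - c) * coeff g c)) +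
        fact c * fact (k - c) * cnj (coeff f c) * (cnj b * (of_nat (Suc c) * coeff g (Suc c))) =
        fact c * fact (k - c) * cnj (coeff f c) *
        coeff (smult (cnj a) (smult (of_nat (Suc k)) g - [:0, 1:] * pderiv g) + smult (cnj b) (pderiv g)) c"
      by (simp only: distrib_left)
  qed
  finally show ?thesis .
qed

lemma pderiv_linear_powers:
  "pderiv ([:a0, a1:] ^ p * [:b0, b1:] ^ q :: complex poly) =
    smult (of_nat p * a1) ([:a0, a1:] ^ (p - 1) * [:b0, b1:] ^ q) +
    smult (of_nat q * b1) ([:a0, a1:] ^ p * [:b0, b1:] ^ (q - 1))"
  by (simp add: pderiv_mult pderiv_power pderiv_pCons algebra_simps)

text \<open>Leibniz' rule for this derivation: it maps each linear form to the Hermitian product of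
  its coefficients with the direction (c, d).\<close>

lemma Euler_linear_powers:
  "smult (cnj c) (smult (of_nat (p + q)) ([:a0, a1:] ^ p * [:b0, b1:] ^ q)
      - [:0, 1:] * pderiv ([:a0, a1:] ^ p * [:b0, b1:] ^ q)) +
    smult (cnj d) (pderiv ([:a0, a1:] ^ p * [:b0, b1:] ^ q)) =
   smult (of_nat p * (cnj c * a0 + cnj d * a1)) ([:a0, a1:] ^ (p - 1) * [:b0, b1:] ^ q) +
   smult (of_nat q * (cnj c * b0 + cnj d * b1)) ([:a0, a1:] ^ p * [:b0, b1:] ^ (q - 1))"
proof (rule poly_ext)
  fix z
  \<comment> \<open>The factor p covers the case p = 0, where the exponent p - 1 is
    truncated.\<close>
  have a: "of_nat p * (a0 + z * a1) ^ p = of_nat p * ((a0 + z * a1) * (a0 + z * a1) ^ (p - 1))"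
    by (cases p) auto
  have b: "of_nat q * (b0 + z * b1) ^ q = of_nat q * ((b0 + z * b1) * (b0 + z * b1) ^ (q - 1))"
    by (cases q) auto
  have identity: "c' * ((N + M) * (X * Y) - z * (N * a1 * (X' * Y) + M * b1 * (X * Y'))) +
      d' * (N * a1 * (X' * Y) + M * b1 * (X * Y')) =
      N * (c' * a0 + d' * a1) * (X' * Y) + M * (c' * b0 + d' * b1) * (X * Y')"
    if "N * X = N * ((a0 + z * a1) * X')" "M * Y = M * ((b0 + z * b1) * Y')" for N M X Y X' Y' c' d'
    using that by algebra
  have lin: "poly [:s, t:] z = s + z * t" for s t by simp
  show "poly (smult (cnj c) (smult (of_nat (p + q)) ([:a0, a1:] ^ p * [:b0, b1:] ^ q)
      - [:0, 1:] * pderiv ([:a0, a1:] ^ p * [:b0, b1:] ^ q)) +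
    smult (cnj d) (pderiv ([:a0, a1:] ^ p * [:b0, b1:] ^ q))) z =
   poly (smult (of_nat p * (cnj c * a0 + cnj d * a1)) ([:a0, a1:] ^ (p - 1) * [:b0, b1:] ^ q) +
   smult (of_nat q * (cnj c * b0 + cnj d * b1)) ([:a0, a1:] ^ p * [:b0, b1:] ^ (q - 1))) z"
    unfolding pderiv_linear_powers poly_add poly_diff poly_smult poly_mult poly_power lin of_nat_add mult_1_right add_0
    by (rule identity[OF a b])
qed

lemma degree_linear_powers: "degree ([:a0, a1:] ^ p * [:b0, b1:] ^ q :: complex poly) \<le> p + q"
proof -
  have "degree ([:a0, a1:] ^ p :: complex poly) \<le> p" "degree ([:b0, b1:] ^ q :: complex poly) \<le> q"
    using degree_power_le[of "[:a0, a1:]" p] degree_power_le[of "[:b0, b1:]" q]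
    by (auto intro: order_trans split: if_splits)
  then show ?thesis using degree_mult_le[of "[:a0, a1:] ^ p" "[:b0, b1:] ^ q"] by linarith
qed

text \<open>For the inner product \<open>fischer\<close> on forms of degree \<open>k\<close>, multiplication by a linear form is adjoint
  to the derivation in the conjugate direction, so the powers of an orthonormal pair can be peeled off
  one at a time.\<close>

lemma fischer_linear_powers:
  assumes "cnj a0 * a0 + cnj a1 * a1 = 1" "cnj b0 * b0 + cnj b1 * b1 = 1" "cnj a0 * b0 + cnj a1 * b1 = 0"
  shows "fischer (p + q) ([:a0, a1:] ^ p * [:b0, b1:] ^ q) ([:a0, a1:] ^ p * [:b0, b1:] ^ q) = fact p * fact q"
proof (induction p)
  case 0
  show ?case
  proof (induction q)
    case 0
    show ?case by (simp add: fischer_def)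
  next
    case (Suc q)
    have "fischer (Suc q) ([:b0, b1:] * [:b0, b1:] ^ q) ([:b0, b1:] ^ Suc q) =
        fischer q ([:b0, b1:] ^ q) (smult (of_nat (Suc q)) ([:b0, b1:] ^ q))"
      using degree_linear_powers[of 1 1 0 b0 b1 q] Euler_linear_powers[of b0 0 "Suc q" 1 1 b0 b1 b1] assms(2)
      by (subst fischer_mult_linear) simp_all
    also have "\<dots> = of_nat (Suc q) * fischer q ([:b0, b1:] ^ q) ([:b0, b1:] ^ q)"
      by (simp add: fischer_def sum_distrib_left algebra_simps)
    also have "\<dots> = of_nat (Suc q) * fact q" using Suc by simp
    finally show ?case by (simp only: power_Suc power_0 mult_1 add_0 fact_0 fact_Suc)
  qed
next
  case (Suc p)
  have orth: "cnj a0 * b0 + cnj a1 * b1 = 0" using assms(3) .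
  have "fischer (Suc (p + q)) ([:a0, a1:] * ([:a0, a1:] ^ p * [:b0, b1:] ^ q)) ([:a0, a1:] ^ Suc p * [:b0, b1:] ^ q) =
      fischer (p + q) ([:a0, a1:] ^ p * [:b0, b1:] ^ q) (smult (of_nat (Suc p)) ([:a0, a1:] ^ p * [:b0, b1:] ^ q))"
    using degree_linear_powers[of a0 a1 p b0 b1 q] Euler_linear_powers[of a0 "Suc p" q a0 a1 b0 b1 a1] assms
    by (subst fischer_mult_linear) (simp_all del: power_Suc)
  also have "\<dots> = of_nat (Suc p) * fischer (p + q) ([:a0, a1:] ^ p * [:b0, b1:] ^ q) ([:a0, a1:] ^ p * [:b0, b1:] ^ q)"
    by (simp add: fischer_def sum_distrib_left algebra_simps)
  also have "\<dots> = of_nat (Suc p) * (fact p * fact q)" unfolding Suc ..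
  finally show ?case by (simp only: power_Suc add_Suc fact_Suc mult.assoc)
qed

text \<open>The entries of column j are the coordinates of a normalised product of powers of
  \<open>col1 u\<close> and \<open>col2 u\<close> in the orthonormal monomial basis. These two forms
  are orthonormal because u is unitary, so the Fischer norm of the product is known.\<close>

lemma rep_SU2_column_norm:
  assumes u: "u \<in> SU2" and j: "j \<le> k"
  shows "(\<Sum>i\<le>k. (cmod (rep_SU2 k u i j))\<^sup>2) = 1"
proof -
  let ?P = "col1 u ^ (k - j) * col2 u ^ j"
  have n: "cnj (u$1$1) * u$1$1 + cnj (u$1$2) * u$1$2 = 1"
    using u unfolding SU2_iff
    by (metis complex_norm_square mult.commute of_real_1 of_real_add)
  have "fischer (k - j + j) ?P ?P = fact (k - j) * fact j"
    unfolding col1_def col2_def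
    by (intro fischer_linear_powers) (use u n in \<open>auto simp: SU2_iff algebra_simps\<close>)
  then have F: "fischer k ?P ?P = fact (k - j) * fact j" using j by simp
  have "(\<Sum>i\<le>k. (cmod (rep_SU2 k u i j))\<^sup>2) =
     (\<Sum>i\<le>k. fact (k - i) * fact i * (cmod (coeff ?P (k - i)))\<^sup>2) / (fact (k - j) * fact j)"
    unfolding rep_SU2_eq sum_divide_distrib
    by (intro sum.cong) (auto simp: norm_mult power_mult_distrib rep_weight_def)
  also have "(\<Sum>i\<le>k. fact (k - i) * fact i * (cmod (coeff ?P (k - i)))\<^sup>2) =
      (\<Sum>c\<le>k. fact c * fact (k - c) * (cmod (coeff ?P c))\<^sup>2)"
    by (rule sum.reindex_bij_witness[of _ "\<lambda>c. k - c" "\<lambda>i. k - i"]) auto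
  also have "\<dots> = fact (k - j) * fact j"
  proof -
    have "complex_of_real (\<Sum>c\<le>k. fact c * fact (k - c) * (cmod (coeff ?P c))\<^sup>2) = fischer k ?P ?P"
      unfolding fischer_def of_real_sum of_real_mult complex_norm_square by (simp add: ac_simps)
    also have "\<dots> = complex_of_real (fact (k - j) * fact j)" unfolding F by simp
    finally show ?thesis by (rule of_real_eq_iff[THEN iffD1])
  qed
  finally show ?thesis by simp
qed

lemma rep_SU2_le_1:
  assumes u: "u \<in> SU2" and j: "j \<le> k" and i: "i \<le> k"
  shows "cmod (rep_SU2 k u i j) \<le> 1"
proof -
  have "(cmod (rep_SU2 k u i j))\<^sup>2 \<le> (\<Sum>i\<le>k. (cmod (rep_SU2 k u i j))\<^sup>2)"
    using i by (intro member_le_sum) auto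
  then show ?thesis using rep_SU2_column_norm[OF u j] by (simp add: abs_square_le_1)
qed

section \<open>Ladder relations between neighbouring columns\<close>

text \<open>The coefficient sqrt ((l + m) (l - m + 1)) of the lowering operator of su(2), with j = l
  + m. It vanishes at j = 0 and j = k + 1, which removes the columns outside the range, including
  the one that truncated subtraction j - 1 yields at j = 0.\<close>

definition ladder :: "nat \<Rightarrow> nat \<Rightarrow> real" where
  "ladder k j = sqrt (real j * (real k - real j + 1))"

lemma rep_weight_raise:
  assumes "j \<le> k"
  shows "rep_weight k i j * real (k - j) = ladder k (Suc j) * rep_weight k i (Suc j)"
proof (cases "j = k")
  case False
  then obtain p where p: "k - j = Suc p" "k - Suc j = p" using assms by (cases "k - j") auto
  have k: "real k - real (Suc j) + 1 = real (Suc p)" using p assms by linarith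
  define W :: real where "W = fact (k - i) * fact i"
  have "rep_weight k i j * real (k - j) = sqrt (W / (fact (Suc p) * fact j) * (real (Suc p))\<^sup>2)"
    unfolding rep_weight_def p W_def real_sqrt_mult by simp
  also have "W / (fact (Suc p) * fact j) * (real (Suc p))\<^sup>2 =
      real (Suc j) * real (Suc p) * (W / (fact p * fact (Suc j)))"
    by (simp add: divide_simps power2_eq_square del: of_nat_Suc)
  also have "sqrt \<dots> = ladder k (Suc j) * rep_weight k i (Suc j)"
    unfolding ladder_def k rep_weight_def p W_def by (simp only: real_sqrt_mult)
  finally show ?thesis .
qed (simp add: ladder_def)

lemma rep_weight_lower:
  assumes "j \<le> k"
  shows "rep_weight k i j * real j = ladder k j * rep_weight k i (j - 1)"
proof (cases j)
  case (Suc l)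
  then have p: "k - l = Suc (k - j)" using assms by auto
  have k: "real k - real j + 1 = real (Suc (k - j))" using assms by (simp add: of_nat_diff)
  define W :: real where "W = fact (k - i) * fact i"
  have "rep_weight k i j * real j = sqrt (W / (fact (k - j) * fact j) * (real j)\<^sup>2)"
    unfolding rep_weight_def W_def real_sqrt_mult by simp
  also have "W / (fact (k - j) * fact j) * (real j)\<^sup>2 =
      real j * real (Suc (k - j)) * (W / (fact (k - l) * fact l))"
    unfolding p Suc by (simp add: divide_simps power2_eq_square del: of_nat_Suc)
  also have "sqrt \<dots> = ladder k j * rep_weight k i (j - 1)"
    unfolding ladder_def k unfolding rep_weight_def Suc W_def by (simp only: real_sqrt_mult diff_Suc_1)
  finally show ?thesis .
qed (simp add: ladder_def)

text \<open>Differentiating \<open>col1 u ^ (k - j) * col2 u ^ j\<close> along the group trades one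
  factor for the other. After renormalisation this is the next column times a ladder coefficient; at
  j = k both sides are 0. \<open>rep_SU2_lower\<close> is the mirror image.\<close>

lemma rep_SU2_raise:
  assumes "j \<le> k"
  shows "of_real (rep_weight k i j) * (of_nat (k - j) * coeff (col1 u ^ (k - j - 1) * col2 u ^ (j + 1)) (k - i))
    = of_real (ladder k (Suc j)) * rep_SU2 k u i (Suc j)"
proof -
  have "complex_of_real (rep_weight k i j) * of_nat (k - j) = of_real (ladder k (Suc j) * rep_weight k i (Suc j))"
    unfolding rep_weight_raise[OF assms, symmetric] by simp
  then show ?thesis by (simp add: rep_SU2_eq mult.assoc[symmetric] del: power_Suc)
qed

lemma rep_SU2_lower:
  assumes "j \<le> k"
  shows "of_real (rep_weight k i j) * (of_nat j * coeff (col1 u ^ (k - j + 1) * col2 u ^ (j - 1)) (k - i))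
    = of_real (ladder k j) * rep_SU2 k u i (j - 1)"
proof (cases "j = 0")
  case False
  then have "k - (j - 1) = k - j + 1" using assms by simp
  moreover have "complex_of_real (rep_weight k i j) * of_nat j = of_real (ladder k j * rep_weight k i (j - 1))"
    unfolding rep_weight_lower[OF assms, symmetric] by simp
  ultimately show ?thesis by (simp add: rep_SU2_eq mult.assoc[symmetric] del: power_Suc)
qed (simp add: ladder_def)

text \<open>The right-hand side is 2 (l (l + 1) - m^2): the Casimir value minus the square of the
  diagonal weight, doubled.\<close>

lemma ladder_sum:
  assumes "j \<le> k"
  shows "(ladder k (Suc j))\<^sup>2 + (ladder k j)\<^sup>2 = 2 * (real j * real (k - j) + real k / 2)"
proof -
  have "(ladder k (Suc j))\<^sup>2 = real (Suc j) * real (k - j)" "(ladder k j)\<^sup>2 = real j * (real (k - j) + 1)"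
    using assms by (simp_all add: ladder_def of_nat_diff)
  then show ?thesis using assms by (simp add: of_nat_diff algebra_simps)
qed

text \<open>The row index is recovered by the Euler operator \<open>z d/dz\<close>, that is by the diagonal generator
  conjugated with \<open>u\<close>; this makes the entries of a column concentrate where
  \<open>1 - 2 |u\<^sub>1\<^sub>2|\<^sup>2\<close> is close to \<open>m / n\<close>.\<close>

lemma rep_SU2_row_index:
  assumes u: "u \<in> SU2" and j: "j \<le> k" and i: "i \<le> k"
  shows "of_real ((real i - real k / 2) - (real j - real k / 2) * (1 - 2 * (cmod (u$1$2))\<^sup>2)) * rep_SU2 k u i j =
    u$1$1 * u$2$1 * (of_real (ladder k (Suc j)) * rep_SU2 k u i (Suc j)) -
    u$1$2 * u$2$2 * (of_real (ladder k j) * rep_SU2 k u i (j - 1))"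
proof -
  let ?p = "k - j" and ?A = "col1 u" and ?B = "col2 u"
  let ?P = "?A ^ ?p * ?B ^ j"
  have det: "u$1$1 * u$2$2 - u$1$2 * u$2$1 = 1"
    using u unfolding SU2_def by (simp add: det_2)
  have lin: "poly ?A z = u$2$1 + z * u$1$1" "poly ?B z = u$2$2 + z * u$1$2" for z
    by (simp_all add: col1_def col2_def)
  \<comment> \<open>Since det u = 1, z = u_22 A - u_21 B for the two linear forms A and B.
    Substituting this for the factor z expresses the Euler operator through the product itself and
    its two neighbours.\<close>
  have "[:0, 1:] * pderiv ?P =
      smult (of_nat ?p * (u$1$1 * u$2$2) - of_nat j * (u$1$2 * u$2$1)) ?P
      - smult (of_nat ?p * (u$1$1 * u$2$1)) (?A ^ (?p - 1) * ?B ^ (j + 1))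
      + smult (of_nat j * (u$1$2 * u$2$2)) (?A ^ (?p + 1) * ?B ^ (j - 1))"
  proof (rule poly_ext)
    fix z
    have a: "of_nat ?p * (u$2$1 + z * u$1$1) ^ ?p = of_nat ?p * ((u$2$1 + z * u$1$1) * (u$2$1 + z * u$1$1) ^ (?p - 1))"
      by (cases ?p) auto
    have b: "of_nat j * (u$2$2 + z * u$1$2) ^ j = of_nat j * ((u$2$2 + z * u$1$2) * (u$2$2 + z * u$1$2) ^ (j - 1))"
      by (cases j) auto
    have identity: "z * (N * a1 * (X' * Y) + M * b1 * (X * Y')) =
        (N * (a1 * b0) - M * (b1 * a0)) * (X * Y) - N * (a1 * a0) * (X' * (Y * (b0 + z * b1))) +
        M * (b1 * b0) * ((X * (a0 + z * a1)) * Y')"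
      if "N * X = N * ((a0 + z * a1) * X')" "M * Y = M * ((b0 + z * b1) * Y')" "a1 * b0 - b1 * a0 = 1"
      for N M X Y X' Y' a0 a1 b0 b1 :: complex
      using that by algebra
    have pd: "pderiv ?P = smult (of_nat ?p * u$1$1) (?A ^ (?p - 1) * ?B ^ j) + smult (of_nat j * u$1$2) (?A ^ ?p * ?B ^ (j - 1))"
      unfolding col1_def col2_def by (rule pderiv_linear_powers)
    have z: "poly [:0, 1:] z = z" by simp
    show "poly ([:0, 1:] * pderiv ?P) z =
      poly (smult (of_nat ?p * (u$1$1 * u$2$2) - of_nat j * (u$1$2 * u$2$1)) ?P
      - smult (of_nat ?p * (u$1$1 * u$2$1)) (?A ^ (?p - 1) * ?B ^ (j + 1))
      + smult (of_nat j * (u$1$2 * u$2$2)) (?A ^ (?p + 1) * ?B ^ (j - 1))) z"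
      unfolding pd poly_add poly_diff poly_smult poly_mult[of "[:0, 1:]"] z
      unfolding poly_add poly_diff poly_smult poly_mult poly_power lin power_add power_one_right
      by (rule identity[OF a b det])
  qed
  then have "coeff ([:0, 1:] * pderiv ?P) (k - i) =
      (of_nat ?p * (u$1$1 * u$2$2) - of_nat j * (u$1$2 * u$2$1)) * coeff ?P (k - i)
      - (of_nat ?p * (u$1$1 * u$2$1)) * coeff (?A ^ (?p - 1) * ?B ^ (j + 1)) (k - i)
      + (of_nat j * (u$1$2 * u$2$2)) * coeff (?A ^ (?p + 1) * ?B ^ (j - 1)) (k - i)"
    by (simp only: coeff_add coeff_diff coeff_smult)
  moreover have "coeff ([:0, 1:] * pderiv ?P) (k - i) = of_nat (k - i) * coeff ?P (k - i)"
    by (cases "k - i") (simp_all add: coeff_pCons coeff_pderiv)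
  ultimately have c: "(of_nat ?p * (u$1$1 * u$2$2) - of_nat j * (u$1$2 * u$2$1) - of_nat (k - i)) * coeff ?P (k - i) =
      u$1$1 * u$2$1 * (of_nat ?p * coeff (?A ^ (?p - 1) * ?B ^ (j + 1)) (k - i))
      - u$1$2 * u$2$2 * (of_nat j * coeff (?A ^ (?p + 1) * ?B ^ (j - 1)) (k - i))"
    by (simp add: algebra_simps)
  have s: "u$1$1 * u$2$2 = 1 - of_real ((cmod (u$1$2))\<^sup>2)" "u$1$2 * u$2$1 = - of_real ((cmod (u$1$2))\<^sup>2)"
    using u det unfolding SU2_iff complex_norm_square by (auto simp: algebra_simps)
  have "of_real ((real i - real k / 2) - (real j - real k / 2) * (1 - 2 * (cmod (u$1$2))\<^sup>2)) =
     (of_nat ?p * (u$1$1 * u$2$2) - of_nat j * (u$1$2 * u$2$1) - of_nat (k - i))"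
    unfolding s using i j by (simp add: of_nat_diff) (simp add: algebra_simps)
  then have "of_real ((real i - real k / 2) - (real j - real k / 2) * (1 - 2 * (cmod (u$1$2))\<^sup>2)) * rep_SU2 k u i j =
     of_real (rep_weight k i j) * ((of_nat ?p * (u$1$1 * u$2$2) - of_nat j * (u$1$2 * u$2$1) - of_nat (k - i)) * coeff ?P (k - i))"
    by (simp only: rep_SU2_eq) (simp only: mult_ac)
  then show ?thesis
    unfolding c rep_SU2_raise[OF j, symmetric] rep_SU2_lower[OF j, symmetric]
    by (simp only: right_diff_distrib mult_ac)
qed

text \<open>The inequality |x - y|^2 \<le> 2 |x|^2 + 2 |y|^2 reduces the claim to the norms of the
  two neighbouring columns, which are 1 whenever the ladder coefficient is not 0.\<close>

lemma ladder_combination_norm: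
  assumes u: "u \<in> SU2" and j: "j \<le> k"
  shows "(\<Sum>i\<le>k. (cmod (a * (of_real (ladder k (Suc j)) * rep_SU2 k u i (Suc j)) -
      b * (of_real (ladder k j) * rep_SU2 k u i (j - 1))))\<^sup>2)
    \<le> 2 * (cmod a)\<^sup>2 * (ladder k (Suc j))\<^sup>2 + 2 * (cmod b)\<^sup>2 * (ladder k j)\<^sup>2"
proof -
  have sq: "(cmod (x - y))\<^sup>2 \<le> 2 * (cmod x)\<^sup>2 + 2 * (cmod y)\<^sup>2" for x y
  proof -
    have "(cmod (x - y))\<^sup>2 \<le> (cmod x + cmod y)\<^sup>2" by (intro power_mono norm_triangle_ineq4) auto
    also have "\<dots> \<le> 2 * (cmod x)\<^sup>2 + 2 * (cmod y)\<^sup>2"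
      using sum_squares_bound[of "cmod x" "cmod y"] by (simp add: power2_sum)
    finally show ?thesis .
  qed
  have up: "(\<Sum>i\<le>k. (cmod (a * (of_real (ladder k (Suc j)) * rep_SU2 k u i (Suc j))))\<^sup>2) = (cmod a)\<^sup>2 * (ladder k (Suc j))\<^sup>2"
  proof (cases "j = k")
    case False
    then show ?thesis using rep_SU2_column_norm[OF u, of "Suc j" k] j
      by (simp add: norm_mult power_mult_distrib mult.assoc flip: sum_distrib_left)
  qed (simp add: ladder_def)
  have down: "(\<Sum>i\<le>k. (cmod (b * (of_real (ladder k j) * rep_SU2 k u i (j - 1))))\<^sup>2) = (cmod b)\<^sup>2 * (ladder k j)\<^sup>2"
    using rep_SU2_column_norm[OF u, of "j - 1" k] j
    by (simp add: norm_mult power_mult_distrib mult.assoc flip: sum_distrib_left)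
  have "(\<Sum>i\<le>k. (cmod (a * (of_real (ladder k (Suc j)) * rep_SU2 k u i (Suc j)) -
      b * (of_real (ladder k j) * rep_SU2 k u i (j - 1))))\<^sup>2) \<le>
    (\<Sum>i\<le>k. 2 * (cmod (a * (of_real (ladder k (Suc j)) * rep_SU2 k u i (Suc j))))\<^sup>2 +
      2 * (cmod (b * (of_real (ladder k j) * rep_SU2 k u i (j - 1))))\<^sup>2)"
    by (intro sum_mono sq)
  also have "\<dots> = 2 * ((cmod a)\<^sup>2 * (ladder k (Suc j))\<^sup>2) + 2 * ((cmod b)\<^sup>2 * (ladder k j)\<^sup>2)"
    unfolding sum.distrib sum_distrib_left[symmetric] up down ..
  finally show ?thesis by simp
qed

text \<open>The value \<open>1 + \<ell>(\<ell>+1) - m\<^sup>2\<close> in terms of \<open>k = 2\<ell>\<close> and \<open>j = \<ell> + m\<close>.\<close>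

definition spectral :: "nat \<Rightarrow> nat \<Rightarrow> real" where
  "spectral k j = 1 + (real j * real (k - j) + real k / 2)"

text \<open>The column has norm 1, and its second moment about the centre (j - k/2) (1 - 2 |u_12|^2)
  is at most \<open>spectral k j\<close>; each of the two contributes at most 1.\<close>

lemma rep_SU2_concentration:
  assumes u: "u \<in> SU2" and j: "j \<le> k"
  shows "(\<Sum>i\<le>k. (1 + ((real i - real k / 2) - (real j - real k / 2) * (1 - 2 * (cmod (u$1$2))\<^sup>2))\<^sup>2 / spectral k j)
     * (cmod (rep_SU2 k u i j))\<^sup>2) \<le> 2"
proof -
  let ?s = "(cmod (u$1$2))\<^sup>2"
  let ?d = "\<lambda>i. (real i - real k / 2) - (real j - real k / 2) * (1 - 2 * ?s)"
  have \<Lambda>: "0 < spectral k j" unfolding spectral_def by (intro add_pos_nonneg) auto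
  have SU2: "(cmod (u$1$1))\<^sup>2 = 1 - ?s" "cmod (u$2$2) = cmod (u$1$1)" "cmod (u$2$1) = cmod (u$1$2)"
    using u unfolding SU2_iff by auto
  \<comment> \<open>Both products of matrix entries in \<open>rep_SU2_row_index\<close> have squared
    modulus s (1 - s) \<le> 1/4, which compensates the factors 2 of
    \<open>ladder_combination_norm\<close> and \<open>ladder_sum\<close>.\<close>
  have s01: "4 * (?s * (1 - ?s)) \<le> 1" using zero_le_power2[of "1 - 2 * ?s"] by (simp add: power2_eq_square algebra_simps)
  have "(\<Sum>i\<le>k. (?d i)\<^sup>2 * (cmod (rep_SU2 k u i j))\<^sup>2) = (\<Sum>i\<le>k. (cmod (of_real (?d i) * rep_SU2 k u i j))\<^sup>2)"
    by (simp only: norm_mult norm_of_real power_mult_distrib power2_abs)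
  also have "\<dots> = (\<Sum>i\<le>k. (cmod (u$1$1 * u$2$1 * (of_real (ladder k (Suc j)) * rep_SU2 k u i (Suc j)) -
    u$1$2 * u$2$2 * (of_real (ladder k j) * rep_SU2 k u i (j - 1))))\<^sup>2)"
    by (intro sum.cong refl, subst rep_SU2_row_index[OF u j]) auto
  also have "\<dots> \<le> 2 * (cmod (u$1$1 * u$2$1))\<^sup>2 * (ladder k (Suc j))\<^sup>2 + 2 * (cmod (u$1$2 * u$2$2))\<^sup>2 * (ladder k j)\<^sup>2"
    by (rule ladder_combination_norm[OF u j])
  also have "\<dots> = 2 * (?s * (1 - ?s)) * ((ladder k (Suc j))\<^sup>2 + (ladder k j)\<^sup>2)"
    by (simp add: norm_mult power_mult_distrib SU2 algebra_simps)
  also have "\<dots> = 4 * (?s * (1 - ?s)) * (real j * real (k - j) + real k / 2)"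
    unfolding ladder_sum[OF j] by simp
  also have "\<dots> \<le> real j * real (k - j) + real k / 2"
    using mult_right_mono[OF s01, of "real j * real (k - j) + real k / 2"] by simp
  also have "\<dots> \<le> spectral k j" by (simp add: spectral_def)
  finally have "(\<Sum>i\<le>k. (?d i)\<^sup>2 * (cmod (rep_SU2 k u i j))\<^sup>2) / spectral k j \<le> 1"
    using \<Lambda> by simp
  then show ?thesis
    using rep_SU2_column_norm[OF u j] by (simp add: distrib_right sum.distrib sum_divide_distrib)
qed

section \<open>Supremum norms of the matrix coefficients\<close>

lemma coeff_mult_has_vector_derivative:
  fixes F G :: "real \<Rightarrow> complex poly"
  assumes "\<And>c. ((\<lambda>s. coeff (F s) c) has_vector_derivative coeff F' c) (at x)"
    and "\<And>c. ((\<lambda>s. coeff (G s) c) has_vector_derivative coeff G' c) (at x)"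
  shows "((\<lambda>s. coeff (F s * G s) c) has_vector_derivative coeff (F x * G' + F' * G x) c) (at x)"
  unfolding coeff_mult coeff_add sum.distrib[symmetric]
  by (intro has_vector_derivative_sum has_vector_derivative_mult assms)

lemma coeff_power_has_vector_derivative:
  fixes F :: "real \<Rightarrow> complex poly"
  assumes F: "\<And>c. ((\<lambda>s. coeff (F s) c) has_vector_derivative coeff F' c) (at x)"
  shows "((\<lambda>s. coeff (F s ^ n) c) has_vector_derivative coeff (smult (of_nat n) (F x ^ (n - 1) * F')) c) (at x)"
proof (induction n arbitrary: c)
  case (Suc n)
  have "((\<lambda>s. coeff (F s * F s ^ n) c) has_vector_derivative
      coeff (F x * smult (of_nat n) (F x ^ (n - 1) * F') + F' * F x ^ n) c) (at x)"
    by (intro coeff_mult_has_vector_derivative F Suc)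
  moreover have "F x * smult (of_nat n) (F x ^ (n - 1) * F') = smult (of_nat n) (F x ^ n * F')"
    by (cases n) (simp_all add: mult.assoc)
  moreover have "smult (of_nat n) (F x ^ n * F') + F' * F x ^ n = smult (of_nat (Suc n)) (F x ^ (Suc n - 1) * F')"
    by (simp add: smult_add_left mult.commute)
  ultimately show ?case by (simp only: power_Suc)
qed simp

text \<open>A generator with zero diagonal and off-diagonal entries b and d replaces one factor
  \<open>col1\<close> by d times \<open>col2\<close>, or one factor \<open>col2\<close> by b times
  \<open>col1\<close>. Thus it shifts the column index by one in either direction.\<close>

lemma rep_SU2_has_vector_derivative:
  assumes j: "j \<le> k" and \<gamma>0: "\<gamma> 0 = mat 1"
    and \<gamma>: "((\<lambda>s. \<gamma> s $1$1) has_vector_derivative 0) (at 0)" "((\<lambda>s. \<gamma> s $1$2) has_vector_derivative b) (at 0)"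
      "((\<lambda>s. \<gamma> s $2$1) has_vector_derivative d) (at 0)" "((\<lambda>s. \<gamma> s $2$2) has_vector_derivative 0) (at 0)"
  shows "((\<lambda>s. rep_SU2 k (x ** \<gamma> s) i j) has_vector_derivative
     d * (of_real (ladder k (Suc j)) * rep_SU2 k x i (Suc j)) + b * (of_real (ladder k j) * rep_SU2 k x i (j - 1))) (at 0)"
proof -
  let ?A = "col1 x" and ?B = "col2 x" and ?p = "k - j"
  have cols: "col1 (x ** \<gamma> s) = smult (\<gamma> s $1$1) ?A + smult (\<gamma> s $2$1) ?B"
    "col2 (x ** \<gamma> s) = smult (\<gamma> s $1$2) ?A + smult (\<gamma> s $2$2) ?B" for s
    by (simp_all add: col1_def col2_def matrix_matrix_mult_def sum_2 algebra_simps)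
  have at_0: "col1 (x ** \<gamma> 0) = ?A" "col2 (x ** \<gamma> 0) = ?B" by (simp_all add: \<gamma>0)
  have lin: "((\<lambda>s. coeff (col1 (x ** \<gamma> s)) c) has_vector_derivative coeff (smult d ?B) c) (at 0)"
    "((\<lambda>s. coeff (col2 (x ** \<gamma> s)) c) has_vector_derivative coeff (smult b ?A) c) (at 0)" for c
    unfolding cols by (auto intro!: derivative_eq_intros \<gamma>)
  have "((\<lambda>s. coeff (col1 (x ** \<gamma> s) ^ ?p * col2 (x ** \<gamma> s) ^ j) (k - i)) has_vector_derivative
      coeff (?A ^ ?p * smult (of_nat j) (?B ^ (j - 1) * smult b ?A) +
        smult (of_nat ?p) (?A ^ (?p - 1) * smult d ?B) * ?B ^ j) (k - i)) (at 0)"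
    using coeff_mult_has_vector_derivative[OF coeff_power_has_vector_derivative[OF lin(1), of ?p]
       coeff_power_has_vector_derivative[OF lin(2), of j], of "k - i"] unfolding at_0 .
  moreover have "?A ^ ?p * smult (of_nat j) (?B ^ (j - 1) * smult b ?A) +
        smult (of_nat ?p) (?A ^ (?p - 1) * smult d ?B) * ?B ^ j =
      smult (d * of_nat ?p) (?A ^ (?p - 1) * ?B ^ (j + 1)) + smult (b * of_nat j) (?A ^ (?p + 1) * ?B ^ (j - 1))"
    by (simp add: algebra_simps)
  ultimately have "((\<lambda>s. coeff (col1 (x ** \<gamma> s) ^ ?p * col2 (x ** \<gamma> s) ^ j) (k - i)) has_vector_derivative
      d * (of_nat ?p * coeff (?A ^ (?p - 1) * ?B ^ (j + 1)) (k - i)) +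
      b * (of_nat j * coeff (?A ^ (?p + 1) * ?B ^ (j - 1)) (k - i))) (at 0)"
    by (simp only: coeff_add coeff_smult mult.assoc)
  then have "((\<lambda>s. of_real (rep_weight k i j) * coeff (col1 (x ** \<gamma> s) ^ ?p * col2 (x ** \<gamma> s) ^ j) (k - i))
      has_vector_derivative of_real (rep_weight k i j) *
      (d * (of_nat ?p * coeff (?A ^ (?p - 1) * ?B ^ (j + 1)) (k - i)) +
      b * (of_nat j * coeff (?A ^ (?p + 1) * ?B ^ (j - 1)) (k - i)))) (at 0)"
    by (rule has_vector_derivative_mult_right)
  then show ?thesis
    unfolding rep_SU2_eq[symmetric] rep_SU2_raise[OF j, symmetric] rep_SU2_lower[OF j, symmetric]
    by (simp only: distrib_left mult_ac)
qed

lemma omega1_derivatives: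
  "((\<lambda>s. omega1 s $1$1) has_vector_derivative 0) (at 0)" "((\<lambda>s. omega1 s $1$2) has_vector_derivative \<i> / 2) (at 0)"
  "((\<lambda>s. omega1 s $2$1) has_vector_derivative \<i> / 2) (at 0)" "((\<lambda>s. omega1 s $2$2) has_vector_derivative 0) (at 0)"
  unfolding omega1_def
  by (auto intro!: derivative_eq_intros simp: vector_def has_vector_derivative_def scaleR_conv_of_real fun_eq_iff algebra_simps)

lemma omega2_derivatives:
  "((\<lambda>s. omega2 s $1$1) has_vector_derivative 0) (at 0)" "((\<lambda>s. omega2 s $1$2) has_vector_derivative - 1 / 2) (at 0)"
  "((\<lambda>s. omega2 s $2$1) has_vector_derivative 1 / 2) (at 0)" "((\<lambda>s. omega2 s $2$2) has_vector_derivative 0) (at 0)"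
  unfolding omega2_def
  by (auto intro!: derivative_eq_intros simp: vector_def has_vector_derivative_def scaleR_conv_of_real fun_eq_iff algebra_simps)

lemma omega_0: "omega1 0 = mat 1" "omega2 0 = mat 1"
  by (simp_all add: omega1_def omega2_def vec_eq_iff forall_2 mat_def)

lemma omega_SU2: "omega1 s \<in> SU2" "omega2 s \<in> SU2"
  by (simp_all add: SU2_iff omega1_def omega2_def norm_mult power_mult_distrib)

lemma omega2_add: "omega2 (s + t) = omega2 s ** omega2 t"
  by (simp add: omega2_def vec_eq_iff forall_2 matrix_matrix_mult_def sum_2 add_divide_distrib
      cos_add sin_add algebra_simps)

text \<open>The derivative of the matrix coefficient along the left-invariant field generated by
  \<open>omega2\<close>.\<close>

definition rep_D2 :: "nat \<Rightarrow> complex^2^2 \<Rightarrow> nat \<Rightarrow> nat \<Rightarrow> complex" where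
  "rep_D2 k u i j = 1 / 2 * (of_real (ladder k (Suc j)) * rep_SU2 k u i (Suc j)) -
     1 / 2 * (of_real (ladder k j) * rep_SU2 k u i (j - 1))"

lemma rep_SU2_omega2_has_vector_derivative:
  assumes "j \<le> k"
  shows "((\<lambda>s. rep_SU2 k (omega2 s) i j) has_vector_derivative rep_D2 k (omega2 t) i j) (at t)"
proof -
  have "((\<lambda>s. rep_SU2 k (omega2 t ** omega2 s) i j) has_vector_derivative rep_D2 k (omega2 t) i j) (at (t - t))"
    using rep_SU2_has_vector_derivative[OF assms omega_0(2) omega2_derivatives, of "omega2 t" i]
    by (simp add: rep_D2_def)
  moreover have "((\<lambda>s. s - t) has_vector_derivative 1) (at t)"
    by (auto intro!: derivative_eq_intros)
  ultimately have "((\<lambda>s. rep_SU2 k (omega2 t ** omega2 s) i j) \<circ> (\<lambda>s. s - t) has_vector_derivative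
      1 *\<^sub>R rep_D2 k (omega2 t) i j) (at t)"
    by (intro vector_diff_chain_at)
  then show ?thesis by (simp add: o_def flip: omega2_add)
qed

lemma continuous_on_rep_SU2_omega2:
  assumes "j \<le> k"
  shows "continuous_on S (\<lambda>s. rep_SU2 k (omega2 s) i j)"
  using rep_SU2_omega2_has_vector_derivative[OF assms]
  by (intro continuous_at_imp_continuous_on ballI) (rule has_vector_derivative_continuous)

lemma continuous_on_rep_D2_omega2:
  assumes "j \<le> k"
  shows "continuous_on S (\<lambda>s. rep_D2 k (omega2 s) i j)"
proof -
  have up: "continuous_on S (\<lambda>s. of_real (ladder k (Suc j)) * rep_SU2 k (omega2 s) i (Suc j))"
  proof (cases "j = k")
    case False
    then show ?thesis using assms by (intro continuous_intros continuous_on_rep_SU2_omega2) auto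
  qed (simp add: ladder_def)
  show ?thesis
    unfolding rep_D2_def using assms
    by (intro continuous_on_diff continuous_on_mult_left up continuous_on_rep_SU2_omega2) auto
qed

lemma pcompose_power: "pcompose (p ^ n) q = pcompose p q ^ n"
  for p q :: "'a::comm_semiring_1 poly"
  by (induction n) (simp_all add: pcompose_mult pcompose_1)

section \<open>Sobolev estimate along the torus \<open>omega2\<close>\<close>

text \<open>Euler decomposition: u is \<open>omega2 \<theta>\<close> between two diagonal factors.
  The left one rotates the variable z, the right one multiplies the two linear forms by phases, and
  neither changes the moduli of the entries.\<close>

lemma rep_SU2_diagonal_phase:
  assumes u: "u \<in> SU2"
  obtains \<theta> where "0 \<le> \<theta>" "\<theta> \<le> pi" "\<And>k i j. cmod (rep_SU2 k u i j) = cmod (rep_SU2 k (omega2 \<theta>) i j)"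
proof
  define \<sigma> where "\<sigma> = cmod (u$1$2)"
  define \<theta> where "\<theta> = 2 * arcsin \<sigma>"
  define e1 where "e1 = cis (Arg (u$1$1))"
  \<comment> \<open>The sign matches the entry - sin (\<theta>/2) of
    \<open>omega2 \<theta>\<close>.\<close>
  define e2 where "e2 = cis (Arg (- u$1$2))"
  have n: "(cmod (u$1$1))\<^sup>2 + \<sigma>\<^sup>2 = 1" using u by (simp add: SU2_iff \<sigma>_def)
  have "\<sigma>\<^sup>2 \<le> 1\<^sup>2" unfolding one_power2 using n zero_le_power2[of "cmod (u$1$1)"] by linarith
  then have \<sigma>: "0 \<le> \<sigma>" "\<sigma> \<le> 1" using power2_le_imp_le[of \<sigma> 1] by (auto simp: \<sigma>_def)
  show "0 \<le> \<theta>" "\<theta> \<le> pi" using \<sigma> arcsin_ubound[of \<sigma>] arcsin_lbound[of \<sigma>] arcsin_le_arcsin[of 0 \<sigma>] by (auto simp: \<theta>_def)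
  have sin: "sin (\<theta> / 2) = \<sigma>" using \<sigma> by (simp add: \<theta>_def)
  have cos: "cos (\<theta> / 2) = cmod (u$1$1)"
    using \<sigma> n by (simp add: \<theta>_def cos_arcsin real_sqrt_unique flip: eq_diff_eq)
  have e: "u$1$1 = of_real (cos (\<theta> / 2)) * e1" "u$1$2 = - of_real (sin (\<theta> / 2)) * e2"
    using rcis_cmod_Arg[of "u$1$1"] rcis_cmod_Arg[of "- u$1$2"]
    unfolding sin cos e1_def e2_def \<sigma>_def rcis_def by (auto simp: minus_equation_iff)
  have unit: "cnj e1 * e1 = 1" "cnj e2 * e2 = 1" by (simp_all add: e1_def e2_def cis_cnj flip: cis_inverse)
  let ?w = "e1 * e2"
  have "col1 u = smult (cnj e2) (pcompose (col1 (omega2 \<theta>)) [:0, ?w:])"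
    using u unit by (simp add: col1_def omega2_def SU2_iff e pcompose_pCons algebra_simps)
  moreover have "col2 u = smult (cnj e1) (pcompose (col2 (omega2 \<theta>)) [:0, ?w:])"
    using u unit by (simp add: col2_def omega2_def SU2_iff e pcompose_pCons algebra_simps)
  ultimately have P: "col1 u ^ p * col2 u ^ q = smult (cnj e2 ^ p * cnj e1 ^ q)
      (pcompose (col1 (omega2 \<theta>) ^ p * col2 (omega2 \<theta>) ^ q) [:0, ?w:])" for p q
    by (simp add: smult_power pcompose_mult pcompose_power mult.commute)
  show "cmod (rep_SU2 k u i j) = cmod (rep_SU2 k (omega2 \<theta>) i j)" for k i j
    unfolding rep_SU2_eq P coeff_smult coeff_pcompose_linear
    by (simp add: norm_mult norm_power e1_def e2_def)
qed

text \<open>A majorant of the sup norm: the fundamental theorem of calculus for |t|^2 on the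
  parameter range [0, pi], with the derivative bounded by 2 |t| |t'|. The product stays under the
  integral so that the sum over the rows can be taken there first.\<close>

definition sup_bound :: "nat \<Rightarrow> nat \<Rightarrow> nat \<Rightarrow> real" where
  "sup_bound k i j = sqrt ((cmod (rep_SU2 k (omega2 0) i j))\<^sup>2 +
     integral {0..pi} (\<lambda>s. 2 * (cmod (rep_SU2 k (omega2 s) i j) * cmod (rep_D2 k (omega2 s) i j))))"

lemma rep_SU2_le_sup_bound:
  assumes u: "u \<in> SU2" and j: "j \<le> k"
  shows "cmod (rep_SU2 k u i j) \<le> sup_bound k i j"
proof -
  obtain \<theta> where \<theta>: "0 \<le> \<theta>" "\<theta> \<le> pi" and eq: "cmod (rep_SU2 k u i j) = cmod (rep_SU2 k (omega2 \<theta>) i j)"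
    using rep_SU2_diagonal_phase[OF u] by metis
  let ?t = "\<lambda>s. rep_SU2 k (omega2 s) i j" and ?D = "\<lambda>s. rep_D2 k (omega2 s) i j"
  have der: "((\<lambda>s. ?t s \<bullet> ?t s) has_vector_derivative ?t s \<bullet> ?D s + ?D s \<bullet> ?t s) (at s within {0..\<theta>})" for s
    by (rule bounded_bilinear.has_vector_derivative[OF bounded_bilinear_inner];
        rule has_vector_derivative_at_within[OF rep_SU2_omega2_has_vector_derivative[OF j]])
  have int: "((\<lambda>s. ?t s \<bullet> ?D s + ?D s \<bullet> ?t s) has_integral ?t \<theta> \<bullet> ?t \<theta> - ?t 0 \<bullet> ?t 0) {0..\<theta>}"
    by (rule fundamental_theorem_of_calculus[OF \<theta>(1)]) (rule der)
  have io: "(\<lambda>s. 2 * (cmod (?t s) * cmod (?D s))) integrable_on {a..b}" for a b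
    using j by (intro integrable_continuous_real continuous_intros continuous_on_rep_SU2_omega2 continuous_on_rep_D2_omega2)
  have "?t \<theta> \<bullet> ?t \<theta> - ?t 0 \<bullet> ?t 0 \<le> integral {0..\<theta>} (\<lambda>s. 2 * (cmod (?t s) * cmod (?D s)))"
  proof (rule has_integral_le[OF int integrable_integral[OF io]])
    fix s
    show "?t s \<bullet> ?D s + ?D s \<bullet> ?t s \<le> 2 * (cmod (?t s) * cmod (?D s))"
      using norm_cauchy_schwarz[of "?t s" "?D s"] by (simp add: inner_commute)
  qed
  also have "\<dots> \<le> integral {0..pi} (\<lambda>s. 2 * (cmod (?t s) * cmod (?D s)))"
    using \<theta> by (intro integral_subset_le io) auto
  finally have "(cmod (rep_SU2 k u i j))\<^sup>2 \<le> (cmod (?t 0))\<^sup>2 + integral {0..pi} (\<lambda>s. 2 * (cmod (?t s) * cmod (?D s)))"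
    unfolding eq by (simp add: dot_square_norm)
  then show ?thesis unfolding sup_bound_def by (rule real_le_rsqrt)
qed

lemma spectral_ge_1: "1 \<le> spectral k j"
  by (simp add: spectral_def)

lemma sup_bound_nonneg: "j \<le> k \<Longrightarrow> 0 \<le> sup_bound k i j"
  by (rule order_trans[OF norm_ge_zero rep_SU2_le_sup_bound[OF omega_SU2(2)]])

text \<open>Under the integral, Cauchy-Schwarz over the rows pairs a column of norm 1 with its
  derivative, whose norm is at most sqrt \<Lambda>. The constant 9 comes from the initial value 1
  and from 2 pi < 8.\<close>

lemma sum_sup_bound_squares:
  assumes j: "j \<le> k"
  shows "(\<Sum>i\<le>k. (sup_bound k i j)\<^sup>2) \<le> 9 * sqrt (spectral k j)"
proof -
  let ?t = "\<lambda>i s. rep_SU2 k (omega2 s) i j" and ?D = "\<lambda>i s. rep_D2 k (omega2 s) i j"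
  have cont: "continuous_on S (\<lambda>s. 2 * (cmod (?t i s) * cmod (?D i s)))" for i S
    using j by (intro continuous_intros continuous_on_rep_SU2_omega2 continuous_on_rep_D2_omega2)
  have int_nonneg: "0 \<le> integral {0..pi} (\<lambda>s. 2 * (cmod (?t i s) * cmod (?D i s)))" for i
    by (intro integral_nonneg integrable_continuous_real cont) auto
  have pw: "(\<Sum>i\<le>k. 2 * (cmod (?t i s) * cmod (?D i s))) \<le> 2 * sqrt (spectral k j)" for s
  proof -
    have "(\<Sum>i\<le>k. (cmod (?D i s))\<^sup>2) \<le> 2 * (cmod (1/2))\<^sup>2 * (ladder k (Suc j))\<^sup>2 + 2 * (cmod (1/2))\<^sup>2 * (ladder k j)\<^sup>2"
      unfolding rep_D2_def by (rule ladder_combination_norm[OF omega_SU2(2) j])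
    also have "\<dots> = ((ladder k (Suc j))\<^sup>2 + (ladder k j)\<^sup>2) / 2"
      by (simp add: power2_eq_square)
    also have "\<dots> \<le> spectral k j" unfolding ladder_sum[OF j] by (simp add: spectral_def)
    finally have D: "sqrt (\<Sum>i\<le>k. (cmod (?D i s))\<^sup>2) \<le> sqrt (spectral k j)" by simp
    have "(\<Sum>i\<le>k. \<bar>cmod (?t i s)\<bar> * \<bar>cmod (?D i s)\<bar>) \<le> L2_set (\<lambda>i. cmod (?t i s)) {..k} * L2_set (\<lambda>i. cmod (?D i s)) {..k}"
      by (rule L2_set_mult_ineq)
    also have "\<dots> \<le> sqrt (spectral k j)"
      using D rep_SU2_column_norm[OF omega_SU2(2) j] by (simp add: L2_set_def)
    finally show ?thesis by (simp flip: sum_distrib_left)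
  qed
  have "(\<Sum>i\<le>k. (sup_bound k i j)\<^sup>2) =
      (\<Sum>i\<le>k. (cmod (?t i 0))\<^sup>2) + (\<Sum>i\<le>k. integral {0..pi} (\<lambda>s. 2 * (cmod (?t i s) * cmod (?D i s))))"
    unfolding sum.distrib[symmetric] sup_bound_def using int_nonneg
    by (intro sum.cong refl real_sqrt_pow2 add_nonneg_nonneg) auto
  also have "(\<Sum>i\<le>k. (cmod (?t i 0))\<^sup>2) = 1" by (rule rep_SU2_column_norm[OF omega_SU2(2) j])
  also have "(\<Sum>i\<le>k. integral {0..pi} (\<lambda>s. 2 * (cmod (?t i s) * cmod (?D i s)))) =
     integral {0..pi} (\<lambda>s. \<Sum>i\<le>k. 2 * (cmod (?t i s) * cmod (?D i s)))"
    by (intro integral_sum[symmetric] integrable_continuous_real cont) auto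
  also have "\<dots> \<le> integral {0..pi} (\<lambda>s. 2 * sqrt (spectral k j))"
    by (intro integral_le integrable_continuous_real continuous_on_sum cont pw) auto
  also have "\<dots> = 2 * pi * sqrt (spectral k j)" by simp
  also have "\<dots> \<le> 8 * sqrt (spectral k j)" using pi_less_4 spectral_ge_1[of k j] by (intro mult_right_mono) auto
  finally show ?thesis using real_sqrt_ge_one[OF spectral_ge_1, of k j] by linarith
qed

section \<open>\<open>L\<^sup>1\<close> norms of the matrix coefficients\<close>

text \<open>The primitive is an arctangent of total variation at most pi. The bound does not depend
  on the centre m, so it serves all rows alike.\<close>

lemma integral_Cauchy_kernel_le:
  assumes n: "n \<noteq> 0" and \<Lambda>: "0 < \<Lambda>"
  shows "integral {-1..1} (\<lambda>x. 1 / (1 + (m - n * x)\<^sup>2 / \<Lambda>)) \<le> pi * sqrt \<Lambda> / \<bar>n\<bar>"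
proof -
  define F where "F x = - sqrt \<Lambda> / n * arctan ((m - n * x) / sqrt \<Lambda>)" for x
  have sq: "((m - n * x) / sqrt \<Lambda>)\<^sup>2 = (m - n * x)\<^sup>2 / \<Lambda>" for x
    using \<Lambda> by (simp add: power_divide)
  have "((\<lambda>x. 1 / (1 + (m - n * x)\<^sup>2 / \<Lambda>)) has_integral F 1 - F (-1)) {-1..1}"
  proof (rule fundamental_theorem_of_calculus)
    fix x
    have "(F has_real_derivative - sqrt \<Lambda> / n * (inverse (1 + ((m - n * x) / sqrt \<Lambda>)\<^sup>2) * (- n / sqrt \<Lambda>))) (at x within {-1..1})"
    proof -
      have "((\<lambda>x. (m - n * x) / sqrt \<Lambda>) has_real_derivative - n / sqrt \<Lambda>) (at x within {-1..1})"
        using \<Lambda> by (auto intro!: derivative_eq_intros simp: power2_eq_square real_div_sqrt divide_simps)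
      then show ?thesis unfolding F_def[abs_def] by (intro DERIV_cmult DERIV_chain2[OF DERIV_arctan])
    qed
    moreover have "- sqrt \<Lambda> / n * (inverse (1 + ((m - n * x) / sqrt \<Lambda>)\<^sup>2) * (- n / sqrt \<Lambda>)) = 1 / (1 + (m - n * x)\<^sup>2 / \<Lambda>)"
    proof -
      have "- sqrt \<Lambda> / n * (X * (- n / sqrt \<Lambda>)) = X" for X using n \<Lambda> by (simp add: field_simps)
      then show ?thesis by (simp only: sq inverse_eq_divide)
    qed
    ultimately show "(F has_vector_derivative 1 / (1 + (m - n * x)\<^sup>2 / \<Lambda>)) (at x within {-1..1})"
      by (simp add: has_real_derivative_iff_has_vector_derivative)
  qed simp
  then have "integral {-1..1} (\<lambda>x. 1 / (1 + (m - n * x)\<^sup>2 / \<Lambda>)) = F 1 - F (-1)"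
    by (rule integral_unique)
  also have "\<dots> \<le> \<bar>sqrt \<Lambda> / n\<bar> * \<bar>arctan ((m + n) / sqrt \<Lambda>) - arctan ((m - n) / sqrt \<Lambda>)\<bar>"
    unfolding abs_mult[symmetric] F_def by (rule order_trans[OF _ abs_ge_self]) (simp add: algebra_simps)
  also have "\<dots> \<le> \<bar>sqrt \<Lambda> / n\<bar> * pi"
    using arctan_bounded[of "(m + n) / sqrt \<Lambda>"] arctan_bounded[of "(m - n) / sqrt \<Lambda>"]
    by (intro mult_left_mono) auto
  finally show ?thesis using \<Lambda> by (simp add: mult.commute)
qed

text \<open>The common setting of the three groups. On SO(3) the lift is an arbitrary choice of
  preimages, so measurability is required only of the coefficients with k in K and of the axis
  cosine. The Haar measure enters the estimates through the uniform law of that cosine.\<close>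

locale SU2_lift = prob_space M for M :: "'a measure" +
  fixes lift :: "'a \<Rightarrow> complex^2^2" and K :: "nat set"
  assumes lift_SU2: "x \<in> space M \<Longrightarrow> lift x \<in> SU2"
    and rep_lift_measurable: "k \<in> K \<Longrightarrow> j \<le> k \<Longrightarrow> (\<lambda>x. rep_SU2 k (lift x) i j) \<in> borel_measurable M"
    and lift_axis_cos_measurable [measurable]: "(\<lambda>x. 1 - 2 * (cmod (lift x $1$2))\<^sup>2) \<in> borel_measurable M"
    and lift_axis_cos_uniform: "continuous_on {-1..1} (h :: real \<Rightarrow> real) \<Longrightarrow>
      (\<integral>x. h (1 - 2 * (cmod (lift x $1$2))\<^sup>2) \<partial>M) = integral {-1..1} h / 2"
begin

text \<open>The (3,3) entry of the associated rotation, that is the cosine of the angle between the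
  third axis and its image.\<close>

definition axis_cos :: "'a \<Rightarrow> real" where "axis_cos x = 1 - 2 * (cmod (lift x $1$2))\<^sup>2"

lemma axis_cos_measurable [measurable]: "axis_cos \<in> borel_measurable M"
  unfolding axis_cos_def[abs_def] by (rule lift_axis_cos_measurable)

lemma rep_lift_bound:
  assumes "k \<in> K" "j \<le> k" "x \<in> space M"
  shows "cmod (rep_SU2 k (lift x) i j) \<le> sup_bound k i j"
  using rep_SU2_le_sup_bound lift_SU2 assms by blast

lemma integrable_rep_lift:
  assumes "k \<in> K" "j \<le> k"
  shows "integrable M (\<lambda>x. cmod (rep_SU2 k (lift x) i j))"
  using rep_lift_measurable[OF assms] rep_lift_bound[OF assms]
  by (intro integrable_const_bound[where B = "sup_bound k i j"] AE_I2) auto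

text \<open>If \<Lambda> is small compared with (k + 1)^2, the slope |j - k/2| is at least (k + 1) /
  3 and the Cauchy kernel estimate applies, with pi < 10/3. Otherwise the right-hand side is at
  least 1 and the trivial bound is enough.\<close>

lemma integral_weight_le:
  assumes j: "j \<le> k"
  shows "(\<integral>x. 1 / (1 + (m - (real j - real k / 2) * axis_cos x)\<^sup>2 / spectral k j) \<partial>M)
    \<le> 5 * sqrt (spectral k j) / (real k + 1)"
proof -
  let ?n = "real j - real k / 2" and ?\<Lambda> = "spectral k j"
  have \<Lambda>: "1 \<le> ?\<Lambda>" by (rule spectral_ge_1)
  have nz: "1 + (m - ?n * x)\<^sup>2 / ?\<Lambda> \<noteq> 0" for x
    using \<Lambda> by (smt (verit) divide_nonneg_nonneg zero_le_power2)
  \<comment> \<open>This is m^2 + \<Lambda> = (l + 1/2)^2 + 3/4.\<close>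
  have n2: "?n\<^sup>2 = (real k + 1)\<^sup>2 / 4 + 3 / 4 - ?\<Lambda>"
    using j by (simp add: spectral_def of_nat_diff power2_eq_square field_simps)
  have ge1: "1 \<le> 1 + (m - ?n * x)\<^sup>2 / ?\<Lambda>" for x using \<Lambda> by simp
  have le1: "1 / (1 + (m - ?n * x)\<^sup>2 / ?\<Lambda>) \<le> 1" "0 \<le> 1 / (1 + (m - ?n * x)\<^sup>2 / ?\<Lambda>)" for x
    using ge1[of x] by (simp_all add: divide_le_eq_1)
  have "(\<integral>x. 1 / (1 + (m - ?n * axis_cos x)\<^sup>2 / ?\<Lambda>) \<partial>M) \<le> (\<integral>x. 1 \<partial>M)"
    using le1 by (intro integral_mono integrable_const integrable_const_bound[where B = 1] AE_I2) auto
  then have "(\<integral>x. 1 / (1 + (m - ?n * axis_cos x)\<^sup>2 / ?\<Lambda>) \<partial>M) \<le> 1" by (simp add: prob_space)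
  moreover have "(\<integral>x. 1 / (1 + (m - ?n * axis_cos x)\<^sup>2 / ?\<Lambda>) \<partial>M) \<le> 5 * sqrt ?\<Lambda> / (real k + 1)"
    if small: "8 * ?\<Lambda> \<le> (real k + 1)\<^sup>2"
  proof -
    have "((real k + 1) / 3)\<^sup>2 = (real k + 1)\<^sup>2 / 9" by (simp add: power_divide)
    then have "((real k + 1) / 3)\<^sup>2 \<le> ?n\<^sup>2"
      unfolding n2 using small zero_le_power2[of "real k + 1"] by linarith
    then have n: "(real k + 1) / 3 \<le> \<bar>?n\<bar>" by (simp flip: abs_le_square_iff)
    have "(\<integral>x. 1 / (1 + (m - ?n * axis_cos x)\<^sup>2 / ?\<Lambda>) \<partial>M) = integral {-1..1} (\<lambda>x. 1 / (1 + (m - ?n * x)\<^sup>2 / ?\<Lambda>)) / 2"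
      unfolding axis_cos_def using nz
      by (intro lift_axis_cos_uniform[where h = "\<lambda>x. 1 / (1 + (m - ?n * x)\<^sup>2 / ?\<Lambda>)"] continuous_intros)
        (use \<Lambda> in auto)
    also have "\<dots> \<le> (pi * sqrt ?\<Lambda> / \<bar>?n\<bar>) / 2"
      using n \<Lambda> by (intro divide_right_mono integral_Cauchy_kernel_le) auto
    also have "\<dots> \<le> (10 / 3 * sqrt ?\<Lambda> / ((real k + 1) / 3)) / 2"
      using n \<Lambda> pi_approx by (intro divide_right_mono frac_le mult_right_mono) auto
    also have "\<dots> = 5 * sqrt ?\<Lambda> / (real k + 1)" by (simp add: divide_simps)
    finally show ?thesis .
  qed
  moreover have "1 \<le> 5 * sqrt ?\<Lambda> / (real k + 1)" if "\<not> 8 * ?\<Lambda> \<le> (real k + 1)\<^sup>2"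
  proof -
    have "(real k + 1)\<^sup>2 \<le> 25 * ?\<Lambda>" using that \<Lambda> by linarith
    then have "real k + 1 \<le> sqrt (25 * ?\<Lambda>)" by (rule real_le_rsqrt)
    then show ?thesis by (simp add: real_sqrt_mult le_divide_eq)
  qed
  ultimately show ?thesis by (cases "8 * ?\<Lambda> \<le> (real k + 1)\<^sup>2") (blast intro: order_trans)+
qed

text \<open>The weighted Cauchy-Schwarz inequality in its additive form 2 A t \<le> \<nu> A^2 / w +
  w t^2 / \<nu>. Summing over the rows before integrating allows the pointwise concentration bound
  on the second term, while the first needs only the integral of 1 / w and the bound on the sum of
  A^2.\<close>

lemma sum_sup_L1:
  assumes k: "k \<in> K" and j: "j \<le> k"
  shows "(\<Sum>i\<le>k. sup_bound k i j * (\<integral>x. cmod (rep_SU2 k (lift x) i j) \<partial>M)) \<le> 10 * sqrt (spectral k j / (real k + 1))"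
proof -
  let ?n = "real j - real k / 2" and ?\<Lambda> = "spectral k j" and ?R = "sqrt (spectral k j / (real k + 1))"
  define w where "w i x = 1 + ((real i - real k / 2) - ?n * axis_cos x)\<^sup>2 / ?\<Lambda>" for i x
  define t where "t i x = cmod (rep_SU2 k (lift x) i j)" for i x
  define A where "A i = sup_bound k i j" for i
  have \<Lambda>: "1 \<le> ?\<Lambda>" by (rule spectral_ge_1)
  then have R: "0 < ?R" by simp
  \<comment> \<open>A nearly optimal choice for 45 \<nu> R^2 + 2 / \<nu>, where 45 = 5 * 9 collects
    the two previous constants. It gives 9 R + 10 R for twice the sum.\<close>
  define \<nu> where "\<nu> = 1 / (5 * ?R)"
  have \<nu>: "0 < \<nu>" using R by (simp add: \<nu>_def)
  have w1: "1 \<le> w i x" for i x using \<Lambda> by (simp add: w_def)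
  have t0: "0 \<le> t i x" for i x by (simp add: t_def)
  have A0: "0 \<le> A i" for i using j by (simp add: A_def sup_bound_nonneg)
  have [measurable]: "t i \<in> borel_measurable M" for i
    unfolding t_def[abs_def] using rep_lift_measurable[OF k j] by measurable
  have [measurable]: "w i \<in> borel_measurable M" for i unfolding w_def[abs_def] by measurable
  have int_t: "integrable M (t i)" for i
    unfolding t_def[abs_def] using integrable_rep_lift[OF k j] .
  have int_w: "integrable M (\<lambda>x. 1 / w i x)" for i
  proof (intro integrable_const_bound[where B=1] AE_I2)
    show "norm (1 / w i x) \<le> 1" for x using w1[of i x] by (auto simp: divide_le_eq_1 abs_if)
  qed simp
  have conc: "(\<Sum>i\<le>k. w i x * (t i x)\<^sup>2) \<le> 2" if "x \<in> space M" for x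
    using rep_SU2_concentration[OF lift_SU2[OF that] j] by (simp add: w_def t_def axis_cos_def)
  have amgm: "2 * (A i * t i x) \<le> \<nu> * (A i)\<^sup>2 * (1 / w i x) + w i x * (t i x)\<^sup>2 / \<nu>" for i x
  proof -
    have w0: "0 < w i x" using w1[of i x] by linarith
    have "0 \<le> (sqrt (\<nu> / w i x) * A i - sqrt (w i x / \<nu>) * t i x)\<^sup>2" by simp
    also have "\<dots> = \<nu> / w i x * (A i)\<^sup>2 + w i x / \<nu> * (t i x)\<^sup>2 - 2 * (sqrt (\<nu> / w i x) * sqrt (w i x / \<nu>)) * (A i * t i x)"
      using \<nu> w0 by (simp add: power2_diff power_mult_distrib)
    also have "sqrt (\<nu> / w i x) * sqrt (w i x / \<nu>) = 1"
      using \<nu> w0 by (simp flip: real_sqrt_mult)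
    finally show ?thesis by simp
  qed
  have pw: "2 * (\<Sum>i\<le>k. A i * t i x) \<le> (\<Sum>i\<le>k. \<nu> * (A i)\<^sup>2 * (1 / w i x)) + 2 / \<nu>" if "x \<in> space M" for x
  proof -
    have "2 * (\<Sum>i\<le>k. A i * t i x) \<le> (\<Sum>i\<le>k. \<nu> * (A i)\<^sup>2 * (1 / w i x) + w i x * (t i x)\<^sup>2 / \<nu>)"
      unfolding sum_distrib_left by (intro sum_mono amgm)
    also have "\<dots> = (\<Sum>i\<le>k. \<nu> * (A i)\<^sup>2 * (1 / w i x)) + (\<Sum>i\<le>k. w i x * (t i x)\<^sup>2) / \<nu>"
      by (simp add: sum.distrib sum_divide_distrib)
    also have "\<dots> \<le> (\<Sum>i\<le>k. \<nu> * (A i)\<^sup>2 * (1 / w i x)) + 2 / \<nu>"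
      using conc[OF that] \<nu> by (intro add_left_mono divide_right_mono) auto
    finally show ?thesis .
  qed
  have "2 * (\<Sum>i\<le>k. A i * (\<integral>x. t i x \<partial>M)) = (\<integral>x. 2 * (\<Sum>i\<le>k. A i * t i x) \<partial>M)"
    using int_t by simp
  also have "\<dots> \<le> (\<integral>x. (\<Sum>i\<le>k. \<nu> * (A i)\<^sup>2 * (1 / w i x)) + 2 / \<nu> \<partial>M)"
    using int_t int_w
    by (intro integral_mono pw Bochner_Integration.integrable_add Bochner_Integration.integrable_sum
        integrable_mult_right integrable_const)
  also have "\<dots> = (\<Sum>i\<le>k. \<nu> * (A i)\<^sup>2 * (\<integral>x. 1 / w i x \<partial>M)) + 2 / \<nu>"
  proof -
    have int: "integrable M (\<lambda>x. \<nu> * (A i)\<^sup>2 * (1 / w i x))" for i using int_w by (intro integrable_mult_right)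
    then have int_sum: "integrable M (\<lambda>x. \<Sum>i\<le>k. \<nu> * (A i)\<^sup>2 * (1 / w i x))"
      by (intro Bochner_Integration.integrable_sum)
    have const: "(\<integral>x. 2 / \<nu> \<partial>M) = 2 / \<nu>" by (simp add: prob_space)
    show ?thesis
      unfolding Bochner_Integration.integral_add[OF int_sum integrable_const] const
        Bochner_Integration.integral_sum[OF int] integral_mult_right_zero ..
  qed
  also have "\<dots> \<le> (\<Sum>i\<le>k. \<nu> * (A i)\<^sup>2 * (5 * sqrt ?\<Lambda> / (real k + 1))) + 2 / \<nu>"
    unfolding w_def using \<nu> by (intro add_right_mono sum_mono mult_left_mono integral_weight_le j) auto
  also have "\<dots> = (\<nu> * (5 * sqrt ?\<Lambda> / (real k + 1))) * (\<Sum>i\<le>k. (A i)\<^sup>2) + 2 / \<nu>"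
    unfolding sum_distrib_left by (simp add: mult_ac)
  also have "\<dots> \<le> (\<nu> * (5 * sqrt ?\<Lambda> / (real k + 1))) * (9 * sqrt ?\<Lambda>) + 2 / \<nu>"
    using sum_sup_bound_squares[OF j] \<nu> \<Lambda> unfolding A_def by (intro add_right_mono mult_left_mono) auto
  also have "\<dots> = \<nu> * 45 * ?R\<^sup>2 + 2 / \<nu>"
    using \<Lambda> by (simp add: divide_inverse)
  also have "\<dots> = 19 * ?R"
  proof -
    have "1 / (5 * r) * 45 * r\<^sup>2 + 2 / (1 / (5 * r)) = 19 * r" if "0 < r" for r :: real
      using that by (simp add: power2_eq_square)
    from this[OF R] show ?thesis unfolding \<nu>_def .
  qed
  finally show ?thesis using R unfolding A_def t_def by linarith
qed

end

section \<open>Summation over the unitary dual\<close>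

text \<open>By Tonelli's theorem the series of absolute values has integral at most the L^1 norm of
  f times the sum of c A B, hence converges almost everywhere. So T has to be identified only at
  points of absolute convergence.\<close>

lemma r_nuclear_Lp_abs_series:
  fixes c A :: "nat \<Rightarrow> real"
  assumes M: "prob_space M" and r: "0 < r" "r \<le> 1" and p: "1 \<le> p"
    and c: "\<And>n. 0 \<le> c n"
    and e [measurable]: "\<And>n. e n \<in> borel_measurable M"
    and A: "\<And>n x. x \<in> space M \<Longrightarrow> cmod (e n x) \<le> A n"
    and summ: "summable (\<lambda>n. (c n * A n * (\<integral>x. cmod (e n x) \<partial>M)) powr r)"
    and T_meas: "\<And>f. f \<in> Lp_space p M \<Longrightarrow> T f \<in> borel_measurable M"
    and T_lim: "\<And>f x. f \<in> Lp_space p M \<Longrightarrow> x \<in> space M \<Longrightarrow>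
      summable (\<lambda>n. cmod (of_real (c n) * (\<integral>y. f y * cnj (e n y) \<partial>M) * e n x)) \<Longrightarrow>
      (\<lambda>n. of_real (c n) * (\<integral>y. f y * cnj (e n y) \<partial>M) * e n x) sums T f x"
  shows "r_nuclear_on_Lp r p M T"
proof (rule r_nuclear_Lp_series[OF M r p c e A summ T_meas])
  interpret prob_space M by fact
  fix f assume f: "f \<in> Lp_space p M"
  have A0: "0 \<le> A n" for n using A norm_ge_zero not_empty by (meson ex_in_conv order_trans)
  have intf: "integrable M f" by (rule Lp_space_integrable[OF M p f])
  then have [measurable]: "f \<in> borel_measurable M" by auto
  let ?B = "\<lambda>n. \<integral>x. cmod (e n x) \<partial>M" and ?F = "\<integral>x. cmod (f x) \<partial>M"
  define g where "g n x = of_real (c n) * (\<integral>y. f y * cnj (e n y) \<partial>M) * e n x" for n x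
  have B0: "0 \<le> ?B n" for n by (intro integral_nonneg_AE) auto
  have F0: "0 \<le> ?F" by (intro integral_nonneg_AE) auto
  have sumK: "summable (\<lambda>n. c n * A n * ?B n)"
    using summable_of_summable_powr[OF summ r] c A0 B0 by simp
  have int_e: "integrable M (\<lambda>x. cmod (e n x))" for n
    using A by (intro integrable_const_bound[where B = "A n"] AE_I2) auto
  have coef: "cmod (\<integral>y. f y * cnj (e n y) \<partial>M) \<le> A n * ?F" for n
  proof -
    have "cmod (\<integral>y. f y * cnj (e n y) \<partial>M) \<le> (\<integral>y. cmod (f y * cnj (e n y)) \<partial>M)"
      by (rule integral_norm_bound)
    also have "\<dots> \<le> (\<integral>y. A n * cmod (f y) \<partial>M)"
    proof (rule integral_mono')
      show "integrable M (\<lambda>y. A n * cmod (f y))" using intf by simp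
      show "cmod (f y * cnj (e n y)) \<le> A n * cmod (f y)" if "y \<in> space M" for y
        using mult_right_mono[OF A[OF that] norm_ge_zero] by (simp add: norm_mult mult.commute)
    qed (use A0 in auto)
    finally show ?thesis by simp
  qed
  have "(\<integral>\<^sup>+x. (\<Sum>n. ennreal (cmod (g n x))) \<partial>M) = (\<Sum>n. \<integral>\<^sup>+x. ennreal (cmod (g n x)) \<partial>M)"
    unfolding g_def by (intro nn_integral_suminf) measurable
  also have "\<dots> \<le> (\<Sum>n. ennreal (c n * A n * ?B n * ?F))"
  proof (intro suminf_le summableI)
    fix n
    have "(\<integral>\<^sup>+x. ennreal (cmod (g n x)) \<partial>M) = ennreal (c n * cmod (\<integral>y. f y * cnj (e n y) \<partial>M) * ?B n)"
      unfolding g_def using int_e[of n] c[of n]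
      by (subst nn_integral_eq_integral) (auto simp: norm_mult)
    also have "\<dots> \<le> ennreal (c n * (A n * ?F) * ?B n)"
      using coef c B0 by (intro ennreal_leI mult_right_mono mult_left_mono)
    finally show "(\<integral>\<^sup>+x. ennreal (cmod (g n x)) \<partial>M) \<le> ennreal (c n * A n * ?B n * ?F)"
      by (simp add: mult_ac)
  qed
  also have "\<dots> = ennreal (\<Sum>n. c n * A n * ?B n * ?F)"
    using c A0 B0 F0 sumK by (intro suminf_ennreal2 summable_mult2) auto
  finally have fin: "(\<integral>\<^sup>+x. (\<Sum>n. ennreal (cmod (g n x))) \<partial>M) \<noteq> \<infinity>"
    by (auto simp: top_unique)
  have "AE x in M. (\<Sum>n. ennreal (cmod (g n x))) \<noteq> \<infinity>"
    by (rule nn_integral_PInf_AE[OF _ fin]) (unfold g_def, measurable)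
  then show "AE x in M. (\<lambda>m. \<Sum>n<m. of_real (c n) * (\<integral>y. f y * cnj (e n y) \<partial>M) * e n x) \<longlonglongrightarrow> T f x"
    using AE_space
  proof eventually_elim
    case (elim x)
    then have "summable (\<lambda>n. cmod (g n x))" by (intro summable_suminf_not_top) auto
    then show ?case using T_lim[OF f elim(2)] by (simp add: g_def sums_def)
  qed
qed

text \<open>Concavity of s^r in the form of the tangent at \<kappa>: x^r \<kappa>^(1-r) \<le> r x +
  (1-r) \<kappa>.\<close>

lemma sum_powr_le_of_mean:
  fixes x :: "'i \<Rightarrow> real"
  assumes r: "0 < r" "r \<le> 1" and \<kappa>: "0 < \<kappa>" and fin: "finite F"
    and x: "\<And>i. i \<in> F \<Longrightarrow> 0 \<le> x i" and le: "(\<Sum>i\<in>F. x i) \<le> real (card F) * \<kappa>"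
  shows "(\<Sum>i\<in>F. x i powr r) \<le> real (card F) * \<kappa> powr r"
proof -
  have "x i powr r * \<kappa> powr (1 - r) \<le> r * x i + (1 - r) * \<kappa>" if "i \<in> F" for i
  proof (cases "x i = 0")
    case False
    then show ?thesis using x[OF that] r \<kappa> by (intro Youngs_inequality_0) auto
  qed (use r \<kappa> in auto)
  then have "(\<Sum>i\<in>F. x i powr r * \<kappa> powr (1 - r)) \<le> (\<Sum>i\<in>F. r * x i + (1 - r) * \<kappa>)"
    by (intro sum_mono) auto
  also have "\<dots> = r * (\<Sum>i\<in>F. x i) + real (card F) * ((1 - r) * \<kappa>)"
    by (simp add: sum.distrib sum_distrib_left)
  also have "\<dots> \<le> r * (real (card F) * \<kappa>) + real (card F) * ((1 - r) * \<kappa>)"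
    using le r by (intro add_right_mono mult_left_mono) auto
  also have "\<dots> = real (card F) * \<kappa>" by (simp add: algebra_simps)
  also have "\<dots> = (real (card F) * \<kappa> powr r) * \<kappa> powr (1 - r)"
    using \<kappa> by (simp add: mult.assoc flip: powr_add)
  finally show ?thesis using \<kappa> by (simp flip: sum_distrib_right)
qed

text \<open>The eigenvalue grows like k + 1 times the distance of the column from the nearer end |m|
  = l. With x and y the smaller and larger of j and k - j, four times the difference of the two
  sides is 3 + 3 x y - x^2 + y, and x^2 \<le> x y.\<close>

lemma spectral_ge:
  assumes "j \<le> k"
  shows "(real k + 1) * (real (min j (k - j)) + 1) / 4 \<le> spectral k j" "real k + 1 \<le> 2 * spectral k j"
proof -
  define a b where "a = min j (k - j)" and "b = max j (k - j)"
  have ab: "real j * real (k - j) = real a * real b" "real k = real a + real b" "real a \<le> real b"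
    using assms by (auto simp: a_def b_def min_def max_def of_nat_diff)
  have "(x + y + 1) * (x + 1) / 4 \<le> 1 + (x * y + (x + y) / 2)" if "0 \<le> x" "x \<le> y" for x y :: real
  proof -
    have "x * x \<le> x * y" "0 \<le> x * x" "0 \<le> y" using that by (auto intro: mult_left_mono)
    moreover have "0 \<le> 3 + 3 * t - s + y" if "s \<le> t" "0 \<le> s" "0 \<le> y" for s t :: real using that by linarith
    ultimately have "0 \<le> 3 + 3 * (x * y) - x * x + y" by blast
    then have nonneg: "0 \<le> (3 + 3 * (x * y) - x * x + y) / 4" by simp
    have "1 + (x * y + (x + y) / 2) - (x + y + 1) * (x + 1) / 4 = (3 + 3 * (x * y) - x * x + y) / 4"
      by (simp add: field_simps)
    then have "0 \<le> 1 + (x * y + (x + y) / 2) - (x + y + 1) * (x + 1) / 4" using nonneg by (simp only:)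
    then show ?thesis by (simp only: diff_ge_0_iff_ge)
  qed
  then show "(real k + 1) * (real (min j (k - j)) + 1) / 4 \<le> spectral k j"
    unfolding spectral_def a_def[symmetric] ab using ab by simp
  show "real k + 1 \<le> 2 * spectral k j"
    by (simp add: spectral_def)
qed

text \<open>After \<open>spectral_ge\<close>, the sum over j is (k + 1)^(-\<gamma>) times a
  convergent series in the distance from the nearer end; the factor 2 counts both ends. The
  threshold 3/2 allows one fixed majorant n^(-3/2), and both exponents used later, \<alpha>/2 and
  \<alpha> r/2 - 1/2, exceed it.\<close>

lemma sum_spectral_powr:
  assumes \<gamma>: "3 / 2 \<le> \<gamma>"
  obtains C where "0 < C" "\<And>k. (\<Sum>j\<le>k. spectral k j powr (- \<gamma>)) \<le> C * (real k + 1) powr (- \<gamma>)"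
proof
  define h :: "nat \<Rightarrow> real" where "h n = (real n + 1) powr (- 3 / 2)" for n
  have h0: "0 \<le> h n" for n by (simp add: h_def)
  have "summable (\<lambda>n. real (n + 1) powr (- 3 / 2))"
    by (subst summable_iff_shift) (simp add: summable_real_powr_iff)
  then have sum_h: "summable h" by (simp add: h_def[abs_def] add.commute)
  show "0 < 4 powr \<gamma> * (2 * suminf h + 1)"
    using suminf_nonneg[OF sum_h h0] by (intro mult_pos_pos) auto
  fix k
  have "(\<Sum>j\<le>k. spectral k j powr (- \<gamma>)) \<le> (\<Sum>j\<le>k. 4 powr \<gamma> * (real k + 1) powr (- \<gamma>) * (h j + h (k - j)))"
  proof (intro sum_mono)
    fix j assume j: "j \<in> {..k}"
    let ?a = "min j (k - j)"
    have "spectral k j powr (- \<gamma>) \<le> ((real k + 1) * (real ?a + 1) / 4) powr (- \<gamma>)"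
      using spectral_ge(1)[of j k] j \<gamma> by (intro powr_mono2') auto
    also have "\<dots> = 4 powr \<gamma> * (real k + 1) powr (- \<gamma>) * (real ?a + 1) powr (- \<gamma>)"
      by (simp add: powr_divide powr_mult powr_minus_divide)
    also have "\<dots> \<le> 4 powr \<gamma> * (real k + 1) powr (- \<gamma>) * h ?a"
      unfolding h_def using \<gamma> by (intro mult_left_mono powr_mono) auto
    also have "\<dots> \<le> 4 powr \<gamma> * (real k + 1) powr (- \<gamma>) * (h j + h (k - j))"
      using h0 by (intro mult_left_mono) (auto simp: min_def)
    finally show "spectral k j powr (- \<gamma>) \<le> 4 powr \<gamma> * (real k + 1) powr (- \<gamma>) * (h j + h (k - j))" .
  qed
  also have "\<dots> = 4 powr \<gamma> * (real k + 1) powr (- \<gamma>) * ((\<Sum>j\<le>k. h j) + (\<Sum>j\<le>k. h (k - j)))"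
    by (simp only: sum.distrib distrib_left sum_distrib_left)
  also have "(\<Sum>j\<le>k. h (k - j)) = (\<Sum>j\<le>k. h j)"
    by (rule sum.reindex_bij_witness[of _ "\<lambda>j. k - j" "\<lambda>j. k - j"]) auto
  also have "4 powr \<gamma> * (real k + 1) powr (- \<gamma>) * ((\<Sum>j\<le>k. h j) + (\<Sum>j\<le>k. h j)) \<le>
      4 powr \<gamma> * (real k + 1) powr (- \<gamma>) * (2 * suminf h + 1)"
    using sum_le_suminf[OF sum_h, of "{..k}"] h0 by (intro mult_left_mono) auto
  finally show "(\<Sum>j\<le>k. spectral k j powr (- \<gamma>)) \<le> (4 powr \<gamma> * (2 * suminf h + 1)) * (real k + 1) powr (- \<gamma>)"
    by (simp add: mult_ac)
qed

section \<open>Nuclearity for an arbitrary lift\<close>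

context SU2_lift
begin

text \<open>The quantity \<open>c * A * B\<close> of the nuclearity criterion for one matrix
  entry.\<close>

definition entry_cost :: "real \<Rightarrow> nat \<Rightarrow> nat \<Rightarrow> nat \<Rightarrow> real" where
  "entry_cost \<alpha> k i j = (real k + 1) * spectral k j powr (- \<alpha> / 2) * sup_bound k i j *
     (\<integral>x. cmod (rep_SU2 k (lift x) i j) \<partial>M)"

lemma entry_cost_nonneg: "j \<le> k \<Longrightarrow> 0 \<le> entry_cost \<alpha> k i j"
  unfolding entry_cost_def by (intro mult_nonneg_nonneg integral_nonneg_AE sup_bound_nonneg) auto

text \<open>By \<open>sum_sup_L1\<close> the mean cost over the k + 1 rows is at most \<kappa>, the
  dimension factor k + 1 cancelling the number of rows. Concavity then passes to r-th
  powers.\<close>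

lemma column_cost:
  assumes k: "k \<in> K" and j: "j \<le> k" and r: "0 < r" "r \<le> 1"
  shows "(\<Sum>i\<le>k. entry_cost \<alpha> k i j powr r) \<le>
    20 * (real k + 1) powr (1 / 2) * spectral k j powr (- (\<alpha> * r / 2 - 1 / 2))"
proof -
  let ?\<Lambda> = "spectral k j"
  define q where "q = ?\<Lambda> / (real k + 1)"
  have \<Lambda>: "1 \<le> ?\<Lambda>" by (rule spectral_ge_1)
  have q: "1 \<le> 2 * q" "0 < q" using spectral_ge(2)[OF j] \<Lambda> by (auto simp: q_def)
  define \<kappa> where "\<kappa> = ?\<Lambda> powr (- \<alpha> / 2) * (10 * sqrt q)"
  have "(\<Sum>i\<le>k. entry_cost \<alpha> k i j) =
      (real k + 1) * (?\<Lambda> powr (- \<alpha> / 2) * (\<Sum>i\<le>k. sup_bound k i j * (\<integral>x. cmod (rep_SU2 k (lift x) i j) \<partial>M)))"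
    unfolding sum_distrib_left entry_cost_def by (simp add: mult_ac)
  also have "\<dots> \<le> (real k + 1) * \<kappa>"
    unfolding \<kappa>_def q_def using sum_sup_L1[OF k j] by (intro mult_left_mono) auto
  finally have "(\<Sum>i\<le>k. entry_cost \<alpha> k i j powr r) \<le> real (card {..k}) * \<kappa> powr r"
    using r \<Lambda> q entry_cost_nonneg[OF j] by (intro sum_powr_le_of_mean) (auto simp: \<kappa>_def add.commute)
  also have "\<dots> = (real k + 1) * (?\<Lambda> powr (- (\<alpha> * r / 2)) * (10 powr r * q powr (r / 2)))"
    using q by (simp add: \<kappa>_def powr_mult powr_powr powr_half_sqrt[symmetric] add.commute)
  \<comment> \<open>As 2 q \<ge> 1, the exponent r/2 may be raised to 1/2 at the cost of a constant.
    This is harmless for the final exponent, because the columns that dominate the sum over j have q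
    of order 1.\<close>
  also have "\<dots> \<le> (real k + 1) * (?\<Lambda> powr (- (\<alpha> * r / 2)) * (10 * (2 * q powr (1 / 2))))"
  proof (intro mult_left_mono mult_mono)
    show "10 powr r \<le> (10 :: real)" using powr_mono[of r 1 "10 :: real"] r by simp
    have "q powr (r / 2) = (2 * q) powr (r / 2) * (1 / 2) powr (r / 2)" using q by (simp flip: powr_mult)
    also have "\<dots> \<le> (2 * q) powr (1 / 2) * 1"
      using q r by (intro mult_mono powr_mono powr_le1) auto
    also have "\<dots> = 2 powr (1 / 2) * q powr (1 / 2)" using q by (simp add: powr_mult)
    also have "\<dots> \<le> 2 * q powr (1 / 2)"
      using powr_mono[of "1/2" 1 "2 :: real"] by (intro mult_right_mono) auto
    finally show "q powr (r / 2) \<le> 2 * q powr (1 / 2)" .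
  qed auto
  also have "\<dots> = 20 * ((real k + 1) powr (1 / 2) * (?\<Lambda> powr (- (\<alpha> * r / 2)) * ?\<Lambda> powr (1 / 2)))"
  proof -
    define s where "s = (real k + 1) powr (1 / 2)"
    have s: "real k + 1 = s * s" "0 < s" by (simp_all add: s_def flip: powr_add)
    have q': "q powr (1 / 2) = ?\<Lambda> powr (1 / 2) / s"
      unfolding q_def s_def by (rule powr_divide)
    show ?thesis unfolding q' s_def[symmetric] unfolding s(1) using s(2) by (simp add: field_simps)
  qed
  also have "\<dots> = 20 * (real k + 1) powr (1 / 2) * ?\<Lambda> powr (- (\<alpha> * r / 2 - 1 / 2))"
    by (simp flip: powr_add)
  finally show ?thesis .
qed

text \<open>One column contributes an integral operator whose kernel, a scalar product of two unit
  columns, is bounded by 1. This controls the levels at every point, for f in L^1.\<close>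

lemma cmod_column_integral_le:
  assumes k: "k \<in> K" and j: "j \<le> k" and f: "integrable M f" and x: "x \<in> space M"
  shows "cmod (\<Sum>i\<le>k. rep_SU2 k (lift x) i j * (\<integral>y. f y * cnj (rep_SU2 k (lift y) i j) \<partial>M)) \<le> (\<integral>y. cmod (f y) \<partial>M)"
proof -
  let ?t = "\<lambda>i y. rep_SU2 k (lift y) i j"
  have [measurable]: "?t i \<in> borel_measurable M" for i using rep_lift_measurable[OF k j] .
  have [measurable]: "f \<in> borel_measurable M" using f by auto
  have int: "integrable M (\<lambda>y. f y * cnj (?t i y))" if "i \<le> k" for i
  proof (rule Bochner_Integration.integrable_bound[OF f])
    show "AE y in M. norm (f y * cnj (?t i y)) \<le> norm (f y)"
      using rep_SU2_le_1[OF lift_SU2 j that] by (intro AE_I2) (simp add: norm_mult mult_left_le)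
  qed measurable
  have kernel: "cmod (\<Sum>i\<le>k. ?t i x * cnj (?t i y)) \<le> 1" if y: "y \<in> space M" for y
  proof -
    have "cmod (\<Sum>i\<le>k. ?t i x * cnj (?t i y)) \<le> (\<Sum>i\<le>k. \<bar>cmod (?t i x)\<bar> * \<bar>cmod (?t i y)\<bar>)"
      by (rule order_trans[OF norm_sum]) (simp add: norm_mult)
    also have "\<dots> \<le> L2_set (\<lambda>i. cmod (?t i x)) {..k} * L2_set (\<lambda>i. cmod (?t i y)) {..k}"
      by (rule L2_set_mult_ineq)
    also have "\<dots> = 1"
      using rep_SU2_column_norm[OF lift_SU2[OF x] j] rep_SU2_column_norm[OF lift_SU2[OF y] j]
      by (simp add: L2_set_def)
    finally show ?thesis .
  qed
  have "(\<Sum>i\<le>k. ?t i x * (\<integral>y. f y * cnj (?t i y) \<partial>M)) = (\<Sum>i\<le>k. \<integral>y. ?t i x * (f y * cnj (?t i y)) \<partial>M)"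
    by (simp only: integral_mult_right_zero)
  also have "\<dots> = (\<integral>y. (\<Sum>i\<le>k. ?t i x * (f y * cnj (?t i y))) \<partial>M)"
    using int by (intro Bochner_Integration.integral_sum[symmetric] integrable_mult_right) auto
  also have "\<dots> = (\<integral>y. f y * (\<Sum>i\<le>k. ?t i x * cnj (?t i y)) \<partial>M)"
    by (simp add: sum_distrib_left mult_ac)
  finally have eq: "(\<Sum>i\<le>k. ?t i x * (\<integral>y. f y * cnj (?t i y) \<partial>M)) =
      (\<integral>y. f y * (\<Sum>i\<le>k. ?t i x * cnj (?t i y)) \<partial>M)" .
  have "cmod (\<integral>y. f y * (\<Sum>i\<le>k. ?t i x * cnj (?t i y)) \<partial>M) \<le>
      (\<integral>y. cmod (f y * (\<Sum>i\<le>k. ?t i x * cnj (?t i y))) \<partial>M)"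
    by (rule integral_norm_bound)
  also have "\<dots> \<le> (\<integral>y. cmod (f y) \<partial>M)"
  proof (rule integral_mono')
    show "cmod (f y * (\<Sum>i\<le>k. ?t i x * cnj (?t i y))) \<le> cmod (f y)" if "y \<in> space M" for y
      using kernel[OF that] by (simp add: norm_mult mult_left_le)
  qed (use f in auto)
  finally show ?thesis unfolding eq .
qed

theorem r_nuclear_lift:
  assumes r: "0 < r" "r \<le> 1" and \<alpha>: "4 / r < \<alpha>" and p: "1 \<le> p"
    and T: "\<And>f x. f \<in> Lp_space p M \<Longrightarrow> x \<in> space M \<Longrightarrow>
      T f x = (\<Sum>\<^sub>\<infinity>k\<in>K. of_nat (k + 1) * (\<Sum>i\<le>k. \<Sum>j\<le>k. rep_SU2 k (lift x) i j *
        of_real (spectral k j powr (- \<alpha> / 2)) * (\<integral>y. f y * cnj (rep_SU2 k (lift y) i j) \<partial>M)))"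
  shows "r_nuclear_on_Lp r p M T"
proof -
  define t where "t k i j x = rep_SU2 k (lift x) i j" for k i j x
  define coef where "coef k j = (real k + 1) * spectral k j powr (- \<alpha> / 2)" for k j
  define idx :: "nat \<Rightarrow> nat \<times> nat \<times> nat" where "idx n = map_prod id prod_decode (prod_decode n)" for n
  define I where "I = Sigma K (\<lambda>k. {..k} \<times> {..k})"
  \<comment> \<open>All triples of naturals are enumerated; those outside I carry the zero
    function.\<close>
  define e where "e = (\<lambda>(k, i, j) x. if (k, i, j) \<in> I then t k i j x else 0)"
  define c where "c = (\<lambda>(k, i :: nat, j). coef k j)"
  define A where "A = (\<lambda>(k, i, j). if (k, i, j) \<in> I then sup_bound k i j else 0)"
  have bij: "bij_betw idx UNIV UNIV"
    by (rule bij_betw_byWitness[where f' = "\<lambda>z. prod_encode (map_prod id prod_encode z)"])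
       (auto simp: idx_def prod.map_comp o_def id_def prod.map_ident)
  have [measurable]: "e z \<in> borel_measurable M" for z
    using rep_lift_measurable by (cases z; cases "z \<in> I") (auto simp: e_def I_def t_def)
  have 4: "4 < \<alpha> * r" using \<alpha> r by (simp add: divide_less_eq)
  have "\<alpha> * r \<le> \<alpha>" using \<alpha> r by (smt (verit) divide_pos_pos mult_left_le)
  then have \<alpha>4: "4 < \<alpha>" using 4 by linarith
  have summable_shift: "summable (\<lambda>k. (real k + 1) powr s)" if "s < -1" for s
  proof -
    have "summable (\<lambda>n. real (n + 1) powr s)"
      using that by (subst summable_iff_shift) (simp add: summable_real_powr_iff)
    then show ?thesis by (simp add: add.commute)
  qed
  have integrable_f: "integrable M f" if "f \<in> Lp_space p M" for f
    by (rule Lp_space_integrable[OF prob_space_axioms p that])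
  define block where "block f k x = of_nat (k + 1) * (\<Sum>i\<le>k. \<Sum>j\<le>k. t k i j x *
        of_real (spectral k j powr (- \<alpha> / 2)) * (\<integral>y. f y * cnj (t k i j y) \<partial>M))" for f k x
  have T_block: "T f x = (\<Sum>\<^sub>\<infinity>k\<in>K. block f k x)" if "f \<in> Lp_space p M" "x \<in> space M" for f x
    using T[OF that] by (simp add: block_def t_def)

  \<comment> \<open>The level k is bounded by a multiple of (k + 1)^(1 - \<alpha>/2). This is
    summable because \<alpha> > 4, so T f is an everywhere pointwise limit of measurable
    functions.\<close>
  have T_meas: "T f \<in> borel_measurable M" if f: "f \<in> Lp_space p M" for f
  proof -
    obtain C where C0: "0 < C" and C: "\<And>k. (\<Sum>j\<le>k. spectral k j powr (- (\<alpha> / 2))) \<le> C * (real k + 1) powr (- (\<alpha> / 2))"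
      using sum_spectral_powr[of "\<alpha> / 2"] \<alpha>4 by auto
    let ?F = "\<integral>y. cmod (f y) \<partial>M"
    have F0: "0 \<le> ?F" by (intro integral_nonneg_AE) auto
    have bound: "cmod (block f k x) \<le> ?F * C * (real k + 1) powr (1 - \<alpha> / 2)" if k: "k \<in> K" and x: "x \<in> space M" for k x
    proof -
      have "block f k x = of_nat (k + 1) * (\<Sum>j\<le>k. of_real (spectral k j powr (- \<alpha> / 2)) *
          (\<Sum>i\<le>k. t k i j x * (\<integral>y. f y * cnj (t k i j y) \<partial>M)))"
        unfolding block_def by (subst sum.swap) (simp add: sum_distrib_left mult_ac)
      also have "cmod \<dots> \<le> (real k + 1) * (\<Sum>j\<le>k. spectral k j powr (- \<alpha> / 2) * ?F)"
        unfolding norm_mult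
      proof (intro mult_mono order_trans[OF norm_sum] sum_mono)
        show "cmod (of_nat (k + 1)) \<le> real k + 1" by (simp only: norm_of_nat)
        fix j assume "j \<in> {..k}"
        then show "cmod (of_real (spectral k j powr (- \<alpha> / 2)) * (\<Sum>i\<le>k. t k i j x * (\<integral>y. f y * cnj (t k i j y) \<partial>M)))
            \<le> spectral k j powr (- \<alpha> / 2) * ?F"
          using cmod_column_integral_le[OF k _ integrable_f[OF f] x, of j]
          by (simp add: norm_mult t_def mult_left_mono)
      qed (auto intro: sum_nonneg)
      also have "\<dots> = (real k + 1) * ?F * (\<Sum>j\<le>k. spectral k j powr (- (\<alpha> / 2)))"
        by (simp add: sum_distrib_right mult_ac flip: sum_distrib_left)
      also have "\<dots> \<le> (real k + 1) * ?F * (C * (real k + 1) powr (- (\<alpha> / 2)))"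
        using C F0 by (intro mult_left_mono) auto
      also have "\<dots> = ?F * C * ((real k + 1) powr 1 * (real k + 1) powr (- (\<alpha> / 2)))"
        by simp
      also have "\<dots> = ?F * C * (real k + 1) powr (1 - \<alpha> / 2)"
        by (simp only: powr_add[symmetric]) simp
      finally show ?thesis .
    qed
    let ?b = "\<lambda>k x. if k \<in> K then block f k x else 0"
    have sums: "(\<lambda>k. ?b k x) sums T f x" if x: "x \<in> space M" for x
    proof -
      have "summable (\<lambda>k. ?F * C * (real k + 1) powr (1 - \<alpha> / 2))"
        using \<alpha>4 by (intro summable_mult summable_shift) auto
      then have "summable (\<lambda>k. norm (?b k x))"
        by (rule summable_comparison_test'[where N=0]) (use bound[OF _ x] F0 C0 in auto)
      then have "((\<lambda>k. ?b k x) has_sum infsum (\<lambda>k. ?b k x) UNIV) UNIV"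
        by (intro has_sum_infsum norm_summable_imp_summable_on)
      moreover have "infsum (\<lambda>k. ?b k x) UNIV = T f x"
        unfolding T_block[OF f x] by (rule infsum_cong_neutral) auto
      ultimately show ?thesis by (simp add: has_sum_imp_sums)
    qed
    show ?thesis
    proof (rule borel_measurable_LIMSEQ_metric)
      show "(\<lambda>x. \<Sum>k<n. ?b k x) \<in> borel_measurable M" for n
      proof (intro borel_measurable_sum)
        fix k
        have "(\<lambda>x. block f k x) \<in> borel_measurable M" if "k \<in> K"
          unfolding block_def t_def
          by (intro borel_measurable_times borel_measurable_const borel_measurable_sum rep_lift_measurable that) auto
        then show "?b k \<in> borel_measurable M" by (cases "k \<in> K") simp_all
      qed
      show "(\<lambda>n. \<Sum>k<n. ?b k x) \<longlonglongrightarrow> T f x" if "x \<in> space M" for x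
        using sums[OF that] by (simp add: sums_def)
    qed
  qed

  have cost: "(c z * A z * (\<integral>x. cmod (e z x) \<partial>M)) powr r =
      (if z \<in> I then (\<lambda>(k, i, j). entry_cost \<alpha> k i j powr r) z else 0)" for z
    by (cases z) (auto simp: c_def A_def e_def coef_def entry_cost_def t_def)
  have sum_cost: "(\<lambda>(k, i, j). entry_cost \<alpha> k i j powr r) summable_on I"
    unfolding I_def
  proof (rule summable_on_SigmaI)
    \<comment> \<open>The total over the level k is of order (k + 1)^(1/2) (k + 1)^(-(\<beta> -
      1/2)) = (k + 1)^(1 - \<beta>), and \<beta> > 2 is the hypothesis on \<alpha>.\<close>
    define \<beta> where "\<beta> = \<alpha> * r / 2"
    have \<beta>: "2 < \<beta>" using 4 by (simp add: \<beta>_def)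
    obtain C where C: "\<And>k. (\<Sum>j\<le>k. spectral k j powr (- (\<beta> - 1 / 2))) \<le> C * (real k + 1) powr (- (\<beta> - 1 / 2))"
      using sum_spectral_powr[of "\<beta> - 1 / 2"] \<beta> by auto
    define G where "G k = (\<Sum>z\<in>{..k} \<times> {..k}. (\<lambda>(i, j). entry_cost \<alpha> k i j powr r) z)" for k
    show "((\<lambda>y. (\<lambda>(k, i, j). entry_cost \<alpha> k i j powr r) (k, y)) has_sum G k) ({..k} \<times> {..k})" for k
      unfolding G_def by (intro has_sum_finiteI) (auto simp: split_def)
    have "(\<lambda>k. 20 * C * (real k + 1) powr (1 - \<beta>)) summable_on K"
    proof (rule summable_on_subset_banach)
      have "summable (\<lambda>k. \<bar>20 * C\<bar> * (real k + 1) powr (1 - \<beta>))"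
        using \<beta> by (intro summable_mult summable_shift) auto
      then show "(\<lambda>k. 20 * C * (real k + 1) powr (1 - \<beta>)) summable_on UNIV"
        by (intro norm_summable_imp_summable_on) (simp add: abs_mult)
    qed simp
    then show "G summable_on K"
    proof (rule summable_on_comparison_test)
      fix k assume k: "k \<in> K"
      have "G k = (\<Sum>j\<le>k. \<Sum>i\<le>k. entry_cost \<alpha> k i j powr r)"
        unfolding G_def sum.cartesian_product[symmetric] by (rule sum.swap)
      also have "\<dots> \<le> (\<Sum>j\<le>k. 20 * (real k + 1) powr (1 / 2) * spectral k j powr (- (\<beta> - 1 / 2)))"
        unfolding \<beta>_def by (intro sum_mono column_cost k r) auto
      also have "\<dots> = 20 * (real k + 1) powr (1 / 2) * (\<Sum>j\<le>k. spectral k j powr (- (\<beta> - 1 / 2)))"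
        by (simp only: sum_distrib_left)
      also have "\<dots> \<le> 20 * (real k + 1) powr (1 / 2) * (C * (real k + 1) powr (- (\<beta> - 1 / 2)))"
        using C by (intro mult_left_mono) auto
      also have "\<dots> = 20 * C * ((real k + 1) powr (1 / 2) * (real k + 1) powr (- (\<beta> - 1 / 2)))"
        by (simp only: mult_ac)
      also have "\<dots> = 20 * C * (real k + 1) powr (1 - \<beta>)"
        by (simp only: powr_add[symmetric]) simp
      finally show "G k \<le> 20 * C * (real k + 1) powr (1 - \<beta>)" .
      show "0 \<le> G k" unfolding G_def by (intro sum_nonneg) auto
    qed
  qed auto
  then have "(\<lambda>z. (c z * A z * (\<integral>x. cmod (e z x) \<partial>M)) powr r) summable_on UNIV"
    unfolding cost by (subst summable_on_cong_neutral[of I UNIV]) auto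
  then have summ: "summable (\<lambda>n. (c (idx n) * A (idx n) * (\<integral>x. cmod (e (idx n) x) \<partial>M)) powr r)"
    using summable_on_reindex_bij_betw[OF bij, of "\<lambda>z. (c z * A z * (\<integral>x. cmod (e z x) \<partial>M)) powr r"]
    by (intro summable_on_imp_summable) simp

  show ?thesis
  proof (rule r_nuclear_Lp_abs_series[OF prob_space_axioms r p _ _ _ summ T_meas])
    show "0 \<le> c (idx n)" for n by (cases "idx n") (simp add: c_def coef_def)
    show "cmod (e (idx n) x) \<le> A (idx n)" if "x \<in> space M" for n x
      using rep_lift_bound[OF _ _ that] by (cases "idx n") (auto simp: e_def A_def I_def t_def)
    fix f x assume f: "f \<in> Lp_space p M" and x: "x \<in> space M"
    define g where "g z = of_real (c z) * (\<integral>y. f y * cnj (e z y) \<partial>M) * e z x" for z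
    assume "summable (\<lambda>n. cmod (of_real (c (idx n)) * (\<integral>y. f y * cnj (e (idx n) y) \<partial>M) * e (idx n) x))"
    then have "(\<lambda>n. g (idx n)) summable_on UNIV"
      unfolding g_def by (rule norm_summable_imp_summable_on)
    then have "g summable_on UNIV" using summable_on_reindex_bij_betw[OF bij, of g] by simp
    then have g_UNIV: "(g has_sum infsum g UNIV) UNIV" by (rule has_sum_infsum)
    \<comment> \<open>Absolute convergence at x permits regrouping the enumerated entries into
      levels, the order in which the operator sums them.\<close>
    have "infsum g UNIV = infsum g I"
      by (rule infsum_cong_neutral) (auto simp: g_def e_def split: prod.splits)
    also have "\<dots> = (\<Sum>\<^sub>\<infinity>k\<in>K. \<Sum>\<^sub>\<infinity>y\<in>{..k} \<times> {..k}. g (k, y))"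
      unfolding I_def using \<open>g summable_on UNIV\<close>
      by (intro infsum_Sigma_banach[symmetric]) (auto intro: summable_on_subset_banach)
    also have "\<dots> = (\<Sum>\<^sub>\<infinity>k\<in>K. block f k x)"
    proof (rule infsum_cong)
      fix k assume k: "k \<in> K"
      have "(\<Sum>\<^sub>\<infinity>y\<in>{..k} \<times> {..k}. g (k, y)) = (\<Sum>i\<le>k. \<Sum>j\<le>k. g (k, i, j))"
        by (simp add: sum.cartesian_product)
      also have "\<dots> = block f k x"
        unfolding block_def sum_distrib_left using k
        by (intro sum.cong refl) (auto simp: g_def c_def e_def I_def coef_def)
      finally show "(\<Sum>\<^sub>\<infinity>y\<in>{..k} \<times> {..k}. g (k, y)) = block f k x" .
    qed
    also have "\<dots> = T f x" by (rule T_block[OF f x, symmetric])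
    finally have "(g has_sum T f x) UNIV" using g_UNIV by simp
    then have "((\<lambda>n. g (idx n)) has_sum T f x) UNIV" using has_sum_reindex_bij_betw[OF bij, of g] by simp
    then show "(\<lambda>n. of_real (c (idx n)) * (\<integral>y. f y * cnj (e (idx n) y) \<partial>M) * e (idx n) x) sums T f x"
      unfolding g_def by (rule has_sum_imp_sums)
  qed measurable
qed

end

section \<open>The double cover and Haar measure\<close>

lemma S3_iff: "x \<in> S3 \<longleftrightarrow> (x$1)\<^sup>2 + (x$2)\<^sup>2 + (x$3)\<^sup>2 + (x$4)\<^sup>2 = 1"
  by (simp add: S3_def norm_eq_sqrt_inner inner_vec_def sum_4 power2_eq_square)

lemma vector_4_nth: "(vector [a, b, c, d] :: 'a::zero^4) $ 1 = a" "(vector [a, b, c, d] :: 'a^4) $ 2 = b"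
  "(vector [a, b, c, d] :: 'a^4) $ 3 = c" "(vector [a, b, c, d] :: 'a^4) $ 4 = d"
  by (simp_all add: vector_def)

lemma quat_to_SU2_nth:
  "quat_to_SU2 x $1$1 = Complex (x$1) (x$4)" "quat_to_SU2 x $1$2 = Complex (x$2) (x$3)"
  "quat_to_SU2 x $2$1 = Complex (- (x$2)) (x$3)" "quat_to_SU2 x $2$2 = Complex (x$1) (- (x$4))"
  by (simp_all add: quat_to_SU2_def)

lemma quat_to_SU2_in_SU2_iff: "quat_to_SU2 x \<in> SU2 \<longleftrightarrow> x \<in> S3"
  by (auto simp: SU2_iff quat_to_SU2_nth S3_iff cmod_power2 complex_eq_iff algebra_simps)

definition SU2_to_quat :: "complex^2^2 \<Rightarrow> real^4" where
  "SU2_to_quat u = vector [Re (u$1$1), Re (u$1$2), Im (u$1$2), Im (u$1$1)]"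

lemma SU2_to_quat_inverse: "u \<in> SU2 \<Longrightarrow> quat_to_SU2 (SU2_to_quat u) = u"
  by (simp add: vec_eq_iff forall_2 quat_to_SU2_nth SU2_to_quat_def vector_4_nth SU2_iff complex_eq_iff)

lemma quat_to_SU2_inverse: "SU2_to_quat (quat_to_SU2 x) = x"
  by (simp add: vec_eq_iff forall_4 quat_to_SU2_nth SU2_to_quat_def vector_4_nth)

lemma SU2_to_quat_in_S3: "u \<in> SU2 \<Longrightarrow> SU2_to_quat u \<in> S3"
  by (simp add: SU2_to_quat_inverse flip: quat_to_SU2_in_SU2_iff)

lemma quat_to_SU2_mult: "quat_to_SU2 (quat_mult x y) = quat_to_SU2 x ** quat_to_SU2 y"
  by (simp add: vec_eq_iff forall_2 quat_to_SU2_nth quat_mult_def vector_4_nth matrix_matrix_mult_def sum_2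
      complex_eq_iff algebra_simps)

lemma SU2_mult: "u \<in> SU2 \<Longrightarrow> w \<in> SU2 \<Longrightarrow> u ** w \<in> SU2"
proof -
  have adj: "adjoint_mat (A ** B) = adjoint_mat B ** adjoint_mat A" for A B :: "complex^2^2"
    by (simp add: adjoint_mat_def matrix_matrix_mult_def vec_eq_iff mult.commute)
  assume "u \<in> SU2" "w \<in> SU2"
  then have 1: "u ** adjoint_mat u = mat 1" "w ** adjoint_mat w = mat 1" "det u = 1" "det w = 1"
    by (auto simp: SU2_def)
  have "(u ** w) ** (adjoint_mat w ** adjoint_mat u) = u ** (w ** adjoint_mat w) ** adjoint_mat u"
    by (simp add: matrix_mul_assoc)
  then show "u ** w \<in> SU2" using 1 by (simp add: SU2_def adj det_mul)
qed

lemma quat_mult_S3: "x \<in> S3 \<Longrightarrow> y \<in> S3 \<Longrightarrow> quat_mult x y \<in> S3"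
  by (simp add: quat_to_SU2_mult SU2_mult flip: quat_to_SU2_in_SU2_iff)

text \<open>With the entries written as quadratic forms in the quaternion, multiplicativity,
  orthogonality and the determinant become polynomial identities.\<close>

lemma SU2_to_SO3_quat:
  "SU2_to_SO3 (quat_to_SU2 x) = vector
    [vector [(x$1)\<^sup>2 - (x$2)\<^sup>2 + (x$3)\<^sup>2 - (x$4)\<^sup>2, 2 * x$1 * x$4 + 2 * x$2 * x$3, 2 * x$3 * x$4 - 2 * x$1 * x$2],
     vector [2 * x$2 * x$3 - 2 * x$1 * x$4, (x$1)\<^sup>2 + (x$2)\<^sup>2 - (x$3)\<^sup>2 - (x$4)\<^sup>2, 2 * x$1 * x$3 + 2 * x$2 * x$4],
     vector [2 * x$1 * x$2 + 2 * x$3 * x$4, 2 * x$2 * x$4 - 2 * x$1 * x$3, (x$1)\<^sup>2 - (x$2)\<^sup>2 - (x$3)\<^sup>2 + (x$4)\<^sup>2]]"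
  by (simp add: SU2_to_SO3_def vec_eq_iff forall_3 pauli_def trace_def sum_2 matrix_matrix_mult_def
      adjoint_mat_def quat_to_SU2_nth power2_eq_square algebra_simps)

lemma SU2_to_SO3_quat_mult:
  "SU2_to_SO3 (quat_to_SU2 (quat_mult x y)) = SU2_to_SO3 (quat_to_SU2 x) ** SU2_to_SO3 (quat_to_SU2 y)"
  unfolding SU2_to_SO3_quat
  by (simp add: vec_eq_iff forall_3 matrix_matrix_mult_def sum_3 quat_mult_def vector_4_nth)
     (intro conjI; algebra)

lemma SU2_to_SO3_mult:
  assumes "u \<in> SU2" "w \<in> SU2"
  shows "SU2_to_SO3 (u ** w) = SU2_to_SO3 u ** SU2_to_SO3 w"
  using SU2_to_SO3_quat_mult[of "SU2_to_quat u" "SU2_to_quat w"] assms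
  by (simp add: quat_to_SU2_mult SU2_to_quat_inverse)

text \<open>For an arbitrary quaternion of squared norm N, the matrix R satisfies R^T R = N^2 and
  det R = N^3.\<close>

lemma SU2_to_SO3_in_SO3:
  assumes "u \<in> SU2"
  shows "SU2_to_SO3 u \<in> SO3"
proof -
  define x where "x = SU2_to_quat u"
  have x: "(x$1)\<^sup>2 + (x$2)\<^sup>2 + (x$3)\<^sup>2 + (x$4)\<^sup>2 = 1"
    using SU2_to_quat_in_S3[OF assms] by (simp add: S3_iff x_def)
  have u: "u = quat_to_SU2 x" using assms by (simp add: x_def SU2_to_quat_inverse)
  let ?N = "(x$1)\<^sup>2 + (x$2)\<^sup>2 + (x$3)\<^sup>2 + (x$4)\<^sup>2"
  have "transpose (SU2_to_SO3 u) ** SU2_to_SO3 u = mat (?N\<^sup>2)"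
    unfolding u SU2_to_SO3_quat vec_eq_iff forall_3
    by (simp only: matrix_matrix_mult_def sum_3 transpose_def mat_def vec_lambda_beta vector_3)
       (simp, intro conjI; algebra)
  moreover have "det (SU2_to_SO3 u) = ?N ^ 3"
    unfolding u SU2_to_SO3_quat det_3 by (simp only: vector_3) algebra
  moreover note x
  ultimately show ?thesis by (simp add: SO3_def orthogonal_matrix)
qed

lemma SU2_to_SO3_33:
  assumes "u \<in> SU2"
  shows "SU2_to_SO3 u $3$3 = 1 - 2 * (cmod (u$1$2))\<^sup>2"
proof -
  define x where "x = SU2_to_quat u"
  have x: "(x$1)\<^sup>2 + (x$2)\<^sup>2 + (x$3)\<^sup>2 + (x$4)\<^sup>2 = 1"
    using SU2_to_quat_in_S3[OF assms] by (simp add: S3_iff x_def)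
  have u: "u = quat_to_SU2 x" using assms by (simp add: x_def SU2_to_quat_inverse)
  show ?thesis unfolding u SU2_to_SO3_quat quat_to_SU2_nth cmod_power2 using x by simp
qed

text \<open>Together with the norm, the entries determine all products x_i x_j, and these determine
  x up to sign.\<close>

lemma SU2_to_SO3_fibre:
  assumes "u \<in> SU2" "w \<in> SU2" and eq: "SU2_to_SO3 u = SU2_to_SO3 w"
  shows "u = w \<or> u = - w"
proof -
  define x y where "x = SU2_to_quat u" and "y = SU2_to_quat w"
  have u: "u = quat_to_SU2 x" "w = quat_to_SU2 y" using assms by (simp_all add: x_def y_def SU2_to_quat_inverse)
  have n: "(x$1)\<^sup>2 + (x$2)\<^sup>2 + (x$3)\<^sup>2 + (x$4)\<^sup>2 = 1" "(y$1)\<^sup>2 + (y$2)\<^sup>2 + (y$3)\<^sup>2 + (y$4)\<^sup>2 = 1"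
    using SU2_to_quat_in_S3 assms by (simp_all add: x_def y_def flip: S3_iff)
  have "\<forall>i j. SU2_to_SO3 (quat_to_SU2 x) $i$j = SU2_to_SO3 (quat_to_SU2 y) $i$j"
    using eq u by simp
  then have prods: "\<forall>i j. x$i * x$j = y$i * y$j"
    unfolding SU2_to_SO3_quat forall_3 forall_4 using n by (auto simp: power2_eq_square mult_ac)
  obtain i where i: "x$i \<noteq> 0"
  proof (rule ccontr)
    assume "\<not> thesis"
    then have "\<forall>i. x$i = 0" using that by blast
    then show False using n by simp
  qed
  have "x$i * x$i = y$i * y$i" using prods by blast
  then have "x$i = y$i \<or> x$i = - y$i" by (simp add: square_eq_iff)
  then have "(\<forall>j. x$j = y$j) \<or> (\<forall>j. x$j = - y$j)"
  proof
    assume eq: "x$i = y$i"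
    have "x$i * x$j = x$i * y$j" for j using prods[rule_format, of i j] eq by simp
    then have "x$j = y$j" for j using i mult_left_cancel by blast
    then show ?thesis by blast
  next
    assume eq: "x$i = - y$i"
    have "x$i * x$j = x$i * - y$j" for j using prods[rule_format, of i j] eq by simp
    then have "x$j = - y$j" for j using i mult_left_cancel by blast
    then show ?thesis by blast
  qed
  then have "x = y \<or> x = - y" by (simp add: vec_eq_iff)
  moreover have "quat_to_SU2 (- y) = - quat_to_SU2 y"
    by (simp add: vec_eq_iff forall_2 quat_to_SU2_nth complex_eq_iff)
  ultimately show ?thesis using u by auto
qed

lemma SO3_mult: "A \<in> SO3 \<Longrightarrow> B \<in> SO3 \<Longrightarrow> A ** B \<in> SO3"
  by (simp add: SO3_def orthogonal_matrix_mul det_mul)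

lemma SO3_transpose: "A \<in> SO3 \<Longrightarrow> transpose A \<in> SO3 \<and> A ** transpose A = mat 1 \<and> transpose A ** A = mat 1"
  by (auto simp: SO3_def orthogonal_matrix_def orthogonal_matrix_transpose)

lemma SO3_column_norm:
  assumes "A \<in> SO3"
  shows "(A$1$j)\<^sup>2 + (A$2$j)\<^sup>2 + (A$3$j)\<^sup>2 = 1"
proof -
  have "(transpose A ** A) $j$j = 1" using SO3_transpose[OF assms] by (simp add: mat_def)
  then show ?thesis by (simp add: matrix_matrix_mult_def transpose_def sum_3 power2_eq_square)
qed

lemma SO3_row_norm:
  assumes "A \<in> SO3"
  shows "(A$j$1)\<^sup>2 + (A$j$2)\<^sup>2 + (A$j$3)\<^sup>2 = 1"
  using SO3_column_norm[of "transpose A" j] SO3_transpose[OF assms] by (simp add: transpose_def)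

text \<open>A first quaternion produces the third column of R. What remains fixes the third axis,
  hence is a plane rotation, which the half angle lifts.\<close>

lemma SU2_to_SO3_surj:
  assumes R: "R \<in> SO3"
  obtains u where "u \<in> SU2" "SU2_to_SO3 u = R"
proof -
  let ?v = "\<lambda>i. R$i$3"
  have n: "(?v 1)\<^sup>2 + (?v 2)\<^sup>2 + (?v 3)\<^sup>2 = 1" by (rule SO3_column_norm[OF R])
  obtain x :: "real^4" where x: "x \<in> S3" "\<And>i. SU2_to_SO3 (quat_to_SU2 x) $i$3 = R$i$3"
  \<comment> \<open>The half-angle formula divides by a, the cosine of half the angle to the third
    axis, which vanishes at the south pole.\<close>
  proof (cases "?v 3 = -1")
    case True
    then have "?v 1 = 0" "?v 2 = 0" using n by (auto simp: sum_power2_eq_zero_iff)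
    then have "\<forall>i. SU2_to_SO3 (quat_to_SU2 (vector [0, 1, 0, 0])) $i$3 = R$i$3"
      unfolding forall_3 SU2_to_SO3_quat using True by (simp add: vector_4_nth)
    moreover have "vector [0, 1, 0, 0] \<in> S3" by (simp add: S3_iff vector_4_nth)
    ultimately show thesis using that by blast
  next
    case False
    have "(?v 3)\<^sup>2 \<le> 1" using n by (smt (verit) zero_le_power2)
    then have "\<bar>?v 3\<bar> \<le> 1" by (simp add: abs_square_le_1)
    then have v3: "-1 < ?v 3" using False by linarith
    define a where "a = sqrt ((1 + ?v 3) / 2)"
    have a: "0 < a" "a\<^sup>2 = (1 + ?v 3) / 2" using v3 by (simp_all add: a_def)
    define b c where "b = - ?v 1 / (2 * a)" and "c = ?v 2 / (2 * a)"
    have ab: "- 2 * a * b = ?v 1" and ac: "2 * a * c = ?v 2" using a by (simp_all add: b_def c_def)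
    have "4 * a\<^sup>2 * (b\<^sup>2 + c\<^sup>2) = (?v 1)\<^sup>2 + (?v 2)\<^sup>2"
      unfolding ab[symmetric] ac[symmetric] by (simp add: power2_eq_square algebra_simps)
    also have "\<dots> = 4 * a\<^sup>2 * (1 - a\<^sup>2)"
      using n unfolding a(2) by (simp add: power2_eq_square field_simps)
    finally have bc: "b\<^sup>2 + c\<^sup>2 = 1 - a\<^sup>2" using a(1) by simp
    have "SU2_to_SO3 (quat_to_SU2 (vector [a, b, c, 0])) $i$3 = R$i$3" for i
    proof -
      have "a\<^sup>2 - b\<^sup>2 - c\<^sup>2 = ?v 3" using bc a(2) by (simp add: field_simps)
      then have "\<forall>i. SU2_to_SO3 (quat_to_SU2 (vector [a, b, c, 0])) $i$3 = R$i$3"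
        unfolding forall_3 SU2_to_SO3_quat using ab ac by (simp add: vector_4_nth)
      then show ?thesis ..
    qed
    moreover have "vector [a, b, c, 0] \<in> S3" using bc by (simp add: S3_iff vector_4_nth)
    ultimately show thesis using that by blast
  qed
  define Q where "Q = SU2_to_SO3 (quat_to_SU2 x)"
  have Q: "Q \<in> SO3" unfolding Q_def using x(1) by (intro SU2_to_SO3_in_SO3) (simp add: quat_to_SU2_in_SU2_iff)
  define S where "S = transpose Q ** R"
  have S: "S \<in> SO3" unfolding S_def using SO3_transpose[OF Q] R by (intro SO3_mult) auto
  have QS: "Q ** S = R" unfolding S_def using SO3_transpose[OF Q] by (simp add: matrix_mul_assoc)
  have "S $i$3 = (transpose Q ** Q) $i$3" for i
    unfolding S_def matrix_matrix_mult_def using x(2) by (simp add: Q_def)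
  then have S3: "S$1$3 = 0" "S$2$3 = 0" "S$3$3 = 1" using SO3_transpose[OF Q] by (simp_all add: mat_def)
  have "S$3$1 = 0" "S$3$2 = 0" using SO3_row_norm[OF S, of 3] S3 by (auto simp: sum_power2_eq_zero_iff)
  note S3 = S3 this
  have "(S$1$1)\<^sup>2 + (S$1$2)\<^sup>2 = 1" using SO3_row_norm[OF S, of 1] S3 by simp
  then obtain \<phi> where \<phi>: "S$1$1 = cos \<phi>" "S$1$2 = sin \<phi>" by (metis sincos_total_2pi)
  have d: "S$1$1 * S$2$2 - S$1$2 * S$2$1 = 1" using S S3 by (simp add: SO3_def det_3)
  have o: "S$1$1 * S$1$2 + S$2$1 * S$2$2 = 0" "(S$1$2)\<^sup>2 + (S$2$2)\<^sup>2 = 1" "(S$1$1)\<^sup>2 + (S$2$1)\<^sup>2 = 1"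
  proof -
    have "(transpose S ** S)$1$2 = 0" using SO3_transpose[OF S] by (simp add: mat_def)
    then show "S$1$1 * S$1$2 + S$2$1 * S$2$2 = 0" using S3
      by (simp add: matrix_matrix_mult_def transpose_def sum_3)
  qed (use SO3_column_norm[OF S, of 1] SO3_column_norm[OF S, of 2] S3 in auto)
  have S22: "S$2$2 = cos \<phi>" "S$2$1 = - sin \<phi>" unfolding \<phi>[symmetric] using d o by algebra+
  define y :: "real^4" where "y = vector [cos (\<phi> / 2), 0, 0, sin (\<phi> / 2)]"
  have y: "y \<in> S3" by (simp add: y_def S3_iff vector_4_nth)
  have cs: "cos \<phi> = (cos (\<phi> / 2))\<^sup>2 - (sin (\<phi> / 2))\<^sup>2" "sin \<phi> = 2 * cos (\<phi> / 2) * sin (\<phi> / 2)"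
    using cos_double[of "\<phi> / 2"] sin_double[of "\<phi> / 2"] by simp_all
  have "SU2_to_SO3 (quat_to_SU2 y) = S"
    using S3 S22 \<phi> unfolding vec_eq_iff forall_3 SU2_to_SO3_quat by (simp add: y_def vector_4_nth cs)
  then have "SU2_to_SO3 (quat_to_SU2 x ** quat_to_SU2 y) = R"
    using x(1) y QS by (subst SU2_to_SO3_mult) (auto simp: quat_to_SU2_in_SU2_iff Q_def)
  moreover have "quat_to_SU2 x ** quat_to_SU2 y \<in> SU2"
    using x(1) y by (intro SU2_mult) (auto simp: quat_to_SU2_in_SU2_iff)
  ultimately show thesis using that by blast
qed

text \<open>The first subgroup is covered with reversed orientation. The sign disappears because
  each field is applied twice.\<close>

lemma SU2_to_SO3_omega: "SU2_to_SO3 (omega1 s) = rot1 (- s)" "SU2_to_SO3 (omega2 s) = rot2 s"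
proof -
  have cs: "cos s = (cos (s / 2))\<^sup>2 - (sin (s / 2))\<^sup>2" "sin s = 2 * cos (s / 2) * sin (s / 2)"
    using cos_double[of "s / 2"] sin_double[of "s / 2"] by simp_all
  have 1: "omega1 s = quat_to_SU2 (vector [cos (s / 2), 0, sin (s / 2), 0])"
    "omega2 s = quat_to_SU2 (vector [cos (s / 2), - sin (s / 2), 0, 0])"
    by (simp_all add: vec_eq_iff forall_2 omega1_def omega2_def quat_to_SU2_nth vector_4_nth complex_eq_iff)
  show "SU2_to_SO3 (omega1 s) = rot1 (- s)" "SU2_to_SO3 (omega2 s) = rot2 s"
    unfolding 1 SU2_to_SO3_quat rot1_def rot2_def cos_minus sin_minus cs
    by (simp_all add: vector_4_nth vec_eq_iff forall_3 mult_ac)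
qed


section \<open>Transport of Haar measure and compactness\<close>

lemma matrix_mult_continuous_on:
  fixes A :: "'a::real_normed_algebra_1^'n^'m"
  shows "continuous_on S (\<lambda>B :: 'a^'k^'n. A ** B)"
  unfolding matrix_matrix_mult_def by (intro continuous_intros)

lemma quat_mult_continuous_on: "continuous_on S (quat_mult x)"
proof -
  have eq: "quat_mult x y = (\<chi> i. if i = 1 then x$1 * y$1 - x$2 * y$2 - x$3 * y$3 - x$4 * y$4
      else if i = 2 then x$1 * y$2 + x$2 * y$1 + x$3 * y$4 - x$4 * y$3
      else if i = 3 then x$1 * y$3 - x$2 * y$4 + x$3 * y$1 + x$4 * y$2
      else x$1 * y$4 + x$2 * y$3 - x$3 * y$2 + x$4 * y$1)" for y
    by (simp add: quat_mult_def vec_eq_iff forall_4 vector_4_nth)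
  have "continuous_on S (\<lambda>y. (if i = 1 then x$1 * y$1 - x$2 * y$2 - x$3 * y$3 - x$4 * y$4
      else if i = 2 then x$1 * y$2 + x$2 * y$1 + x$3 * y$4 - x$4 * y$3
      else if i = 3 then x$1 * y$3 - x$2 * y$4 + x$3 * y$1 + x$4 * y$2
      else x$1 * y$4 + x$2 * y$3 - x$3 * y$2 + x$4 * y$1) :: real)" for i :: 4
    by (cases "i = 1"; cases "i = 2"; cases "i = 3") (auto intro!: continuous_intros)
  then show ?thesis unfolding eq[abs_def] by (intro continuous_on_vec_lambda)
qed

lemma quat_to_SU2_continuous_on: "continuous_on S quat_to_SU2"
proof -
  have eq: "quat_to_SU2 x = (\<chi> i j. if i = 1 then (if j = 1 then Complex (x$1) (x$4) else Complex (x$2) (x$3))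
      else (if j = 1 then Complex (- (x$2)) (x$3) else Complex (x$1) (- (x$4))))" for x
    by (simp add: vec_eq_iff forall_2 quat_to_SU2_nth)
  have "continuous_on S (\<lambda>x. if i = 1 then (if j = 1 then Complex (x$1) (x$4) else Complex (x$2) (x$3))
      else (if j = 1 then Complex (- (x$2)) (x$3) else Complex (x$1) (- (x$4))))" for i j :: 2
    unfolding Complex_eq by (cases "i = 1"; cases "j = 1") (auto intro!: continuous_intros)
  then show ?thesis unfolding eq[abs_def] by (intro continuous_on_vec_lambda)
qed

lemma SU2_to_SO3_continuous_on: "continuous_on S SU2_to_SO3"
  unfolding SU2_to_SO3_def[abs_def] matrix_matrix_mult_def trace_def adjoint_mat_def
  by (intro continuous_intros) auto

lemma normalized_haar_space:
  assumes "normalized_haar G mul M"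
  shows "space M = G" "sets M = sets (restrict_space borel G)" "prob_space M"
  using assms sets_eq_imp_space_eq[of M "restrict_space borel G"]
  by (auto simp: normalized_haar_def space_restrict_space)

lemma normalized_haar_measurable:
  assumes M: "normalized_haar G mul M" and f: "continuous_on G f"
  shows "f \<in> borel_measurable M"
  using borel_measurable_continuous_on_restrict[OF f] normalized_haar_space(2)[OF M]
  by (simp cong: measurable_cong_sets)

lemma measurable_into_restrict:
  assumes "f \<in> borel_measurable M" "f \<in> space M \<rightarrow> H"
  shows "f \<in> measurable M (restrict_space borel H)"
  using assms by (rule measurable_restrict_space2[rotated])

text \<open>The image of Haar measure under a continuous surjective homomorphism is invariant,
  because every h in H is some f g and translation by h pulls back to translation by g.\<close>

lemma normalized_haar_distr:
  assumes M: "normalized_haar G mul M"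
    and mul: "\<And>g. g \<in> G \<Longrightarrow> continuous_on G (mul g)" "\<And>g h. g \<in> G \<Longrightarrow> h \<in> G \<Longrightarrow> mul g h \<in> G"
    and mul': "\<And>g. g \<in> H \<Longrightarrow> continuous_on H (mul' g)" "\<And>g h. g \<in> H \<Longrightarrow> h \<in> H \<Longrightarrow> mul' g h \<in> H"
    and f: "continuous_on G f" "f ` G = H" "\<And>g h. g \<in> G \<Longrightarrow> h \<in> G \<Longrightarrow> f (mul g h) = mul' (f g) (f h)"
  shows "normalized_haar H mul' (distr M (restrict_space borel H) f)"
proof -
  note sp = normalized_haar_space[OF M]
  let ?N = "restrict_space borel H"
  have fm: "f \<in> measurable M ?N"
    using normalized_haar_measurable[OF M f(1)] f(2) sp(1) by (intro measurable_into_restrict) auto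
  have "distr (distr M ?N f) (distr M ?N f) (mul' h) = distr M ?N f" if h: "h \<in> H" for h
  proof -
    obtain g where g: "g \<in> G" "h = f g" using h f(2) by auto
    have mm: "mul g \<in> measurable M M"
    proof -
      have "mul g \<in> measurable M (restrict_space borel G)"
        using normalized_haar_measurable[OF M mul(1)[OF g(1)]] mul(2)[OF g(1)] sp(1)
        by (intro measurable_into_restrict) auto
      then show ?thesis using sp(2) by (simp cong: measurable_cong_sets)
    qed
    have mm': "mul' h \<in> measurable ?N ?N"
      using borel_measurable_continuous_on_restrict[OF mul'(1)[OF h]] mul'(2)[OF h]
      by (intro measurable_into_restrict) (auto simp: space_restrict_space)
    have "distr (distr M ?N f) (distr M ?N f) (mul' h) = distr (distr M ?N f) ?N (mul' h)"
      by (intro distr_cong) auto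
    also have "\<dots> = distr M ?N (mul' h \<circ> f)" by (rule distr_distr[OF mm' fm])
    also have "\<dots> = distr M ?N (f \<circ> mul g)"
      using f(3) g sp(1) by (intro distr_cong) auto
    also have "\<dots> = distr (distr M M (mul g)) ?N f" by (rule distr_distr[OF fm mm, symmetric])
    also have "\<dots> = distr M ?N f" using M g(1) by (simp add: normalized_haar_def)
    finally show ?thesis .
  qed
  moreover have "prob_space (distr M ?N f)" using prob_space.prob_space_distr[OF sp(3) fm] .
  ultimately show ?thesis by (simp add: normalized_haar_def)
qed

lemma normalized_haar_SU2_of_S3:
  assumes "normalized_haar S3 quat_mult M"
  shows "normalized_haar SU2 (**) (distr M (restrict_space borel SU2) quat_to_SU2)"
proof (rule normalized_haar_distr[OF assms])
  show "quat_to_SU2 ` S3 = SU2"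
    using SU2_to_quat_inverse SU2_to_quat_in_S3 quat_to_SU2_in_SU2_iff by (auto simp: image_iff) metis
qed (auto intro: quat_mult_continuous_on matrix_mult_continuous_on quat_to_SU2_continuous_on
    simp: quat_mult_S3 SU2_mult quat_to_SU2_mult)

lemma normalized_haar_SO3_of_SU2:
  assumes "normalized_haar SU2 (**) M"
  shows "normalized_haar SO3 (**) (distr M (restrict_space borel SO3) SU2_to_SO3)"
proof (rule normalized_haar_distr[OF assms])
  show "SU2_to_SO3 ` SU2 = SO3"
    using SU2_to_SO3_in_SO3 SU2_to_SO3_surj by (auto simp: image_iff) metis
qed (auto intro: matrix_mult_continuous_on SU2_to_SO3_continuous_on simp: SU2_mult SO3_mult SU2_to_SO3_mult)

lemma normalized_haar_integral_translate:
  fixes f :: "'a::topological_space \<Rightarrow> real"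
  assumes M: "normalized_haar G mul M" and g: "g \<in> G"
    and mul: "continuous_on G (mul g)" "\<And>h. h \<in> G \<Longrightarrow> mul g h \<in> G" and f: "continuous_on G f"
  shows "(\<integral>x. f (mul g x) \<partial>M) = (\<integral>x. f x \<partial>M)"
proof -
  note sp = normalized_haar_space[OF M]
  have "mul g \<in> measurable M (restrict_space borel G)"
    using normalized_haar_measurable[OF M mul(1)] mul(2) sp(1) by (intro measurable_into_restrict) auto
  then have "mul g \<in> measurable M M" using sp(2) by (simp cong: measurable_cong_sets)
  then have "(\<integral>x. f x \<partial>distr M M (mul g)) = (\<integral>x. f (mul g x) \<partial>M)"
    using normalized_haar_measurable[OF M f] by (intro integral_distr)
  then show ?thesis using M g by (simp add: normalized_haar_def)
qed

lemma compact_SU2: "compact SU2"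
proof -
  have "quat_to_SU2 ` S3 = SU2"
    using SU2_to_quat_inverse SU2_to_quat_in_S3 quat_to_SU2_in_SU2_iff by (auto simp: image_iff) metis
  moreover have "compact (quat_to_SU2 ` S3)"
    by (intro compact_continuous_image quat_to_SU2_continuous_on) (simp add: S3_def)
  ultimately show ?thesis by simp
qed

lemma compact_SO3: "compact SO3"
proof -
  have "SU2_to_SO3 ` SU2 = SO3"
    using SU2_to_SO3_in_SO3 SU2_to_SO3_surj by (auto simp: image_iff) metis
  then show ?thesis
    using compact_continuous_image[OF SU2_to_SO3_continuous_on compact_SU2] by simp
qed

lemma normalized_haar_integrable:
  fixes f :: "'a::topological_space \<Rightarrow> real"
  assumes M: "normalized_haar G mul M" and G: "compact G" and f: "continuous_on G f"
  shows "integrable M f"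
proof -
  interpret prob_space M by (rule normalized_haar_space(3)[OF M])
  have "bounded (f ` G)" using compact_continuous_image[OF f G] by (rule compact_imp_bounded)
  then obtain B where "\<And>x. x \<in> G \<Longrightarrow> norm (f x) \<le> B" unfolding bounded_iff by blast
  then show ?thesis
    using normalized_haar_measurable[OF M f] normalized_haar_space(1)[OF M]
    by (intro integrable_const_bound[where B=B] AE_I2) auto
qed

section \<open>The law of the (3,3) entry of a random rotation\<close>

lemma rot1_SO3: "rot1 s \<in> SO3" and rot2_SO3: "rot2 s \<in> SO3"
  using SU2_to_SO3_in_SO3[OF omega_SU2(1)[of "- s"]] SU2_to_SO3_in_SO3[OF omega_SU2(2)[of s]]
  by (simp_all add: SU2_to_SO3_omega)

text \<open>Differentiating the invariance of the integral of \<open>v\<^sub>3^n v\<^sub>2\<close> (with \<open>v\<close> the third column)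
  under rotations about the first axis.\<close>

lemma SO3_haar_moment_derivative:
  assumes M: "normalized_haar SO3 (**) M"
  shows "(\<integral>R. real n * (R$3$3) ^ (n - 1) * (R$2$3)\<^sup>2 - (R$3$3) ^ (n + 1) \<partial>M) = 0"
proof -
  interpret prob_space M by (rule normalized_haar_space(3)[OF M])
  \<comment> \<open>P and Q are the third and second coordinates of the third column of
    \<open>rot1 s ** R\<close>, so P' = Q and Q' = - P.\<close>
  define P where "P s R = sin s * R$2$3 + cos s * R$3$3" for s and R :: "real^3^3"
  define Q where "Q s R = cos s * R$2$3 - sin s * R$3$3" for s and R :: "real^3^3"
  define f where "f s R = P s R ^ n * Q s R" for s R
  define F where "F s R = real n * P s R ^ (n - 1) * (Q s R)\<^sup>2 - P s R ^ (n + 1)" for s R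
  have cont: "continuous_on SO3 (f s)" "continuous_on SO3 (F s)" for s
    unfolding f_def F_def P_def Q_def by (intro continuous_intros)+
  note meas [measurable] = normalized_haar_measurable[OF M cont(1)] normalized_haar_measurable[OF M cont(2)]
  have deriv: "((\<lambda>s. f s R) has_real_derivative F s R) (at s)" for s R
  proof -
    have "((\<lambda>s. P s R) has_real_derivative Q s R) (at s)" "((\<lambda>s. Q s R) has_real_derivative - P s R) (at s)"
      unfolding P_def Q_def by (auto intro!: derivative_eq_intros)
    then show ?thesis
      unfolding f_def F_def by (auto intro!: derivative_eq_intros simp: power2_eq_square)
  qed
  have bound: "\<bar>F s R\<bar> \<le> real n + 1" if "R \<in> SO3" for s R
  proof -
    have "(P s R)\<^sup>2 + (Q s R)\<^sup>2 = ((sin s)\<^sup>2 + (cos s)\<^sup>2) * ((R$2$3)\<^sup>2 + (R$3$3)\<^sup>2)"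
      unfolding P_def Q_def by algebra
    also have "\<dots> = (R$2$3)\<^sup>2 + (R$3$3)\<^sup>2" by simp
    also have "\<dots> \<le> 1" using SO3_column_norm[OF that, of 3] zero_le_power2[of "R$1$3"] by linarith
    finally have "(P s R)\<^sup>2 \<le> 1" "(Q s R)\<^sup>2 \<le> 1" by (smt (verit) zero_le_power2)+
    then have 1: "\<bar>P s R\<bar> \<le> 1" "\<bar>Q s R\<bar> \<le> 1" by (simp_all add: abs_square_le_1)
    have "\<bar>F s R\<bar> \<le> \<bar>real n * P s R ^ (n - 1) * (Q s R)\<^sup>2\<bar> + \<bar>P s R ^ (n + 1)\<bar>"
      unfolding F_def by (rule abs_triangle_ineq4)
    also have "\<dots> \<le> real n * 1 * 1 + 1"
      unfolding abs_mult power_abs using 1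
      by (intro add_mono mult_mono power_le_one) auto
    finally show ?thesis by simp
  qed
  \<comment> \<open>The integral of \<open>f t\<close> is independent of t, so all difference
    quotients integrate to 0. The bound on F dominates them, and F 0 is their limit.\<close>
  define s where "s m = inverse (real (Suc m))" for m
  have s0: "s m \<noteq> 0" for m by (simp add: s_def)
  define q where "q m R = (f (s m) R - f 0 R) / s m" for m R
  have inv: "(\<integral>R. f t R \<partial>M) = (\<integral>R. f 0 R \<partial>M)" for t
  proof -
    have "f t R = f 0 (rot1 t ** R)" for R
      by (simp add: f_def P_def Q_def rot1_def matrix_matrix_mult_def sum_3 algebra_simps)
    then show ?thesis
      using normalized_haar_integral_translate[OF M rot1_SO3[of t] matrix_mult_continuous_on _ cont(1)[of 0]]
        SO3_mult[OF rot1_SO3] by simp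
  qed
  have q_int: "(\<integral>R. q m R \<partial>M) = 0" for m
  proof -
    have "integrable M (f t)" for t by (rule normalized_haar_integrable[OF M compact_SO3 cont(1)])
    then show ?thesis using inv[of "s m"] by (simp add: q_def)
  qed
  have "(\<lambda>m. \<integral>R. q m R \<partial>M) \<longlonglongrightarrow> (\<integral>R. F 0 R \<partial>M)"
  proof (rule integral_dominated_convergence[where w = "\<lambda>_. real n + 1"])
    show "AE R in M. (\<lambda>m. q m R) \<longlonglongrightarrow> F 0 R"
    proof (rule AE_I2)
      fix R
      have lim: "((\<lambda>h. (f (0 + h) R - f 0 R) / h) \<longlongrightarrow> F 0 R) (at 0)"
        using deriv[of R 0] by (simp add: DERIV_def)
      have "filterlim s (at 0) sequentially"
        unfolding s_def[abs_def] by (rule filterlim_atI[OF LIMSEQ_inverse_real_of_nat]) auto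
      from filterlim_compose[OF lim this] show "(\<lambda>m. q m R) \<longlonglongrightarrow> F 0 R" by (simp add: q_def)
    qed
    show "AE R in M. norm (q m R) \<le> real n + 1" for m
    proof (rule AE_I2)
      fix R assume "R \<in> space M"
      then have R: "R \<in> SO3" using normalized_haar_space(1)[OF M] by simp
      have "norm (f (s m) R - f 0 R) \<le> (real n + 1) * norm (s m - 0)"
        using deriv bound[OF R] by (intro field_differentiable_bound[of UNIV "\<lambda>t. f t R" "\<lambda>t. F t R"]) auto
      then show "norm (q m R) \<le> real n + 1" using s0[of m] by (simp add: q_def divide_le_eq)
    qed
    show "q m \<in> borel_measurable M" for m unfolding q_def by measurable
  qed simp_all
  then have "(\<integral>R. F 0 R \<partial>M) = 0" using q_int by (simp add: LIMSEQ_const_iff)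
  then show ?thesis by (simp add: F_def P_def Q_def)
qed

text \<open>Writing M_n for the moments and I_2 for the integral of v_3^n v_2^2, the derivative
  identity gives (n + 1) I_2 = M_(n+2). Symmetry between the first two axes and |v| = 1 give 2 I_2 +
  M_(n+2) = M_n. Hence (n + 3) M_(n+2) = (n + 1) M_n.\<close>

lemma SO3_haar_moment:
  assumes M: "normalized_haar SO3 (**) M"
  shows "(\<integral>R. (R$3$3) ^ n \<partial>M) = (1 + (-1) ^ n) / (2 * (real n + 1))"
proof (induction n rule: induct_nat_012)
  interpret prob_space M by (rule normalized_haar_space(3)[OF M])
  case 0
  show ?case by (simp add: prob_space)
next
  case 1
  show ?case using SO3_haar_moment_derivative[OF M, of 0] by simp
next
  case (ge2 n)
  interpret prob_space M by (rule normalized_haar_space(3)[OF M])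
  have integrable: "integrable M (\<lambda>R. (R$3$3) ^ a * (R$i$3) ^ b)" for a b i
    by (intro normalized_haar_integrable[OF M compact_SO3] continuous_intros)
  let ?I = "\<lambda>i. \<integral>R. (R$3$3) ^ n * (R$i$3)\<^sup>2 \<partial>M" and ?M = "\<lambda>n. \<integral>R. (R$3$3) ^ n \<partial>M"
  \<comment> \<open>The quarter turn about the third axis, which exchanges v_1^2 and v_2^2 and fixes
    v_3.\<close>
  let ?g = "vector [vector [0, -1, 0], vector [1, 0, 0], vector [0, 0, 1]] :: real^3^3"
  have g: "?g \<in> SO3"
    by (simp add: SO3_def orthogonal_matrix det_3 vec_eq_iff forall_3 matrix_matrix_mult_def transpose_def sum_3 mat_def)
  have "?I 2 = (\<integral>R. ((?g ** R)$3$3) ^ n * ((?g ** R)$2$3)\<^sup>2 \<partial>M)"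
    using SO3_mult[OF g]
    by (intro normalized_haar_integral_translate[OF M g matrix_mult_continuous_on, symmetric] continuous_intros)
  also have "\<dots> = ?I 1" by (simp add: matrix_matrix_mult_def sum_3)
  finally have I12: "?I 2 = ?I 1" .
  have "?I 1 + ?I 2 + ?I 3 = (\<integral>R. (R$3$3) ^ n * (R$1$3)\<^sup>2 + (R$3$3) ^ n * (R$2$3)\<^sup>2 + (R$3$3) ^ n * (R$3$3)\<^sup>2 \<partial>M)"
    using integrable by simp
  also have "\<dots> = ?M n"
  proof (rule Bochner_Integration.integral_cong[OF refl])
    fix R assume "R \<in> space M"
    then have "(R$1$3)\<^sup>2 + (R$2$3)\<^sup>2 + (R$3$3)\<^sup>2 = 1" using SO3_column_norm normalized_haar_space(1)[OF M] by simp
    then show "(R$3$3) ^ n * (R$1$3)\<^sup>2 + (R$3$3) ^ n * (R$2$3)\<^sup>2 + (R$3$3) ^ n * (R$3$3)\<^sup>2 = (R$3$3) ^ n"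
      by (simp flip: distrib_left)
  qed
  finally have "?I 1 + ?I 2 + ?I 3 = ?M n" .
  moreover have "?I 3 = ?M (n + 2)" by (simp only: power_add)
  ultimately have I: "2 * ?I 2 + ?M (n + 2) = ?M n" using I12 by linarith
  \<comment> \<open>The zeroth power puts the second term into the shape covered by
    \<open>integrable\<close>.\<close>
  have "(\<integral>R. real (n + 1) * ((R$3$3) ^ n * (R$2$3)\<^sup>2) - (R$3$3) ^ (n + 2) * (R$1$3) ^ 0 \<partial>M) = 0"
    using SO3_haar_moment_derivative[OF M, of "n + 1"] by (simp add: mult.assoc)
  then have "real (n + 1) * ?I 2 = ?M (n + 2)"
    using integrable[of n 2 2] integrable[of "n + 2" 1 0] by simp
  moreover have "k * m = (k + 2) * z" if "k * x = z" "2 * x + z = m" for k x z m :: real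
    by (simp add: that(1)[symmetric] that(2)[symmetric] algebra_simps)
  ultimately have "real (n + 1) * ?M n = (real (n + 1) + 2) * ?M (n + 2)" using I by blast
  then have "real (n + 1) * ?M n = (real n + 3) * ?M (n + 2)" by simp
  moreover have c: "(a + 1) * (b / (2 * (a + 1))) = b / 2" if "0 \<le> a" for a b :: real
    using that by (simp add: divide_simps algebra_simps)
  ultimately have "(real n + 3) * ?M (n + 2) = (1 + (-1) ^ n) / 2"
    unfolding ge2(1) of_nat_add of_nat_1 c[OF of_nat_0_le_iff] by simp
  moreover have "x = y / z" if "z * x = y" "0 < z" for x y z :: real
    using that by (simp add: field_simps)
  ultimately have "?M (n + 2) = (1 + (-1) ^ n) / 2 / (real n + 3)" by (smt (verit) of_nat_0_le_iff)
  then show ?case by (simp add: algebra_simps)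
qed

lemma integral_power_symmetric: "integral {-1..1} (\<lambda>x::real. x ^ n) = (1 + (-1) ^ n) / (real n + 1)"
proof -
  have "((\<lambda>x::real. x ^ n) has_integral 1 ^ (n + 1) / (real n + 1) - (-1) ^ (n + 1) / (real n + 1)) {-1..1}"
  proof (rule fundamental_theorem_of_calculus)
    fix x :: real
    have "((\<lambda>x. x ^ (n + 1) / (real n + 1)) has_real_derivative
        (real (n + 1) * x ^ (n + 1 - Suc 0)) / (real n + 1)) (at x within {-1..1})"
      by (intro DERIV_cdivide DERIV_pow)
    moreover have "(real (n + 1) * x ^ (n + 1 - Suc 0)) / (real n + 1) = x ^ n"
      by (simp add: add.commute)
    ultimately have "((\<lambda>x. x ^ (n + 1) / (real n + 1)) has_real_derivative x ^ n) (at x within {-1..1})"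
      by (simp only:)
    then show "((\<lambda>x. x ^ (n + 1) / (real n + 1)) has_vector_derivative x ^ n) (at x within {-1..1})"
      by (simp only: has_real_derivative_iff_has_vector_derivative)
  qed simp
  then show ?thesis by (simp add: integral_unique diff_divide_distrib[symmetric] add_divide_distrib)
qed

text \<open>Archimedes' theorem on the sphere: the moments agree with those of the uniform law, and
  polynomials are uniformly dense in the continuous functions on [-1, 1].\<close>

lemma SO3_haar_uniform:
  assumes M: "normalized_haar SO3 (**) M" and h: "continuous_on {-1..1} (h :: real \<Rightarrow> real)"
  shows "(\<integral>R. h (R$3$3) \<partial>M) = integral {-1..1} h / 2"
proof -
  interpret prob_space M by (rule normalized_haar_space(3)[OF M])
  have R33: "R$3$3 \<in> {-1..1}" if "R \<in> SO3" for R :: "real^3^3"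
  proof -
    have "(R$3$3)\<^sup>2 \<le> 1" using SO3_column_norm[OF that, of 3] by (smt (verit) zero_le_power2)
    then show ?thesis by (simp add: abs_square_le_1 abs_le_iff)
  qed
  have int: "integrable M (\<lambda>R. g (R$3$3))" if "continuous_on {-1..1} g" for g :: "real \<Rightarrow> real"
    using R33 by (intro normalized_haar_integrable[OF M compact_SO3] continuous_on_compose2[OF that] continuous_intros) auto
  have poly: "(\<integral>R. g (R$3$3) \<partial>M) = integral {-1..1} g / 2" if pg: "real_polynomial_function g" for g
  proof -
    obtain a n where g: "g = (\<lambda>x. \<Sum>i\<le>n. a i * x ^ i)" using pg unfolding real_polynomial_function_iff_sum by blast
    have "integrable M (\<lambda>R. (R$3$3) ^ i)" for i by (intro int[of "\<lambda>x. x ^ i"] continuous_intros)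
    then have "(\<integral>R. g (R$3$3) \<partial>M) = (\<Sum>i\<le>n. a i * ((1 + (-1) ^ i) / (2 * (real i + 1))))"
      unfolding g by (simp add: SO3_haar_moment[OF M])
    also have "\<dots> = (\<Sum>i\<le>n. a i * integral {-1..1} (\<lambda>x. x ^ i)) / 2"
      unfolding sum_divide_distrib integral_power_symmetric by (intro sum.cong refl) simp
    also have "(\<Sum>i\<le>n. a i * integral {-1..1} (\<lambda>x. x ^ i)) = integral {-1..1} g"
      unfolding g by (subst integral_sum) (auto intro!: integrable_continuous_real continuous_intros)
    finally show ?thesis .
  qed
  have "\<bar>(\<integral>R. h (R$3$3) \<partial>M) - integral {-1..1} h / 2\<bar> \<le> \<epsilon>" if \<epsilon>: "0 < \<epsilon>" for \<epsilon>
  proof -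
    obtain g where g: "real_polynomial_function g" "\<And>x. x \<in> {-1..1} \<Longrightarrow> \<bar>h x - g x\<bar> < \<epsilon> / 2"
      using Stone_Weierstrass_real_polynomial_function[OF compact_Icc h, of "\<epsilon> / 2"] \<epsilon> by auto
    have cg: "continuous_on {-1..1} g"
      using g(1) continuous_on_polymonial_function by (auto simp: real_polynomial_function_eq)
    have "\<bar>(\<integral>R. h (R$3$3) \<partial>M) - (\<integral>R. g (R$3$3) \<partial>M)\<bar> = \<bar>\<integral>R. h (R$3$3) - g (R$3$3) \<partial>M\<bar>"
      using int[OF h] int[OF cg] by simp
    also have "\<dots> \<le> (\<integral>R. \<bar>h (R$3$3) - g (R$3$3)\<bar> \<partial>M)" by (rule integral_abs_bound)
    also have "\<dots> \<le> (\<integral>R. \<epsilon> / 2 \<partial>M)"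
      using int[OF h] int[OF cg] less_imp_le[OF g(2)[OF R33]] normalized_haar_space(1)[OF M]
      by (intro integral_mono) auto
    finally have 1: "\<bar>(\<integral>R. h (R$3$3) \<partial>M) - (\<integral>R. g (R$3$3) \<partial>M)\<bar> \<le> \<epsilon> / 2" by (simp add: prob_space)
    have "\<bar>integral {-1..1} h - integral {-1..1} g\<bar> = norm (integral {-1..1} (\<lambda>x. h x - g x))"
      using h cg by (simp add: Henstock_Kurzweil_Integration.integral_diff integrable_continuous_real)
    also have "\<dots> \<le> \<epsilon> / 2 * (1 - (-1))"
      using h cg less_imp_le[OF g(2)] by (intro integral_bound continuous_on_diff) auto
    finally have 2: "\<bar>integral {-1..1} h - integral {-1..1} g\<bar> \<le> \<epsilon>" by simp
    show ?thesis using 1 2 unfolding poly[OF g(1)] by linarith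
  qed
  then have "\<bar>(\<integral>R. h (R$3$3) \<partial>M) - integral {-1..1} h / 2\<bar> \<le> 0"
    by (rule dense_ge)
  then show ?thesis by simp
qed

section \<open>Sub-Laplacians\<close>

lemma continuous_on_coeff_mult:
  fixes F G :: "'a::topological_space \<Rightarrow> complex poly"
  assumes "\<And>c. continuous_on S (\<lambda>x. coeff (F x) c)" "\<And>c. continuous_on S (\<lambda>x. coeff (G x) c)"
  shows "continuous_on S (\<lambda>x. coeff (F x * G x) c)"
  unfolding coeff_mult by (intro continuous_intros assms)

lemma continuous_on_coeff_power:
  fixes F :: "'a::topological_space \<Rightarrow> complex poly"
  assumes "\<And>c. continuous_on S (\<lambda>x. coeff (F x) c)"
  shows "continuous_on S (\<lambda>x. coeff (F x ^ n) c)"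
  by (induction n arbitrary: c) (auto intro: continuous_on_coeff_mult assms)

lemma rep_SU2_continuous_on: "continuous_on S (\<lambda>u. rep_SU2 k u i j)"
proof -
  have lin: "continuous_on S (\<lambda>u. coeff [:f u, g u:] c)" if "continuous_on S f" "continuous_on S g"
    for f g :: "complex^2^2 \<Rightarrow> complex" and c
  proof (cases c)
    case (Suc d)
    then show ?thesis using that by (cases d) (simp_all add: coeff_pCons)
  qed (use that in simp)
  have "continuous_on S (\<lambda>u. coeff (col1 u) c)" "continuous_on S (\<lambda>u. coeff (col2 u) c)" for c
    unfolding col1_def col2_def by (intro lin continuous_intros)+
  then show ?thesis
    unfolding rep_SU2_eq by (intro continuous_intros continuous_on_coeff_mult continuous_on_coeff_power)
qed

definition SO3_lift :: "real^3^3 \<Rightarrow> complex^2^2" where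
  "SO3_lift R = (SOME u. u \<in> SU2 \<and> SU2_to_SO3 u = R)"

lemma rep_SO3_eq: "rep_SO3 k R = rep_SU2 k (SO3_lift R)"
  by (simp add: rep_SO3_def SO3_lift_def)

lemma SO3_lift:
  assumes "R \<in> SO3"
  shows "SO3_lift R \<in> SU2" "SU2_to_SO3 (SO3_lift R) = R"
proof -
  have "\<exists>u. u \<in> SU2 \<and> SU2_to_SO3 u = R" using SU2_to_SO3_surj[OF assms] by metis
  from someI_ex[OF this] show "SO3_lift R \<in> SU2" "SU2_to_SO3 (SO3_lift R) = R"
    unfolding SO3_lift_def by auto
qed

text \<open>The entries are homogeneous of degree k in u.\<close>

lemma rep_SU2_uminus:
  assumes "even k" "j \<le> k"
  shows "rep_SU2 k (- u) i j = rep_SU2 k u i j"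
proof -
  have "col1 (- u) = smult (-1) (col1 u)" "col2 (- u) = smult (-1) (col2 u)"
    by (simp_all add: col1_def col2_def)
  then have "col1 (- u) ^ (k - j) * col2 (- u) ^ j = smult ((-1) ^ (k - j) * (-1) ^ j) (col1 u ^ (k - j) * col2 u ^ j)"
    by (simp only: smult_power mult_smult_left mult_smult_right smult_smult mult.commute)
  also have "(-1) ^ (k - j) * (-1) ^ j = (1 :: complex)"
    using assms by (simp flip: power_add)
  finally show ?thesis by (simp add: rep_SU2_eq)
qed

lemma rep_SO3_cover:
  assumes "even k" "j \<le> k" "u \<in> SU2"
  shows "rep_SO3 k (SU2_to_SO3 u) i j = rep_SU2 k u i j"
proof -
  note lift = SO3_lift[OF SU2_to_SO3_in_SO3[OF assms(3)]]
  have "SO3_lift (SU2_to_SO3 u) = u \<or> SO3_lift (SU2_to_SO3 u) = - u"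
    using SU2_to_SO3_fibre[OF lift(1) assms(3) lift(2)] .
  then show ?thesis using rep_SU2_uminus[OF assms(1,2)] by (auto simp: rep_SO3_eq)
qed

text \<open>\<open>SU2_to_SO3\<close> is a quotient map: the preimage of a closed set under \<open>rep_SO3\<close> is the image of a
  compact one.\<close>

lemma rep_SO3_continuous_on:
  assumes "even k" "j \<le> k"
  shows "continuous_on SO3 (\<lambda>R. rep_SO3 k R i j)"
proof (subst continuous_on_closed_vimage[OF compact_imp_closed[OF compact_SO3]], intro allI impI)
  fix B :: "complex set" assume B: "closed B"
  have "(\<lambda>R. rep_SO3 k R i j) -` B \<inter> SO3 = SU2_to_SO3 ` ((\<lambda>u. rep_SU2 k u i j) -` B \<inter> SU2)"
  proof (intro subset_antisym subsetI)
    fix R assume R: "R \<in> (\<lambda>R. rep_SO3 k R i j) -` B \<inter> SO3"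
    then have "SO3_lift R \<in> (\<lambda>u. rep_SU2 k u i j) -` B \<inter> SU2" using SO3_lift[of R] by (auto simp: rep_SO3_eq)
    then show "R \<in> SU2_to_SO3 ` ((\<lambda>u. rep_SU2 k u i j) -` B \<inter> SU2)"
      using SO3_lift(2)[of R] R by (metis IntD2 imageI)
  qed (auto simp: rep_SO3_cover[OF assms] SU2_to_SO3_in_SO3)
  moreover have "closed ((\<lambda>u. rep_SU2 k u i j) -` B \<inter> SU2)"
    using continuous_on_closed_vimage[OF compact_imp_closed[OF compact_SU2]] rep_SU2_continuous_on B by blast
  then have "compact ((\<lambda>u. rep_SU2 k u i j) -` B \<inter> SU2)"
    using compact_Int_closed[OF compact_SU2] by (metis Int_absorb1 Int_lower2 inf.commute)
  then have "compact (SU2_to_SO3 ` ((\<lambda>u. rep_SU2 k u i j) -` B \<inter> SU2))"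
    by (rule compact_continuous_image[OF SU2_to_SO3_continuous_on])
  ultimately show "closed ((\<lambda>R. rep_SO3 k R i j) -` B \<inter> SO3)" by (simp add: compact_imp_closed)
qed

section \<open>Matrix coefficients as eigenfunctions\<close>

text \<open>With raising part U and lowering part L, the fields are e1 (U + L) and e2 (U - L), where
  e1^2 = -1/4 and e2^2 = 1/4. In the sum of squares the double shifts cancel and the mixed terms
  return to column j. The sign \<epsilon> admits either orientation of the first subgroup.\<close>

lemma sub_laplacian_of_ladder:
  fixes t :: "'a \<Rightarrow> nat \<Rightarrow> complex" and \<epsilon> :: complex
  assumes \<epsilon>: "\<epsilon> * \<epsilon> = 1"
    and G: "\<And>x s. x \<in> G \<Longrightarrow> mul x (\<gamma>1 s) \<in> G" "\<And>x s. x \<in> G \<Longrightarrow> mul x (\<gamma>2 s) \<in> G"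
    and d1: "\<And>x j. x \<in> G \<Longrightarrow> j \<le> k \<Longrightarrow> ((\<lambda>s. t (mul x (\<gamma>1 s)) j) has_vector_derivative
       \<epsilon> * \<i> / 2 * (of_real (ladder k (Suc j)) * t x (Suc j) + of_real (ladder k j) * t x (j - 1))) (at 0)"
    and d2: "\<And>x j. x \<in> G \<Longrightarrow> j \<le> k \<Longrightarrow> ((\<lambda>s. t (mul x (\<gamma>2 s)) j) has_vector_derivative
       1 / 2 * (of_real (ladder k (Suc j)) * t x (Suc j) - of_real (ladder k j) * t x (j - 1))) (at 0)"
    and x: "x \<in> G" and j: "j \<le> k"
  shows "sub_laplacian mul \<gamma>1 \<gamma>2 (\<lambda>y. t y j) x = - of_real (real j * real (k - j) + real k / 2) * t x j"
proof -
  define U where "U j y = of_real (ladder k (Suc j)) * t y (Suc j)" for j y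
  define L where "L j y = of_real (ladder k j) * t y (j - 1)" for j y
  define e1 :: complex where "e1 = \<epsilon> * \<i> / 2"
  define e2 :: complex where "e2 = 1 / 2"
  have top: "ladder k (Suc k) = 0" and bot: "ladder k 0 = 0" by (simp_all add: ladder_def)
  have lower_U: "of_real (ladder k j) * U (j - 1) y = of_real ((ladder k j)\<^sup>2) * t y j" for y
    using bot by (cases j) (simp_all add: U_def power2_eq_square)
  have raise_L: "of_real (ladder k (Suc j)) * L (Suc j) y = of_real ((ladder k (Suc j))\<^sup>2) * t y j" for y
    by (simp add: L_def power2_eq_square)
  have field1: "invariant_field mul \<gamma>1 (\<lambda>y. t y j) y = e1 * (U j y + L j y)" if "y \<in> G" "j \<le> k" for y j
    unfolding invariant_field_def U_def L_def e1_def by (rule vector_derivative_at) (rule d1[OF that])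
  have field2: "invariant_field mul \<gamma>2 (\<lambda>y. t y j) y = e2 * (U j y - L j y)" if "y \<in> G" "j \<le> k" for y j
    unfolding invariant_field_def U_def L_def e2_def by (rule vector_derivative_at) (rule d2[OF that])
  \<comment> \<open>At j = k the ladder coefficient is 0, so the column k + 1 is never
    differentiated.\<close>
  have dU1: "((\<lambda>s. U j (mul x (\<gamma>1 s))) has_vector_derivative
      of_real (ladder k (Suc j)) * (e1 * (U (Suc j) x + L (Suc j) x))) (at 0)"
  proof (cases "j = k")
    case False
    then show ?thesis unfolding U_def[of j] using d1[OF x, of "Suc j"] j
      by (intro has_vector_derivative_mult_right) (simp add: U_def L_def e1_def)
  qed (simp add: U_def[of k] top)
  have dL1: "((\<lambda>s. L j (mul x (\<gamma>1 s))) has_vector_derivative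
      of_real (ladder k j) * (e1 * (U (j - 1) x + L (j - 1) x))) (at 0)"
    unfolding L_def[of j] using d1[OF x, of "j - 1"] j
    by (intro has_vector_derivative_mult_right) (simp add: U_def L_def e1_def)
  have dU2: "((\<lambda>s. U j (mul x (\<gamma>2 s))) has_vector_derivative
      of_real (ladder k (Suc j)) * (e2 * (U (Suc j) x - L (Suc j) x))) (at 0)"
  proof (cases "j = k")
    case False
    then show ?thesis unfolding U_def[of j] using d2[OF x, of "Suc j"] j
      by (intro has_vector_derivative_mult_right) (simp add: U_def L_def e2_def)
  qed (simp add: U_def[of k] top)
  have dL2: "((\<lambda>s. L j (mul x (\<gamma>2 s))) has_vector_derivative
      of_real (ladder k j) * (e2 * (U (j - 1) x - L (j - 1) x))) (at 0)"
    unfolding L_def[of j] using d2[OF x, of "j - 1"] j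
    by (intro has_vector_derivative_mult_right) (simp add: U_def L_def e2_def)
  have "invariant_field mul \<gamma>1 (invariant_field mul \<gamma>1 (\<lambda>y. t y j)) x =
      vector_derivative (\<lambda>s. e1 * (U j (mul x (\<gamma>1 s)) + L j (mul x (\<gamma>1 s)))) (at 0)"
    unfolding invariant_field_def[of mul \<gamma>1 "invariant_field mul \<gamma>1 (\<lambda>y. t y j)"] field1[OF G(1)[OF x] j] ..
  also have "\<dots> = e1 * (of_real (ladder k (Suc j)) * (e1 * (U (Suc j) x + L (Suc j) x)) +
      of_real (ladder k j) * (e1 * (U (j - 1) x + L (j - 1) x)))"
    by (intro vector_derivative_at has_vector_derivative_mult_right has_vector_derivative_add dU1 dL1)
  finally have D1: "invariant_field mul \<gamma>1 (invariant_field mul \<gamma>1 (\<lambda>y. t y j)) x =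
      e1 * e1 * (of_real (ladder k (Suc j)) * U (Suc j) x + of_real (ladder k (Suc j)) * L (Suc j) x +
      of_real (ladder k j) * U (j - 1) x + of_real (ladder k j) * L (j - 1) x)"
    by (simp add: algebra_simps)
  have "invariant_field mul \<gamma>2 (invariant_field mul \<gamma>2 (\<lambda>y. t y j)) x =
      vector_derivative (\<lambda>s. e2 * (U j (mul x (\<gamma>2 s)) - L j (mul x (\<gamma>2 s)))) (at 0)"
    unfolding invariant_field_def[of mul \<gamma>2 "invariant_field mul \<gamma>2 (\<lambda>y. t y j)"] field2[OF G(2)[OF x] j] ..
  also have "\<dots> = e2 * (of_real (ladder k (Suc j)) * (e2 * (U (Suc j) x - L (Suc j) x)) -
      of_real (ladder k j) * (e2 * (U (j - 1) x - L (j - 1) x)))"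
    by (intro vector_derivative_at has_vector_derivative_mult_right has_vector_derivative_diff dU2 dL2)
  finally have D2: "invariant_field mul \<gamma>2 (invariant_field mul \<gamma>2 (\<lambda>y. t y j)) x =
      e2 * e2 * (of_real (ladder k (Suc j)) * U (Suc j) x - of_real (ladder k (Suc j)) * L (Suc j) x -
      of_real (ladder k j) * U (j - 1) x + of_real (ladder k j) * L (j - 1) x)"
    by (simp add: algebra_simps)
  have ee: "e1 * e1 = - 1 / 4" "e2 * e2 = 1 / 4"
    using \<epsilon> by (simp_all add: e1_def e2_def) (simp add: mult_ac flip: mult.assoc)
  have "sub_laplacian mul \<gamma>1 \<gamma>2 (\<lambda>y. t y j) x =
      - 1 / 2 * (of_real (ladder k (Suc j)) * L (Suc j) x + of_real (ladder k j) * U (j - 1) x)"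
    unfolding sub_laplacian_def D1 D2 ee by (simp add: field_simps)
  also have "\<dots> = - 1 / 2 * of_real ((ladder k (Suc j))\<^sup>2 + (ladder k j)\<^sup>2) * t x j"
    unfolding lower_U raise_L by (simp add: algebra_simps)
  also have "\<dots> = - of_real (real j * real (k - j) + real k / 2) * t x j"
  proof -
    have "- 1 / 2 * of_real (2 * a) * z = - of_real a * z" for a and z :: complex by simp
    then show ?thesis unfolding ladder_sum[OF j] .
  qed
  finally show ?thesis .
qed

lemma sub_laplacian_SU2_rep:
  assumes "u \<in> SU2" "j \<le> k"
  shows "sub_laplacian_SU2 (\<lambda>y. rep_SU2 k y i j) u = - of_real (real j * real (k - j) + real k / 2) * rep_SU2 k u i j"
  unfolding sub_laplacian_SU2_def
proof (rule sub_laplacian_of_ladder[where G = SU2 and \<epsilon> = 1])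
  fix x j s assume "x \<in> SU2"
  then show "x ** omega1 s \<in> SU2" "x ** omega2 s \<in> SU2" using SU2_mult omega_SU2 by blast+
next
  fix x j assume j: "j \<le> k"
  show "((\<lambda>s. rep_SU2 k (x ** omega1 s) i j) has_vector_derivative 1 * \<i> / 2 *
      (of_real (ladder k (Suc j)) * rep_SU2 k x i (Suc j) + of_real (ladder k j) * rep_SU2 k x i (j - 1))) (at 0)"
    using rep_SU2_has_vector_derivative[OF j omega_0(1) omega1_derivatives, of x i] by (simp add: algebra_simps)
  show "((\<lambda>s. rep_SU2 k (x ** omega2 s) i j) has_vector_derivative 1 / 2 *
      (of_real (ladder k (Suc j)) * rep_SU2 k x i (Suc j) - of_real (ladder k j) * rep_SU2 k x i (j - 1))) (at 0)"
    using rep_SU2_has_vector_derivative[OF j omega_0(2) omega2_derivatives, of x i] by (simp add: algebra_simps)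
qed (use assms in auto)

text \<open>Along a lifted curve the chosen preimage may jump, but only by a sign, which even k does
  not see. Derivatives can therefore be computed on SU(2) from one fixed preimage of R.\<close>

lemma rep_SO3_along:
  assumes "even k" "j \<le> k" "R \<in> SO3" "w \<in> SU2"
  shows "rep_SO3 k (R ** SU2_to_SO3 w) i j = rep_SU2 k (SO3_lift R ** w) i j"
proof -
  note lift = SO3_lift[OF assms(3)]
  have "R ** SU2_to_SO3 w = SU2_to_SO3 (SO3_lift R ** w)"
    using lift assms(4) by (simp add: SU2_to_SO3_mult)
  then show ?thesis using rep_SO3_cover[OF assms(1,2) SU2_mult[OF lift(1) assms(4)]] by simp
qed

lemma sub_laplacian_SO3_rep:
  assumes k: "even k" and "R \<in> SO3" "j \<le> k"
  shows "sub_laplacian_SO3 (\<lambda>y. rep_SO3 k y i j) R = - of_real (real j * real (k - j) + real k / 2) * rep_SO3 k R i j"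
  unfolding sub_laplacian_SO3_def
proof (rule sub_laplacian_of_ladder[where G = SO3 and \<epsilon> = "-1"])
  fix x j s assume "x \<in> SO3"
  then show "x ** rot1 s \<in> SO3" "x ** rot2 s \<in> SO3" using SO3_mult rot1_SO3 rot2_SO3 by blast+
next
  fix x j assume x: "x \<in> SO3" and j: "j \<le> k"
  let ?u = "SO3_lift x"
  \<comment> \<open>The point is written - 0 to fit the chain rule with the reversal s \<mapsto> -
    s.\<close>
  have "((\<lambda>s. rep_SU2 k (?u ** omega1 s) i j) has_vector_derivative \<i> / 2 *
      (of_real (ladder k (Suc j)) * rep_SU2 k ?u i (Suc j) + of_real (ladder k j) * rep_SU2 k ?u i (j - 1))) (at (- 0))"
    using rep_SU2_has_vector_derivative[OF j omega_0(1) omega1_derivatives, of ?u i] by (simp add: algebra_simps)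
  moreover have "(uminus has_vector_derivative (-1 :: real)) (at 0)"
    by (auto intro!: derivative_eq_intros)
  ultimately have "((\<lambda>s. rep_SU2 k (?u ** omega1 s) i j) \<circ> uminus has_vector_derivative (-1) *\<^sub>R (\<i> / 2 *
      (of_real (ladder k (Suc j)) * rep_SU2 k ?u i (Suc j) + of_real (ladder k j) * rep_SU2 k ?u i (j - 1)))) (at 0)"
    by (intro vector_diff_chain_at)
  moreover have "rep_SU2 k (?u ** omega1 (- s)) i j = rep_SO3 k (x ** rot1 s) i j" for s
    using rep_SO3_along[OF k j x omega_SU2(1)[of "- s"]] by (simp add: SU2_to_SO3_omega)
  ultimately show "((\<lambda>s. rep_SO3 k (x ** rot1 s) i j) has_vector_derivative - 1 * \<i> / 2 *
      (of_real (ladder k (Suc j)) * rep_SO3 k x i (Suc j) + of_real (ladder k j) * rep_SO3 k x i (j - 1))) (at 0)"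
    by (simp add: o_def rep_SO3_eq)
  have "rep_SU2 k (?u ** omega2 s) i j = rep_SO3 k (x ** rot2 s) i j" for s
    using rep_SO3_along[OF k j x omega_SU2(2)[of s]] by (simp add: SU2_to_SO3_omega)
  then show "((\<lambda>s. rep_SO3 k (x ** rot2 s) i j) has_vector_derivative 1 / 2 *
      (of_real (ladder k (Suc j)) * rep_SO3 k x i (Suc j) - of_real (ladder k j) * rep_SO3 k x i (j - 1))) (at 0)"
    using rep_SU2_has_vector_derivative[OF j omega_0(2) omega2_derivatives, of ?u i]
    by (simp add: algebra_simps rep_SO3_eq)
qed (use assms in auto)

section \<open>The operators as explicit series\<close>

text \<open>All entries of a column share one eigenvalue, so the diagonal symbol is that eigenvalue
  times the squared column norm 1. The base of the complex power is a real number \<ge> 1, where it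
  agrees with the real power.\<close>

lemma neg_power_symbol_spectral:
  assumes norm: "(\<Sum>h\<le>k. (cmod (t k x h i))\<^sup>2) = 1"
    and A: "\<And>h. A (\<lambda>y. t k y h i) x = - of_real (real i * real (k - i) + real k / 2) * t k x h i"
  shows "neg_power_symbol t A \<alpha> x k i i = of_real (spectral k i powr (- \<alpha> / 2))"
proof -
  let ?q = "complex_of_real (real i * real (k - i) + real k / 2)"
  have "op_symbol t A x k i i = - ?q * (\<Sum>h\<le>k. of_real ((cmod (t k x h i))\<^sup>2))"
    unfolding op_symbol_def A complex_norm_square sum_distrib_left by (intro sum.cong) (simp_all add: mult_ac)
  also have "\<dots> = - ?q" unfolding of_real_sum[symmetric] norm by simp
  finally have "1 - op_symbol t A x k i i = of_real (spectral k i)" by (simp add: spectral_def)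
  moreover have "of_real (spectral k i) powr (of_real (- \<alpha> / 2) :: complex) = of_real (spectral k i powr (- \<alpha> / 2))"
    using spectral_ge_1[of k i] by (intro powr_of_real) auto
  ultimately show ?thesis by (simp only: neg_power_symbol_def if_True refl)
qed

lemma quantization_neg_power_symbol:
  assumes "\<And>k j. k \<in> K \<Longrightarrow> j \<le> k \<Longrightarrow> neg_power_symbol t A \<alpha> x k j j = of_real (s k j)"
  shows "quantization K t \<mu> (neg_power_symbol t A \<alpha>) f x =
    (\<Sum>\<^sub>\<infinity>k\<in>K. of_nat (k + 1) * (\<Sum>i\<le>k. \<Sum>j\<le>k. t k x i j * of_real (s k j) * (\<integral>y. f y * cnj (t k y i j) \<partial>\<mu>)))"
  unfolding quantization_def
proof (intro infsum_cong arg_cong2[of _ _ _ _ "(*)"] refl sum.cong)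
  fix k i j assume k: "k \<in> K" and ij: "i \<in> {..k}" "j \<in> {..k}"
  have "(\<Sum>h\<le>k. t k x i j * neg_power_symbol t A \<alpha> x k j h * fourier_coeff t \<mu> f k h i) =
    (\<Sum>h\<le>k. if h = j then t k x i j * of_real (s k j) * fourier_coeff t \<mu> f k j i else 0)"
    using assms[OF k] ij by (intro sum.cong) (auto simp: neg_power_symbol_def)
  then show "(\<Sum>h\<le>k. t k x i j * neg_power_symbol t A \<alpha> x k j h * fourier_coeff t \<mu> f k h i) =
      t k x i j * of_real (s k j) * (\<integral>y. f y * cnj (t k y i j) \<partial>\<mu>)"
    using ij by (simp add: fourier_coeff_def)
qed

lemma sub_power_SU2_eq:
  assumes "u \<in> SU2"
  shows "sub_power_SU2 \<mu> \<alpha> f u = (\<Sum>\<^sub>\<infinity>k. of_nat (k + 1) * (\<Sum>i\<le>k. \<Sum>j\<le>k. rep_SU2 k u i j *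
    of_real (spectral k j powr (- \<alpha> / 2)) * (\<integral>y. f y * cnj (rep_SU2 k y i j) \<partial>\<mu>)))"
  unfolding sub_power_SU2_def
  using assms by (intro quantization_neg_power_symbol neg_power_symbol_spectral rep_SU2_column_norm sub_laplacian_SU2_rep)

lemma sub_power_SO3_eq:
  assumes "R \<in> SO3"
  shows "sub_power_SO3 \<mu> \<alpha> f R = (\<Sum>\<^sub>\<infinity>k\<in>{k. even k}. of_nat (k + 1) * (\<Sum>i\<le>k. \<Sum>j\<le>k. rep_SU2 k (SO3_lift R) i j *
    of_real (spectral k j powr (- \<alpha> / 2)) * (\<integral>y. f y * cnj (rep_SU2 k (SO3_lift y) i j) \<partial>\<mu>)))"
  unfolding sub_power_SO3_def rep_SO3_eq[symmetric]
proof (intro quantization_neg_power_symbol neg_power_symbol_spectral)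
  fix k j :: nat assume "k \<in> {k. even k}" "j \<le> k"
  then show "(\<Sum>h\<le>k. (cmod (rep_SO3 k R h j))\<^sup>2) = 1"
    "sub_laplacian_SO3 (\<lambda>y. rep_SO3 k y h j) R = - of_real (real j * real (k - j) + real k / 2) * rep_SO3 k R h j" for h
    using rep_SU2_column_norm[OF SO3_lift(1)[OF assms]] sub_laplacian_SO3_rep[OF _ assms] by (simp_all only: rep_SO3_eq mem_Collect_eq)
qed

section \<open>The three groups\<close>

lemma SU2_haar_uniform:
  assumes M: "normalized_haar SU2 (**) M" and h: "continuous_on {-1..1} (h :: real \<Rightarrow> real)"
  shows "(\<integral>u. h (1 - 2 * (cmod (u$1$2))\<^sup>2) \<partial>M) = integral {-1..1} h / 2"
proof -
  note sp = normalized_haar_space[OF M]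
  let ?N = "distr M (restrict_space borel SO3) SU2_to_SO3"
  have N: "normalized_haar SO3 (**) ?N" by (rule normalized_haar_SO3_of_SU2[OF M])
  have cm: "SU2_to_SO3 \<in> measurable M (restrict_space borel SO3)"
    using normalized_haar_measurable[OF M SU2_to_SO3_continuous_on] sp(1) SU2_to_SO3_in_SO3
    by (intro measurable_into_restrict) auto
  have "(\<lambda>R :: real^3^3. h (R$3$3)) \<in> borel_measurable (restrict_space borel SO3)"
  proof (intro borel_measurable_continuous_on_restrict continuous_on_compose2[OF h] continuous_intros subsetI)
    fix y assume "y \<in> (\<lambda>R :: real^3^3. R$3$3) ` SO3"
    then obtain R :: "real^3^3" where R: "R \<in> SO3" "y = R$3$3" by auto
    have "y\<^sup>2 \<le> 1"
      unfolding R(2) using SO3_column_norm[OF R(1), of 3] zero_le_power2[of "R$1$3"] zero_le_power2[of "R$2$3"] by linarith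
    then show "y \<in> {-1..1}" by (simp add: abs_square_le_1 abs_le_iff)
  qed
  then have "(\<integral>R. h (R$3$3) \<partial>?N) = (\<integral>u. h (SU2_to_SO3 u $3$3) \<partial>M)"
    using cm by (intro integral_distr)
  also have "\<dots> = (\<integral>u. h (1 - 2 * (cmod (u$1$2))\<^sup>2) \<partial>M)"
    using SU2_to_SO3_33 sp(1) by (intro Bochner_Integration.integral_cong) auto
  finally show ?thesis using SO3_haar_uniform[OF N h] by simp
qed

lemma r_nuclear_SU2:
  assumes M: "normalized_haar SU2 (**) M" and "0 < r" "r \<le> 1" "4 / r < \<alpha>" "1 \<le> p"
  shows "r_nuclear_on_Lp r p M (sub_power_SU2 M \<alpha>)"
proof -
  note sp = normalized_haar_space[OF M]
  interpret prob_space M by (rule sp(3))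
  interpret SU2_lift M "\<lambda>u. u" UNIV
  proof
    show "(\<lambda>u. rep_SU2 k u i j) \<in> borel_measurable M" for k i j
      by (rule normalized_haar_measurable[OF M rep_SU2_continuous_on])
    show "(\<lambda>u. 1 - 2 * (cmod (u$1$2))\<^sup>2) \<in> borel_measurable M"
      by (rule normalized_haar_measurable[OF M]) (intro continuous_intros)
  qed (use sp SU2_haar_uniform[OF M] in auto)
  show ?thesis
    using assms sub_power_SU2_eq sp(1) by (intro r_nuclear_lift) auto
qed

lemma r_nuclear_SO3:
  assumes M: "normalized_haar SO3 (**) M" and "0 < r" "r \<le> 1" "4 / r < \<alpha>" "1 \<le> p"
  shows "r_nuclear_on_Lp r p M (sub_power_SO3 M \<alpha>)"
proof -
  note sp = normalized_haar_space[OF M]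
  interpret prob_space M by (rule sp(3))
  \<comment> \<open>This quantity does not depend on the chosen preimage, so it is measurable
    although nothing is known about the lift.\<close>
  have R33: "1 - 2 * (cmod (SO3_lift R $1$2))\<^sup>2 = R$3$3" if "R \<in> SO3" for R
    using SU2_to_SO3_33[OF SO3_lift(1)[OF that]] SO3_lift(2)[OF that] by simp
  interpret SU2_lift M SO3_lift "{k. even k}"
  proof
    show "SO3_lift R \<in> SU2" if "R \<in> space M" for R using SO3_lift(1) that sp(1) by simp
    show "(\<lambda>R. rep_SU2 k (SO3_lift R) i j) \<in> borel_measurable M" if "k \<in> {k. even k}" "j \<le> k" for k i j
      using normalized_haar_measurable[OF M rep_SO3_continuous_on, of k j i] that by (simp add: rep_SO3_eq)
    have "(\<lambda>R :: real^3^3. R$3$3) \<in> borel_measurable M"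
      by (rule normalized_haar_measurable[OF M]) (intro continuous_intros)
    then show "(\<lambda>R. 1 - 2 * (cmod (SO3_lift R $1$2))\<^sup>2) \<in> borel_measurable M"
      using R33 sp(1) by (subst measurable_cong) auto
    show "(\<integral>R. h (1 - 2 * (cmod (SO3_lift R $1$2))\<^sup>2) \<partial>M) = integral {-1..1} h / 2"
      if "continuous_on {-1..1} h" for h :: "real \<Rightarrow> real"
    proof -
      have "(\<integral>R. h (1 - 2 * (cmod (SO3_lift R $1$2))\<^sup>2) \<partial>M) = (\<integral>R. h (R$3$3) \<partial>M)"
        using R33 sp(1) by (intro Bochner_Integration.integral_cong) auto
      then show ?thesis using SO3_haar_uniform[OF M that] by simp
    qed
  qed
  show ?thesis
    using assms sub_power_SO3_eq sp(1) by (intro r_nuclear_lift) auto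
qed

lemma r_nuclear_S3:
  assumes M: "normalized_haar S3 quat_mult M" and "0 < r" "r \<le> 1" "4 / r < \<alpha>" "1 \<le> p"
  shows "r_nuclear_on_Lp r p M (sub_power_S3 M \<alpha>)"
proof -
  note sp = normalized_haar_space[OF M]
  interpret prob_space M by (rule sp(3))
  let ?N = "distr M (restrict_space borel SU2) quat_to_SU2"
  have N: "normalized_haar SU2 (**) ?N" by (rule normalized_haar_SU2_of_S3[OF M])
  have qm: "quat_to_SU2 \<in> measurable M (restrict_space borel SU2)"
    using normalized_haar_measurable[OF M quat_to_SU2_continuous_on] sp(1)
    by (intro measurable_into_restrict) (auto simp: quat_to_SU2_in_SU2_iff)
  have inv: "inv_into S3 quat_to_SU2 u = SU2_to_quat u" if "u \<in> SU2" for u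
  proof (rule inv_into_f_eq)
    show "inj_on quat_to_SU2 S3" by (metis inj_onI quat_to_SU2_inverse)
  qed (use that SU2_to_quat_in_S3 SU2_to_quat_inverse in auto)
  have integral_N: "(\<integral>u. g u \<partial>?N) = (\<integral>x. g (quat_to_SU2 x) \<partial>M)"
    if "g \<in> borel_measurable (restrict_space borel SU2)" for g :: "complex^2^2 \<Rightarrow> 'b::{banach, second_countable_topology}"
    using qm that by (intro integral_distr)
  have SU2_to_quat_meas: "SU2_to_quat \<in> measurable (restrict_space borel SU2) M"
  proof -
    have "continuous_on SU2 SU2_to_quat"
    proof -
      have eq: "SU2_to_quat u = (\<chi> i. if i = 1 then Re (u$1$1) else if i = 2 then Re (u$1$2)
          else if i = 3 then Im (u$1$2) else Im (u$1$1))" for u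
        by (simp add: SU2_to_quat_def vec_eq_iff forall_4 vector_4_nth)
      have "continuous_on SU2 (\<lambda>u. if i = 1 then Re (u$1$1) else if i = 2 then Re (u$1$2)
          else if i = 3 then Im (u$1$2) else Im (u$1$1))" for i :: 4
        by (cases "i = 1"; cases "i = 2"; cases "i = 3") (auto intro!: continuous_intros)
      then show ?thesis unfolding eq[abs_def] by (intro continuous_on_vec_lambda)
    qed
    then have "SU2_to_quat \<in> measurable (restrict_space borel SU2) (restrict_space borel S3)"
      using SU2_to_quat_in_S3
      by (intro measurable_into_restrict borel_measurable_continuous_on_restrict) (auto simp: space_restrict_space)
    then show ?thesis using sp(2) by (simp cong: measurable_cong_sets)
  qed
  interpret SU2_lift M quat_to_SU2 UNIV
  proof
    show "quat_to_SU2 x \<in> SU2" if "x \<in> space M" for x using that sp(1) by (simp add: quat_to_SU2_in_SU2_iff)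
    show "(\<lambda>x. rep_SU2 k (quat_to_SU2 x) i j) \<in> borel_measurable M" for k i j
      by (rule normalized_haar_measurable[OF M continuous_on_compose2[OF rep_SU2_continuous_on quat_to_SU2_continuous_on]]) auto
    have cont: "continuous_on UNIV (\<lambda>u :: complex^2^2. 1 - 2 * (cmod (u$1$2))\<^sup>2)" by (intro continuous_intros)
    show "(\<lambda>x. 1 - 2 * (cmod (quat_to_SU2 x $1$2))\<^sup>2) \<in> borel_measurable M"
      by (rule normalized_haar_measurable[OF M continuous_on_compose2[OF cont quat_to_SU2_continuous_on]]) auto
    show "(\<integral>x. h (1 - 2 * (cmod (quat_to_SU2 x $1$2))\<^sup>2) \<partial>M) = integral {-1..1} h / 2"
      if h: "continuous_on {-1..1} h" for h :: "real \<Rightarrow> real"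
    proof -
      have "(\<lambda>u :: complex^2^2. h (1 - 2 * (cmod (u$1$2))\<^sup>2)) \<in> borel_measurable (restrict_space borel SU2)"
      proof (intro borel_measurable_continuous_on_restrict continuous_on_compose2[OF h] continuous_intros subsetI)
        fix y assume "y \<in> (\<lambda>u :: complex^2^2. 1 - 2 * (cmod (u$1$2))\<^sup>2) ` SU2"
        then obtain u where u: "u \<in> SU2" "y = 1 - 2 * (cmod (u$1$2))\<^sup>2" by auto
        have "(cmod (u$1$2))\<^sup>2 \<le> 1"
          using u(1) zero_le_power2[of "cmod (u$1$1)"] unfolding SU2_iff by linarith
        then show "y \<in> {-1..1}" using u(2) by simp
      qed
      from integral_N[OF this] show ?thesis using SU2_haar_uniform[OF N h] by simp
    qed
  qed
  show ?thesis
  proof (rule r_nuclear_lift)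
    fix f x assume f: "f \<in> Lp_space p M" and x: "x \<in> space M"
    \<comment> \<open>The integral over the image measure is pulled back to the sphere. On SU(2) the
      chosen inverse is replaced by the continuous \<open>SU2_to_quat\<close>, which makes the
      integrand measurable.\<close>
    have coef: "(\<integral>u. (f \<circ> inv_into S3 quat_to_SU2) u * cnj (rep_SU2 k u i j) \<partial>?N) =
        (\<integral>y. f y * cnj (rep_SU2 k (quat_to_SU2 y) i j) \<partial>M)" for k i j
    proof -
      have "(\<integral>u. (f \<circ> inv_into S3 quat_to_SU2) u * cnj (rep_SU2 k u i j) \<partial>?N) =
          (\<integral>u. f (SU2_to_quat u) * cnj (rep_SU2 k u i j) \<partial>?N)"
        using inv by (intro Bochner_Integration.integral_cong) (auto simp: space_restrict_space)
      also have "\<dots> = (\<integral>y. f (SU2_to_quat (quat_to_SU2 y)) * cnj (rep_SU2 k (quat_to_SU2 y) i j) \<partial>M)"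
      proof (rule integral_N)
        have "(\<lambda>u. f (SU2_to_quat u)) \<in> borel_measurable (restrict_space borel SU2)"
          using measurable_compose[OF SU2_to_quat_meas] f by (auto simp: Lp_space_def)
        moreover have "(\<lambda>u. rep_SU2 k u i j) \<in> borel_measurable (restrict_space borel SU2)"
          by (rule borel_measurable_continuous_on_restrict[OF rep_SU2_continuous_on])
        ultimately show "(\<lambda>u. f (SU2_to_quat u) * cnj (rep_SU2 k u i j)) \<in> borel_measurable (restrict_space borel SU2)"
          by (intro borel_measurable_times borel_measurable_cnj)
      qed
      finally show ?thesis by (simp add: quat_to_SU2_inverse)
    qed
    have "quat_to_SU2 x \<in> SU2" using x sp(1) by (simp add: quat_to_SU2_in_SU2_iff)
    then show "sub_power_S3 M \<alpha> f x = (\<Sum>\<^sub>\<infinity>k. of_nat (k + 1) * (\<Sum>i\<le>k. \<Sum>j\<le>k. rep_SU2 k (quat_to_SU2 x) i j *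
        of_real (spectral k j powr (- \<alpha> / 2)) * (\<integral>y. f y * cnj (rep_SU2 k (quat_to_SU2 y) i j) \<partial>M)))"
      unfolding sub_power_S3_def by (simp only: sub_power_SU2_eq coef)
  qed (use assms in auto)
qed

theorem corollary3p20:
  fixes r \<alpha> p :: real
    and \<mu>_SO3 :: "(real^3^3) measure"
    and \<mu>_SU2 :: "(complex^2^2) measure"
    and \<mu>_S3 :: "(real^4) measure"
  assumes "0 < r" and "r \<le> 1"
    and "\<alpha> > 4 / r"
    and "1 \<le> p"
    and "normalized_haar SO3 (**) \<mu>_SO3"
    and "normalized_haar SU2 (**) \<mu>_SU2"
    and "normalized_haar S3 quat_mult \<mu>_S3"
  shows "r_nuclear_on_Lp r p \<mu>_SO3 (sub_power_SO3 \<mu>_SO3 \<alpha>) \<and>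
         r_nuclear_on_Lp r p \<mu>_SU2 (sub_power_SU2 \<mu>_SU2 \<alpha>) \<and>
         r_nuclear_on_Lp r p \<mu>_S3 (sub_power_S3 \<mu>_S3 \<alpha>)"
  using assms r_nuclear_SO3 r_nuclear_SU2 r_nuclear_S3 by blast

end
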